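(* Let $m\ge3$ and $\mathbb R^m=\mathbb R^2\oplus\mathbb R^{m-2}$, $x=u+v$ with $u=u_1e_1+u_2e_2\in\mathbb R^2$ and $v\in\mathbb R^{m-2}$; put $z=u_1+\mathrm i u_2$, $\bar z=u_1-\mathrm i u_2$. For $s,k,i\in\mathbb N$ consider the following subspaces of $\mathcal M(\mathbb R^m,\mathbb C_m)$, where in each case one takes the linear span over all $Q_i\in\mathcal M_i(\mathbb R^{m-2},\mathbb C_{m-2})$ and over the two indicated choices of $X$: (a) $P_M(\bar z^{s}z^{k+s}XQ_i(v))$, $X\in\{I_+,T_+\}$; (b) $P_M(z^{s}\bar z^{k+s}XQ_i(v))$, $X\in\{I_-,T_-\}$; (c) $P_M(\bar z^{s}z^{k+s+1}XQ_i(v))$, $X\in\{T_-,I_-\}$; (d) $P_M(z^{s}\bar z^{k+s+1}XQ_i(v))$, $X\in\{T_+,I_+\}$. Then $\mathcal M(\mathbb R^m,\mathbb C_m)$ is the direct sum of these $\mathrm{Spin}(2)\times\mathrm{Spin}(m-2)$-invariant summands (over all $s,k,i\in\mathbb N$ and all four types), each of them occurring exactly once, and they are eigenspaces of the three commuting operators $S_u=\mathrm iM_{12}$, $S_v=\mathrm ie_{12}(\Gamma_v-\frac{m-3}2)$ and $\Gamma_x-\frac{m-1}2$, with eigenvalues (in this order): (a) $-(k+\frac12),\ -(i+\frac{m-3}2),\ -(k+i+2s+\frac{m-1}2)$; (b) $(k+\frac12),\ (i+\frac{m-3}2),\ -(k+i+2s+\frac{m-1}2)$; (c) $-(k+\frac12),\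 (i+\frac{m-3}2),\ -(k+i+2s+1+\frac{m-1}2)$; (d) $(k+\frac12),\ -(i+\frac{m-3}2),\ -(k+i+2s+1+\frac{m-1}2)$.
   Context: $\mathbb N=\{0,1,2,\dots\}$; $\mathrm i$ is the imaginary unit, while $i$ denotes an index. $\mathbb C_m$ is the complex Clifford algebra generated by $e_1,\dots,e_m$ with $e_ae_b+e_be_a=-2\delta_{ab}$; $\mathbb C_2$ is the subalgebra generated by $e_1,e_2$ and $\mathbb C_{m-2}$ the subalgebra generated by $e_3,\dots,e_m$ (a basis of $\mathbb R^{m-2}$); $e_{12}=e_1e_2$. In $\mathbb C_2$: $T_\pm=\frac12(e_1\pm\mathrm ie_2)$, $I_+=-T_+T_-=\frac12(1+\mathrm ie_{12})$, $I_-=-T_-T_+=\frac12(1-\mathrm ie_{12})$. $\mathcal P(\mathbb R^m,\mathbb C_m)$ is the space of $\mathbb C_m$-valued polynomials, $x=\sum_{j}x_je_j$ (with $x_1=u_1$, $x_2=u_2$), $v=\sum_{j\ge3}x_je_j$, $\partial_x=\sum_{j=1}^me_j\partial_{x_j}$, $\partial_v=\sum_{j\ge3}e_j\partial_{x_j}$, Clifford elements acting by left multiplication. $\mathcal M(\mathbb R^m,\mathbb C_m)=\ker\partial_x$ on $\mathcal P(\mathbb R^m,\mathbb C_m)$; $\mathcal M_i(\mathbb R^{m-2},\mathbb C_{m-2})$ is the space of $\mathbb C_{m-2}$-valued polynomials in $v$, homogeneous of degree $i$ and annihilated by $\partial_v$. $P_M$ is the projection of $\mathcal P(\mathbb R^m,\mathbb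 C_m)$ onto the $s=0$ summand of the Fischer decomposition $\mathcal P(\mathbb R^m,\mathbb C_m)=\bigoplus_{s\ge0}x^s\mathcal M(\mathbb R^m,\mathbb C_m)$. $M_{12}=u_1\partial_{u_2}-u_2\partial_{u_1}-\frac12e_{12}$, $\Gamma_x=\frac12([\partial_x,x]+m)$, $\Gamma_v=\frac12([\partial_v,v]+m-2)$ (operator commutators). $\mathrm{Spin}(d)$ (products of an even number of unit vectors of $\mathbb R^d$) acts on Clifford-valued polynomials by $L(s)P(x)=sP(s^{-1}xs)$; $\mathrm{Spin}(2)\times\mathrm{Spin}(m-2)$ acts through $(s,t)\mapsto L(st)$. "Eigenspace" here means that the listed subspace consists of simultaneous eigenvectors with the listed eigenvalues. *)

theory Defs
  imports Complex_Main "HOL-Library.Function_Algebras"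
begin

section \<open>The complex Clifford algebra on generators indexed by natural numbers\<close>

text \<open>An element is the finitely supported family of its coefficients with respect to the blades
  \<open>e\<^sub>A = e\<^sub>a\<^sub>1 \<cdots> e\<^sub>a\<^sub>p\<close>, \<open>A = {a\<^sub>1 < \<dots> < a\<^sub>p}\<close> a finite set of indices.  The algebra of
  dimension \<open>2\<^sup>m\<close> generated by \<open>e\<^sub>1, \<dots>, e\<^sub>m\<close> is the subalgebra \<open>cliff {1..m}\<close> below.\<close>

typedef clifford =
  "{a :: nat set \<Rightarrow> complex. finite {A. a A \<noteq> 0} \<and> (\<forall>A. a A \<noteq> 0 \<longrightarrow> finite A)}"
  morphisms coef Abs_clifford
  by (rule exI[of _ "\<lambda>_. 0"]) simp

lemma clifford_eqI: "(\<And>C. coef a C = coef b C) \<Longrightarrow> a = b"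
  by (metis coef_inject ext)

lemma finite_coef: "finite {A. coef a A \<noteq> 0}"
  using coef[of a] by simp

lemma coef_infinite: "coef a A \<noteq> 0 \<Longrightarrow> finite A"
  using coef[of a] by simp

definition symdiff :: "nat set \<Rightarrow> nat set \<Rightarrow> nat set" where
  "symdiff A B = (A - B) \<union> (B - A)"

text \<open>\<open>e\<^sub>A e\<^sub>B = blade_sign A B \<cdot> e\<^bsub>symdiff A B\<^esub>\<close>: every pair \<open>b < a\<close> costs a transposition and
  every pair \<open>b = a\<close> a factor \<open>e\<^sub>a\<^sup>2 = -1\<close>.\<close>

definition blade_sign :: "nat set \<Rightarrow> nat set \<Rightarrow> complex" where
  "blade_sign A B = (- 1) ^ card {(a, b). a \<in> A \<and> b \<in> B \<and> b \<le> a}"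

instantiation clifford :: "{zero, one, plus, uminus, minus, times}"
begin

definition "0 = Abs_clifford (\<lambda>A. 0)"
definition "1 = Abs_clifford (\<lambda>A. if A = {} then 1 else 0)"
definition "a + b = Abs_clifford (\<lambda>A. coef a A + coef b A)"
definition "- a = Abs_clifford (\<lambda>A. - coef a A)"
definition "a - b = Abs_clifford (\<lambda>A. coef a A - coef b A)"
definition "a * b = Abs_clifford (\<lambda>C. \<Sum>A | coef a A \<noteq> 0. \<Sum>B | coef b B \<noteq> 0.
    if symdiff A B = C then blade_sign A B * coef a A * coef b B else 0)"

instance ..

end

lemma coef_zero [simp]: "coef 0 A = 0"
  by (simp add: zero_clifford_def Abs_clifford_inverse)

lemma coef_one: "coef 1 A = (if A = {} then 1 else 0)"
  by (simp add: one_clifford_def Abs_clifford_inverse)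

lemma coef_add [simp]: "coef (a + b) A = coef a A + coef b A"
proof -
  have "{A. coef a A + coef b A \<noteq> 0} \<subseteq> {A. coef a A \<noteq> 0} \<union> {A. coef b A \<noteq> 0}" by auto
  then have "finite {A. coef a A + coef b A \<noteq> 0}"
    by (rule finite_subset) (simp add: finite_coef)
  moreover have "\<forall>A. coef a A + coef b A \<noteq> 0 \<longrightarrow> finite A"
    using coef_infinite by (metis add.right_neutral)
  ultimately show ?thesis by (simp add: plus_clifford_def Abs_clifford_inverse)
qed

lemma coef_uminus [simp]: "coef (- a) A = - coef a A"
  using coef[of a] by (simp add: uminus_clifford_def Abs_clifford_inverse)

lemma coef_minus [simp]: "coef (a - b) A = coef a A - coef b A"
proof -
  have "a - b = a + (- b)" by (simp add: plus_clifford_def minus_clifford_def)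
  then show ?thesis by simp
qed

lemma coef_mult: "coef (a * b) C = (\<Sum>A | coef a A \<noteq> 0. \<Sum>B | coef b B \<noteq> 0.
    if symdiff A B = C then blade_sign A B * coef a A * coef b B else 0)"
proof -
  let ?f = "\<lambda>C. \<Sum>A | coef a A \<noteq> 0. \<Sum>B | coef b B \<noteq> 0.
    if symdiff A B = C then blade_sign A B * coef a A * coef b B else 0"
  have *: "C \<in> (\<lambda>(A, B). symdiff A B) ` ({A. coef a A \<noteq> 0} \<times> {B. coef b B \<noteq> 0})"
    if "?f C \<noteq> 0" for C
  proof (rule ccontr)
    assume "\<not> ?thesis"
    then have "symdiff A B \<noteq> C" if "coef a A \<noteq> 0" "coef b B \<noteq> 0" for A B
      using that by force
    then have "?f C = 0" by (intro sum.neutral ballI) auto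
    with that show False by contradiction
  qed
  then have "{C. ?f C \<noteq> 0} \<subseteq>
      (\<lambda>(A, B). symdiff A B) ` ({A. coef a A \<noteq> 0} \<times> {B. coef b B \<noteq> 0})"
    by (intro subsetI) (simp only: mem_Collect_eq)
  then have "finite {C. ?f C \<noteq> 0}"
    by (rule finite_subset) (simp add: finite_coef)
  moreover have "\<forall>C. ?f C \<noteq> 0 \<longrightarrow> finite C"
  proof (intro allI impI)
    fix C assume "?f C \<noteq> 0"
    from *[OF this] obtain A B where "coef a A \<noteq> 0" "coef b B \<noteq> 0" "C = symdiff A B"
      by auto
    then show "finite C" using coef_infinite[of a A] coef_infinite[of b B]
      by (simp add: symdiff_def)
  qed
  ultimately show ?thesis by (simp add: times_clifford_def Abs_clifford_inverse)
qed

lemma coef_mult_supersets: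
  assumes "finite S" "finite T" "\<And>A. coef a A \<noteq> 0 \<Longrightarrow> A \<in> S" "\<And>A. coef b A \<noteq> 0 \<Longrightarrow> A \<in> T"
  shows "coef (a * b) C = (\<Sum>A\<in>S. \<Sum>B\<in>T.
    if symdiff A B = C then blade_sign A B * coef a A * coef b B else 0)"
  unfolding coef_mult
proof (rule sum.mono_neutral_cong_left)
  show "(\<Sum>B | coef b B \<noteq> 0. if symdiff A B = C then blade_sign A B * coef a A * coef b B else 0)
     = (\<Sum>B\<in>T. if symdiff A B = C then blade_sign A B * coef a A * coef b B else 0)" for A
    by (rule sum.mono_neutral_left) (use assms in auto)
  show "\<forall>A\<in>S - {A. coef a A \<noteq> 0}. (\<Sum>B\<in>T.
      if symdiff A B = C then blade_sign A B * coef a A * coef b B else 0) = 0"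
    by (intro ballI sum.neutral) auto
qed (use assms in auto)

lemma coef_mult_Pow:
  assumes "finite U" "\<And>A. coef a A \<noteq> 0 \<Longrightarrow> A \<subseteq> U" "\<And>A. coef b A \<noteq> 0 \<Longrightarrow> A \<subseteq> U"
  shows "coef (a * b) C = (\<Sum>A\<in>Pow U. \<Sum>B\<in>Pow U.
    if symdiff A B = C then blade_sign A B * coef a A * coef b B else 0)"
  by (rule coef_mult_supersets) (use assms in auto)

lemma neg_one_power_symdiff:
  assumes "finite X" "finite Y"
  shows "(- 1 :: complex) ^ card ((X - Y) \<union> (Y - X)) = (- 1) ^ card X * (- 1) ^ card Y"
proof -
  have "card X = card (X - Y) + card (X \<inter> Y)" "card Y = card (Y - X) + card (X \<inter> Y)"
    using card_Int_Diff[OF assms(1), of Y] card_Int_Diff[OF assms(2), of X]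
    by (simp_all add: Int_commute[of Y X])
  moreover have "card ((X - Y) \<union> (Y - X)) = card (X - Y) + card (Y - X)"
    using assms by (intro card_Un_disjoint) auto
  moreover have "(- 1 :: complex) ^ (p + r) * (- 1) ^ (q + r) = (- 1) ^ (p + q)" for p q r :: nat
    by (cases "even p"; cases "even q"; cases "even r") simp_all
  ultimately show ?thesis by simp
qed

lemma finite_pairs:
  assumes "finite A" "finite B"
  shows "finite {(a, b). a \<in> A \<and> b \<in> B \<and> b \<le> (a::nat)}"
  by (rule finite_subset[of _ "A \<times> B"]) (use assms in auto)

lemma blade_sign_symdiff_left:
  assumes "finite A" "finite B" "finite C"
  shows "blade_sign (symdiff A B) C = blade_sign A C * blade_sign B C"
proof -
  have "{(a, b). a \<in> symdiff A B \<and> b \<in> C \<and> b \<le> a} =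
      ({(a, b). a \<in> A \<and> b \<in> C \<and> b \<le> a} - {(a, b). a \<in> B \<and> b \<in> C \<and> b \<le> a}) \<union>
      ({(a, b). a \<in> B \<and> b \<in> C \<and> b \<le> a} - {(a, b). a \<in> A \<and> b \<in> C \<and> b \<le> a})"
    by (auto simp: symdiff_def)
  then show ?thesis
    using assms by (simp add: blade_sign_def neg_one_power_symdiff finite_pairs)
qed

lemma blade_sign_symdiff_right:
  assumes "finite A" "finite B" "finite C"
  shows "blade_sign A (symdiff B C) = blade_sign A B * blade_sign A C"
proof -
  have "{(a, b). a \<in> A \<and> b \<in> symdiff B C \<and> b \<le> a} =
      ({(a, b). a \<in> A \<and> b \<in> B \<and> b \<le> a} - {(a, b). a \<in> A \<and> b \<in> C \<and> b \<le> a}) \<union>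
      ({(a, b). a \<in> A \<and> b \<in> C \<and> b \<le> a} - {(a, b). a \<in> A \<and> b \<in> B \<and> b \<le> a})"
    by (auto simp: symdiff_def)
  then show ?thesis
    using assms by (simp add: blade_sign_def neg_one_power_symdiff finite_pairs)
qed

lemma symdiff_assoc: "symdiff (symdiff A B) C = symdiff A (symdiff B C)"
  by (auto simp: symdiff_def)

lemma clifford_support:
  obtains U where "finite U" "\<And>A. coef a A \<noteq> 0 \<Longrightarrow> A \<subseteq> U"
proof (rule that)
  show "finite (\<Union>{A. coef a A \<noteq> 0})"
    using finite_coef coef_infinite by blast
qed blast

lemma coef_mult_subset:
  assumes "finite U" "\<And>A. coef a A \<noteq> 0 \<Longrightarrow> A \<subseteq> U" "\<And>A. coef b A \<noteq> 0 \<Longrightarrow> A \<subseteq> U"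
    and "coef (a * b) C \<noteq> 0"
  shows "C \<subseteq> U"
proof (rule ccontr)
  assume "\<not> C \<subseteq> U"
  then have "symdiff A B \<noteq> C" if "A \<in> Pow U" "B \<in> Pow U" for A B
    using that by (auto simp: symdiff_def)
  then have "coef (a * b) C = 0"
    by (subst coef_mult_Pow[OF assms(1-3)]) (auto intro!: sum.neutral)
  with assms(4) show False by simp
qed

lemma sum_symdiff_delta:
  assumes "finite U" "A \<subseteq> U" "B \<subseteq> U"
  shows "(\<Sum>E\<in>Pow U. if symdiff A B = E then g E else (0::complex)) = g (symdiff A B)"
proof -
  have "symdiff A B \<in> Pow U" using assms by (auto simp: symdiff_def)
  then show ?thesis using assms(1) by (simp add: sum.delta')
qed

lemma clifford_mult_assoc: "(a * b) * c = a * (b * c)" for a b c :: clifford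
proof (rule clifford_eqI)
  fix D
  obtain U1 U2 U3 where U123: "finite U1" "\<And>A. coef a A \<noteq> 0 \<Longrightarrow> A \<subseteq> U1"
    "finite U2" "\<And>A. coef b A \<noteq> 0 \<Longrightarrow> A \<subseteq> U2"
    "finite U3" "\<And>A. coef c A \<noteq> 0 \<Longrightarrow> A \<subseteq> U3"
    by (metis clifford_support)
  define U where "U = U1 \<union> U2 \<union> U3"
  have U: "finite U" "\<And>A. coef a A \<noteq> 0 \<Longrightarrow> A \<subseteq> U" "\<And>A. coef b A \<noteq> 0 \<Longrightarrow> A \<subseteq> U"
    "\<And>A. coef c A \<noteq> 0 \<Longrightarrow> A \<subseteq> U"
    using U123 unfolding U_def by blast+
  have fin: "finite A" if "A \<in> Pow U" for A using that U(1) finite_subset by auto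
  let ?t = "\<lambda>A B C. if symdiff (symdiff A B) C = D
    then blade_sign A B * blade_sign A C * blade_sign B C * coef a A * coef b B * coef c C else 0"
  have "coef ((a * b) * c) D = (\<Sum>E\<in>Pow U. \<Sum>C\<in>Pow U.
      if symdiff E C = D then blade_sign E C * coef (a * b) E * coef c C else 0)"
    by (rule coef_mult_Pow) (use U coef_mult_subset in blast)+
  also have "\<dots> = (\<Sum>C\<in>Pow U. \<Sum>E\<in>Pow U. \<Sum>A\<in>Pow U. \<Sum>B\<in>Pow U. if symdiff A B = E then
      if symdiff E C = D then blade_sign E C * (blade_sign A B * coef a A * coef b B) * coef c C
        else 0 else 0)"
  proof (subst sum.swap, intro sum.cong refl)
    fix C E
    show "(if symdiff E C = D then blade_sign E C * coef (a * b) E * coef c C else 0) =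
      (\<Sum>A\<in>Pow U. \<Sum>B\<in>Pow U. if symdiff A B = E then if symdiff E C = D
        then blade_sign E C * (blade_sign A B * coef a A * coef b B) * coef c C else 0 else 0)"
    proof (cases "symdiff E C = D")
      case True
      then show ?thesis
        by (auto simp: coef_mult_Pow[OF U(1,2,3)] sum_distrib_left sum_distrib_right
          intro!: sum.cong)
    qed (simp cong: if_cong)
  qed
  also have "\<dots> = (\<Sum>C\<in>Pow U. \<Sum>A\<in>Pow U. \<Sum>B\<in>Pow U. \<Sum>E\<in>Pow U. if symdiff A B = E then
      if symdiff E C = D then blade_sign E C * (blade_sign A B * coef a A * coef b B) * coef c C
        else 0 else 0)"
    by (rule sum.cong[OF refl], subst sum.swap, rule sum.cong[OF refl], rule sum.swap)
  also have "\<dots> = (\<Sum>C\<in>Pow U. \<Sum>A\<in>Pow U. \<Sum>B\<in>Pow U. ?t A B C)"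
    by (intro sum.cong refl, subst sum_symdiff_delta)
      (auto simp: U(1) fin blade_sign_symdiff_left)
  also have "\<dots> = (\<Sum>A\<in>Pow U. \<Sum>C\<in>Pow U. \<Sum>B\<in>Pow U. ?t A B C)" by (rule sum.swap)
  also have "\<dots> = (\<Sum>A\<in>Pow U. \<Sum>B\<in>Pow U. \<Sum>C\<in>Pow U. ?t A B C)"
    by (rule sum.cong[OF refl], rule sum.swap)
  finally have L: "coef ((a * b) * c) D = (\<Sum>A\<in>Pow U. \<Sum>B\<in>Pow U. \<Sum>C\<in>Pow U. ?t A B C)" .
  have "coef (a * (b * c)) D = (\<Sum>A\<in>Pow U. \<Sum>E\<in>Pow U.
      if symdiff A E = D then blade_sign A E * coef a A * coef (b * c) E else 0)"
    by (rule coef_mult_Pow) (use U coef_mult_subset in blast)+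
  also have "\<dots> = (\<Sum>A\<in>Pow U. \<Sum>E\<in>Pow U. \<Sum>B\<in>Pow U. \<Sum>C\<in>Pow U. if symdiff B C = E then
      if symdiff A E = D then blade_sign A E * coef a A * (blade_sign B C * coef b B * coef c C)
        else 0 else 0)"
  proof (intro sum.cong refl)
    fix A E
    show "(if symdiff A E = D then blade_sign A E * coef a A * coef (b * c) E else 0) =
      (\<Sum>B\<in>Pow U. \<Sum>C\<in>Pow U. if symdiff B C = E then if symdiff A E = D
        then blade_sign A E * coef a A * (blade_sign B C * coef b B * coef c C) else 0 else 0)"
    proof (cases "symdiff A E = D")
      case True
      then show ?thesis
        by (auto simp: coef_mult_Pow[OF U(1,3,4)] sum_distrib_left sum_distrib_right
          intro!: sum.cong)
    qed (simp cong: if_cong)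
  qed
  also have "\<dots> = (\<Sum>A\<in>Pow U. \<Sum>B\<in>Pow U. \<Sum>C\<in>Pow U. \<Sum>E\<in>Pow U. if symdiff B C = E then
      if symdiff A E = D then blade_sign A E * coef a A * (blade_sign B C * coef b B * coef c C)
        else 0 else 0)"
    by (rule sum.cong[OF refl], subst sum.swap, rule sum.cong[OF refl], rule sum.swap)
  also have "\<dots> = (\<Sum>A\<in>Pow U. \<Sum>B\<in>Pow U. \<Sum>C\<in>Pow U. ?t A B C)"
    by (intro sum.cong refl, subst sum_symdiff_delta)
      (auto simp: U(1) fin blade_sign_symdiff_right symdiff_assoc)
  finally show "coef ((a * b) * c) D = coef (a * (b * c)) D" using L by simp
qed

lemma blade_sign_empty [simp]: "blade_sign {} B = 1" "blade_sign A {} = 1"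
  by (simp_all add: blade_sign_def)

lemma symdiff_empty [simp]: "symdiff {} B = B" "symdiff A {} = A"
  by (simp_all add: symdiff_def)

instance clifford :: ring_1
proof
  fix a b c :: clifford
  show "a * b * c = a * (b * c)" by (rule clifford_mult_assoc)
  show "1 * a = a"
    by (rule clifford_eqI, subst coef_mult_supersets[of "{{}}" "{A. coef a A \<noteq> 0}"])
      (auto simp: coef_one finite_coef split: if_splits)
  show "a * 1 = a"
    by (rule clifford_eqI, subst coef_mult_supersets[of "{A. coef a A \<noteq> 0}" "{{}}"])
      (auto simp: coef_one finite_coef split: if_splits)
  show "(0::clifford) \<noteq> 1"
    by (metis coef_one coef_zero zero_neq_one)
  obtain U1 U2 U3 where U123: "finite U1" "\<And>A. coef a A \<noteq> 0 \<Longrightarrow> A \<subseteq> U1"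
    "finite U2" "\<And>A. coef b A \<noteq> 0 \<Longrightarrow> A \<subseteq> U2"
    "finite U3" "\<And>A. coef c A \<noteq> 0 \<Longrightarrow> A \<subseteq> U3"
    by (metis clifford_support)
  define U where "U = U1 \<union> U2 \<union> U3"
  have U: "finite U" "\<And>A. coef a A \<noteq> 0 \<Longrightarrow> A \<subseteq> U" "\<And>A. coef b A \<noteq> 0 \<Longrightarrow> A \<subseteq> U"
    "\<And>A. coef c A \<noteq> 0 \<Longrightarrow> A \<subseteq> U"
    using U123 unfolding U_def by blast+
  have ab: "\<And>A. coef (a + b) A \<noteq> 0 \<Longrightarrow> A \<subseteq> U" and bc: "\<And>A. coef (b + c) A \<noteq> 0 \<Longrightarrow> A \<subseteq> U"
    using U by (metis add.right_neutral coef_add)+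
  show "(a + b) * c = a * c + b * c"
  proof (rule clifford_eqI)
    fix C
    have "coef ((a + b) * c) C = (\<Sum>A\<in>Pow U. \<Sum>B\<in>Pow U.
        if symdiff A B = C then blade_sign A B * coef (a + b) A * coef c B else 0)"
      by (rule coef_mult_Pow) (use U(1,4) ab in auto)
    also have "\<dots> = coef (a * c) C + coef (b * c) C"
      by (simp add: coef_mult_Pow[OF U(1,2,4)] coef_mult_Pow[OF U(1,3,4)]
          flip: sum.distrib) (intro sum.cong refl, simp add: algebra_simps)
    finally show "coef ((a + b) * c) C = coef (a * c + b * c) C" by simp
  qed
  show "a * (b + c) = a * b + a * c"
  proof (rule clifford_eqI)
    fix C
    have "coef (a * (b + c)) C = (\<Sum>A\<in>Pow U. \<Sum>B\<in>Pow U.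
        if symdiff A B = C then blade_sign A B * coef a A * coef (b + c) B else 0)"
      by (rule coef_mult_Pow) (use U(1,2) bc in auto)
    also have "\<dots> = coef (a * b) C + coef (a * c) C"
      by (simp add: coef_mult_Pow[OF U(1,2,3)] coef_mult_Pow[OF U(1,2,4)]
          flip: sum.distrib) (intro sum.cong refl, simp add: algebra_simps)
    finally show "coef (a * (b + c)) C = coef (a * b + a * c) C" by simp
  qed
qed (rule clifford_eqI, simp)+

definition scal :: "complex \<Rightarrow> clifford" where
  "scal c = Abs_clifford (\<lambda>A. if A = {} then c else 0)"

definition gen :: "nat \<Rightarrow> clifford" where
  "gen j = Abs_clifford (\<lambda>A. if A = {j} then 1 else 0)"

lemma coef_scal: "coef (scal c) A = (if A = {} then c else 0)"
proof -
  have "finite {A::nat set. A = {} \<and> c \<noteq> 0}" by simp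
  then show ?thesis by (simp add: scal_def Abs_clifford_inverse)
qed

lemma coef_gen: "coef (gen j) A = (if A = {j} then 1 else 0)"
  by (simp add: gen_def Abs_clifford_inverse)

lemma coef_scal_mult [simp]: "coef (scal c * a) A = c * coef a A"
  by (subst coef_mult_supersets[of "{{}}" "{A. coef a A \<noteq> 0}"])
    (auto simp: coef_scal finite_coef split: if_splits)

lemma coef_mult_scal [simp]: "coef (a * scal c) A = c * coef a A"
  by (subst coef_mult_supersets[of "{A. coef a A \<noteq> 0}" "{{}}"])
    (auto simp: coef_scal finite_coef split: if_splits)

lemma scal_add: "scal (c + d) = scal c + scal d"
  by (rule clifford_eqI) (simp add: coef_scal)

lemma scal_mult: "scal (c * d) = scal c * scal d"
  by (rule clifford_eqI) (simp add: coef_scal)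

lemma scal_one: "scal 1 = 1"
  by (rule clifford_eqI) (simp add: coef_scal coef_one)

lemma coef_gen_mult_gen:
  "coef (gen a * gen b) C = (if symdiff {a} {b} = C then blade_sign {a} {b} else 0)"
  by (subst coef_mult_supersets[of "{{a}}" "{{b}}"]) (auto simp: coef_gen split: if_splits)

lemma scal_central: "scal c * a = a * scal c"
  by (rule clifford_eqI) simp

lemma gen_anticommute: "gen a * gen b + gen b * gen a = (if a = b then - 2 else 0)"
proof -
  have *: "{(x, y). x = c \<and> y = d \<and> y \<le> x} = (if d \<le> c then {(c, d)} else {})" for c d :: nat
    by auto
  have "gen a * gen b + gen b * gen a = 0" if "a \<noteq> b"
    using that by (intro clifford_eqI) (auto simp: coef_gen_mult_gen blade_sign_def * symdiff_def)
  moreover have "gen a * gen a = - 1"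
    by (intro clifford_eqI) (auto simp: coef_gen_mult_gen blade_sign_def * symdiff_def coef_one)
  ultimately show ?thesis by auto
qed

inductive_set cliff :: "nat set \<Rightarrow> clifford set" for J where
  "scal c \<in> cliff J"
| "j \<in> J \<Longrightarrow> gen j \<in> cliff J"
| "a \<in> cliff J \<Longrightarrow> b \<in> cliff J \<Longrightarrow> a + b \<in> cliff J"
| "a \<in> cliff J \<Longrightarrow> b \<in> cliff J \<Longrightarrow> a * b \<in> cliff J"

definition e12 :: clifford where "e12 = gen 1 * gen 2"
definition Tplus :: clifford where "Tplus = scal (1/2) * (gen 1 + scal \<i> * gen 2)"
definition Tminus :: clifford where "Tminus = scal (1/2) * (gen 1 - scal \<i> * gen 2)"
definition Iplus :: clifford where "Iplus = - Tplus * Tminus"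
definition Iminus :: clifford where "Iminus = - Tminus * Tplus"


section \<open>Clifford-valued polynomials and the Dirac operator\<close>

text \<open>For a finite \<open>J\<close>, a point of \<open>\<real>\<^sup>J\<close> is given by the coordinates \<open>y j\<close>, \<open>j \<in> J\<close>, of
  some \<open>y :: nat \<Rightarrow> real\<close>; polynomials over \<open>J\<close> do not depend on the other coordinates.  Hence a
  polynomial in the variables \<open>x\<^sub>3, \<dots>, x\<^sub>m\<close> is also one in \<open>x\<^sub>1, \<dots>, x\<^sub>m\<close>.\<close>

type_synonym cfun = "(nat \<Rightarrow> real) \<Rightarrow> clifford"

definition cscale :: "complex \<Rightarrow> cfun \<Rightarrow> cfun" where
  "cscale c P = (\<lambda>y. scal c * P y)"

interpretation cfun: vector_space cscale
proof
  fix c d :: complex and P Q :: cfun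
  show "cscale c (P + Q) = cscale c P + cscale c Q"
    by (rule ext) (simp add: cscale_def distrib_left)
  show "cscale (c + d) P = cscale c P + cscale d P"
    by (rule ext) (simp add: cscale_def scal_add distrib_right)
  show "cscale c (cscale d P) = cscale (c * d) P"
    by (rule ext) (simp add: cscale_def scal_mult mult.assoc)
  show "cscale 1 P = P"
    by (rule ext) (simp add: cscale_def scal_one)
qed

definition cpoly :: "nat set \<Rightarrow> cfun set" where
  "cpoly J = cfun.span
     {\<lambda>y. scal (of_real (\<Prod>j\<in>J. y j ^ \<alpha> j)) * a | (\<alpha> :: nat \<Rightarrow> nat) a. a \<in> cliff J}"

definition partial_deriv :: "nat \<Rightarrow> cfun \<Rightarrow> cfun" where
  "partial_deriv j P = (\<lambda>y. THE d. \<forall>A.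
     ((\<lambda>t. coef (P (y(j := t))) A) has_vector_derivative coef d A) (at (y j)))"

definition lmult :: "clifford \<Rightarrow> cfun \<Rightarrow> cfun" where
  "lmult a P = (\<lambda>y. a * P y)"

definition cvec :: "nat set \<Rightarrow> (nat \<Rightarrow> real) \<Rightarrow> clifford" where
  "cvec J y = (\<Sum>j\<in>J. scal (of_real (y j)) * gen j)"

definition vmult :: "nat set \<Rightarrow> cfun \<Rightarrow> cfun" where
  "vmult J P = (\<lambda>y. cvec J y * P y)"

definition dirac :: "nat set \<Rightarrow> cfun \<Rightarrow> cfun" where
  "dirac J P = (\<Sum>j\<in>J. lmult (gen j) (partial_deriv j P))"

definition monogenic :: "nat set \<Rightarrow> cfun set" where
  "monogenic J = {P \<in> cpoly J. dirac J P = 0}"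

definition monogenic_hom :: "nat set \<Rightarrow> nat \<Rightarrow> cfun set" where
  "monogenic_hom J i =
     {P \<in> monogenic J. \<forall>t y. P (\<lambda>j. t * y j) = scal (of_real (t ^ i)) * P y}"

text \<open>\<open>P = \<Sum>\<^sub>s x\<^sup>s h\<^sub>s\<close> with monogenic \<open>h\<^sub>s\<close>, almost all zero, is the Fischer decomposition of \<open>P\<close>;
  it is unique, and \<open>h\<^sub>0\<close> is the projection.\<close>

definition monogenic_proj :: "nat set \<Rightarrow> cfun \<Rightarrow> cfun" where
  "monogenic_proj J P = (THE Q. \<exists>h. (\<forall>s. h s \<in> monogenic J) \<and> finite {s. h s \<noteq> 0} \<and>
     P = (\<Sum>s | h s \<noteq> 0. (vmult J ^^ s) (h s)) \<and> Q = h 0)"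


section \<open>The operators and the spin action\<close>

definition M12 :: "cfun \<Rightarrow> cfun" where
  "M12 P = (\<lambda>y. scal (of_real (y 1)) * partial_deriv 2 P y - scal (of_real (y 2)) * partial_deriv 1 P y
     - scal (1/2) * e12 * P y)"

definition Gam :: "nat set \<Rightarrow> cfun \<Rightarrow> cfun" where
  "Gam J P = cscale (1/2)
     (dirac J (vmult J P) - vmult J (dirac J P) + cscale (of_nat (card J)) P)"

definition S_u :: "cfun \<Rightarrow> cfun" where
  "S_u P = cscale \<i> (M12 P)"

definition S_v :: "nat \<Rightarrow> cfun \<Rightarrow> cfun" where
  "S_v m P = cscale \<i> (lmult e12 (Gam {3..m} P - cscale ((of_nat m - 3) / 2) P))"

definition S_x :: "nat \<Rightarrow> cfun \<Rightarrow> cfun" where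
  "S_x m P = Gam {1..m} P - cscale ((of_nat m - 1) / 2) P"

definition unit_vecs :: "nat set \<Rightarrow> clifford set" where
  "unit_vecs J = {cvec J y | y. (\<Sum>j\<in>J. (y j)\<^sup>2) = 1}"

definition Spin :: "nat set \<Rightarrow> clifford set" where
  "Spin J = {prod_list ws | ws. even (length ws) \<and> set ws \<subseteq> unit_vecs J}"

definition cinv :: "clifford \<Rightarrow> clifford" where
  "cinv s = (THE t. s * t = 1 \<and> t * s = 1)"

text \<open>For \<open>s \<in> Spin J\<close> the element \<open>s\<inverse> x s\<close> is again a vector of \<open>\<real>\<^sup>J\<close>; \<open>coords\<close> reads off its
  coordinates.\<close>

definition coords :: "clifford \<Rightarrow> nat \<Rightarrow> real" where
  "coords w j = Re (coef w {j})"

definition Lact :: "nat set \<Rightarrow> clifford \<Rightarrow> cfun \<Rightarrow> cfun" where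
  "Lact J s P = (\<lambda>y. s * P (coords (cinv s * cvec J y * s)))"


section \<open>The summands\<close>

definition zc :: "(nat \<Rightarrow> real) \<Rightarrow> complex" where
  "zc y = Complex (y 1) (y 2)"

datatype kind = Ka | Kb | Kc | Kd

fun kind_monomial :: "kind \<Rightarrow> nat \<Rightarrow> nat \<Rightarrow> complex \<Rightarrow> complex" where
  "kind_monomial Ka s k z = cnj z ^ s * z ^ (k + s)"
| "kind_monomial Kb s k z = z ^ s * cnj z ^ (k + s)"
| "kind_monomial Kc s k z = cnj z ^ s * z ^ (k + s + 1)"
| "kind_monomial Kd s k z = z ^ s * cnj z ^ (k + s + 1)"

fun kind_factors :: "kind \<Rightarrow> clifford set" where
  "kind_factors Ka = {Iplus, Tplus}"
| "kind_factors Kb = {Iminus, Tminus}"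
| "kind_factors Kc = {Tminus, Iminus}"
| "kind_factors Kd = {Tplus, Iplus}"

definition summand :: "nat \<Rightarrow> kind \<Rightarrow> nat \<Rightarrow> nat \<Rightarrow> nat \<Rightarrow> cfun set" where
  "summand m \<tau> s k i = cfun.span
     {monogenic_proj {1..m} (\<lambda>y. scal (kind_monomial \<tau> s k (zc y)) * X * Q y) | X Q.
        X \<in> kind_factors \<tau> \<and> Q \<in> monogenic_hom {3..m} i}"

definition direct_sum_of :: "cfun set \<Rightarrow> ('i \<Rightarrow> cfun set) \<Rightarrow> bool" where
  "direct_sum_of V W \<longleftrightarrow> cfun.subspace V \<and> (\<forall>\<iota>. cfun.subspace (W \<iota>) \<and> W \<iota> \<subseteq> V) \<and>
     (\<forall>P\<in>V. \<exists>!h. (\<forall>\<iota>. h \<iota> \<in> W \<iota>) \<and> finite {\<iota>. h \<iota> \<noteq> 0} \<and> P = (\<Sum>\<iota> | h \<iota> \<noteq> 0. h \<iota>))"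

definition commute_on :: "cfun set \<Rightarrow> (cfun \<Rightarrow> cfun) \<Rightarrow> (cfun \<Rightarrow> cfun) \<Rightarrow> bool" where
  "commute_on V S T \<longleftrightarrow> (\<forall>P\<in>V. S (T P) = T (S P))"

definition joint_eigenvectors ::
    "nat \<Rightarrow> cfun set \<Rightarrow> complex \<Rightarrow> complex \<Rightarrow> complex \<Rightarrow> bool" where
  "joint_eigenvectors m W a b c \<longleftrightarrow>
     (\<forall>P\<in>W. S_u P = cscale a P \<and> S_v m P = cscale b P \<and> S_x m P = cscale c P)"

end

theory Submission
  imports Defs
begin

text \<open>The projection \<open>P\<^sub>M\<close> has kernel \<open>x \<P>\<close>, and modulo \<open>x \<P>\<close> multiplication by \<open>v = x - u\<close> equals
  multiplication by \<open>- u\<close>.  By the Fischer decomposition in the variable \<open>v\<close>, the products of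
  polynomials in \<open>u\<close> with the monogenic polynomials \<open>Q\<^sub>i(v)\<close> therefore span \<open>\<P>\<close> modulo \<open>x \<P>\<close>, and
  expanding the former in \<open>z\<^sup>a\<close>, its conjugate powers and the elements \<open>I\<^sub>\<plusminus>, T\<^sub>\<plusminus>\<close> gives exactly
  the generators (a)--(d).  Since \<open>M\<^sub>1\<^sub>2\<close> commutes and \<open>S\<^sub>v\<close> anticommutes with both \<open>x\<close> and \<open>\<partial>\<^sub>x\<close>, they
  commute with \<open>P\<^sub>M\<close>, so each summand consists of joint eigenvectors; different summands have
  different eigenvalue triples, whence the sum is direct.  An element of the spin group is a
  product of reflections, and a single reflection already permutes the summands.\<close>

text \<open>\<open>monogenic_proj\<close> is a definite description, so existence and uniqueness of
  the Fischer decomposition have to be proved. Both rest on one computation: \<open>dx K\<close>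
  maps \<open>x^(s+1) h\<close>, with \<open>h\<close> monogenic and homogeneous, to a nonzero
  multiple of \<open>x^s h\<close>. No inner product and no dimension count enters. The result is
  used for \<open>{3..m}\<close>, to produce generators, and for \<open>{1..m}\<close>, to control
  the projection. The exponents in (a)-(d) come from sorting. Write w for the conjugate of z. A
  product z^a w^b X with X in {I_+, T_+} has type (a) if a >= b and type (d) otherwise; with X in
  {I_-, T_-} it has type (b) if b >= a and type (c) otherwise. So each product is listed exactly
  once. The three eigenvalues are not obtained alike. Generators are eigenvectors of S_u and S_v
  before the projection, but in general not of Gamma_x. For the latter, the projection keeps the
  degree n, and Gamma_x acts as -n on monogenic polynomials of degree n.\<close>

lemma coef_mult_single:
  "coef (a * b) C = (\<Sum>A | coef a A \<noteq> 0. blade_sign A (symdiff A C) * coef a A * coef b (symdiff A C))"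
proof -
  have "(\<Sum>B | coef b B \<noteq> 0. if symdiff A B = C then blade_sign A B * coef a A * coef b B else 0)
      = blade_sign A (symdiff A C) * coef a A * coef b (symdiff A C)" for A
  proof -
    have "symdiff A B = C \<longleftrightarrow> B = symdiff A C" for B
      by (auto simp: symdiff_def)
    then show ?thesis
      by (simp add: sum.delta finite_coef)
  qed
  then show ?thesis
    by (simp add: coef_mult)
qed

lemma coef_sum: "coef (sum f S) A = (\<Sum>s\<in>S. coef (f s) A)"
  by (induction S rule: infinite_finite_induct) auto

lemma scal_zero [simp]: "scal 0 = 0"
  by (rule clifford_eqI) (simp add: coef_scal)

lemma scal_uminus: "scal (- c) = - scal c"
  by (rule clifford_eqI) (simp add: coef_scal)

lemma scal_diff: "scal (c - d) = scal c - scal d"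
  by (rule clifford_eqI) (simp add: coef_scal)

lemma scal_sum: "scal (sum f S) = (\<Sum>s\<in>S. scal (f s))"
  by (induction S rule: infinite_finite_induct) (auto simp: scal_add)

lemma scal_of_nat: "scal (of_nat n) = of_nat n"
  by (induction n) (auto simp: scal_add scal_one)

lemma scal_numeral: "scal (numeral n) = numeral n"
  using scal_of_nat[of "numeral n"] by simp

lemma scal_left_commute: "a * (scal c * b) = scal c * (a * b)"
  by (metis mult.assoc scal_central)

lemma scal_scal_commute: "scal c * (scal d * a) = scal d * (scal c * a)"
  by (simp only: mult.assoc[symmetric] scal_mult[symmetric] mult.commute[of c d])

section \<open>Partial derivatives of polynomials\<close>

text \<open>The relational form records existence of the derivative, which the definite description
  in \<open>partial_deriv\<close> leaves open. It is tested on the complex coefficients, where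
  uniqueness of derivatives is available.\<close>

definition has_pd :: "nat \<Rightarrow> cfun \<Rightarrow> cfun \<Rightarrow> bool" where
  "has_pd j P P' \<longleftrightarrow> (\<forall>y A. ((\<lambda>t. coef (P (y(j := t))) A) has_vector_derivative coef (P' y) A) (at (y j)))"

lemma partial_deriv_eqI:
  assumes "has_pd j P P'"
  shows "partial_deriv j P = P'"
proof
  fix y
  show "partial_deriv j P y = P' y"
    unfolding partial_deriv_def
  proof (rule the_equality)
    show "\<forall>A. ((\<lambda>t. coef (P (y(j := t))) A) has_vector_derivative coef (P' y) A) (at (y j))"
      using assms by (simp add: has_pd_def)
  next
    fix d assume d: "\<forall>A. ((\<lambda>t. coef (P (y(j := t))) A) has_vector_derivative coef d A) (at (y j))"
    show "d = P' y"
    proof (rule clifford_eqI)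
      fix A
      have "(\<lambda>x. x *\<^sub>R coef d A) = (\<lambda>x. x *\<^sub>R coef (P' y) A)"
        using d assms unfolding has_pd_def has_vector_derivative_def
        by (metis has_derivative_unique)
      then show "coef d A = coef (P' y) A"
        by (metis scaleR_one)
    qed
  qed
qed

lemma has_pd_const: "has_pd j (\<lambda>_. a) 0"
  by (simp add: has_pd_def)

lemma has_pd_add: "has_pd j P P' \<Longrightarrow> has_pd j Q Q' \<Longrightarrow> has_pd j (P + Q) (P' + Q')"
  by (auto simp: has_pd_def intro: has_vector_derivative_add)

text \<open>By \<open>coef_mult_single\<close>, a coefficient of the product is a finite linear
  combination, with fixed scalars, of coefficients of \<open>P\<close>.\<close>

lemma has_pd_lmult: "has_pd j P P' \<Longrightarrow> has_pd j (lmult a P) (lmult a P')"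
  unfolding has_pd_def lmult_def
  by (auto simp: coef_mult_single intro!: has_vector_derivative_sum has_vector_derivative_mult_right)

lemma cscale_eq_lmult: "cscale c P = lmult (scal c) P"
  by (simp add: cscale_def lmult_def)

lemma has_pd_cscale: "has_pd j P P' \<Longrightarrow> has_pd j (cscale c P) (cscale c P')"
  by (simp add: cscale_eq_lmult has_pd_lmult)

lemma has_pd_real_mult:
  assumes "has_pd j P P'"
    and "\<And>y. ((\<lambda>t. g (y(j := t))) has_real_derivative g' y) (at (y j))"
  shows "has_pd j (\<lambda>y. scal (of_real (g y)) * P y)
    (\<lambda>y. scal (of_real (g' y)) * P y + scal (of_real (g y)) * P' y)"
  unfolding has_pd_def
proof (intro allI)
  fix y A
  have g: "((\<lambda>t. of_real (g (y(j := t))) :: complex) has_vector_derivative of_real (g' y)) (at (y j))"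
    using assms(2)[of y] by (auto simp: has_real_derivative_iff_has_vector_derivative
      intro: has_vector_derivative_of_real)
  have "((\<lambda>t. of_real (g (y(j := t))) * coef (P (y(j := t))) A) has_vector_derivative
      (of_real (g (y(j := y j))) * coef (P' y) A + of_real (g' y) * coef (P (y(j := y j))) A)) (at (y j))"
    using has_vector_derivative_mult[OF g, of "\<lambda>t. coef (P (y(j := t))) A" "coef (P' y) A"] assms(1)
    by (simp add: has_pd_def)
  then show "((\<lambda>t. coef (scal (of_real (g (y(j := t)))) * P (y(j := t))) A) has_vector_derivative
      coef (scal (of_real (g' y)) * P y + scal (of_real (g y)) * P' y) A) (at (y j))"
    by (simp add: add.commute)
qed

definition xmult :: "nat \<Rightarrow> cfun \<Rightarrow> cfun" where
  "xmult j P = (\<lambda>y. scal (of_real (y j)) * P y)"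

lemma has_pd_xmult:
  assumes "has_pd j P P'"
  shows "has_pd j (xmult k P) ((if j = k then P else 0) + xmult k P')"
proof -
  have "has_pd j (xmult k P) (\<lambda>y. scal (of_real (if j = k then 1 else 0)) * P y + scal (of_real (y k)) * P' y)"
    unfolding xmult_def by (rule has_pd_real_mult[OF assms]) (auto intro!: derivative_eq_intros)
  moreover have "(\<lambda>y. scal (of_real (if j = k then 1 else 0)) * P y + scal (of_real (y k)) * P' y)
      = (if j = k then P else 0) + xmult k P'"
    by (auto simp: xmult_def scal_one)
  ultimately show ?thesis by simp
qed

lemma lmult_add: "lmult a (P + Q) = lmult a P + lmult a Q"
  by (auto simp: lmult_def distrib_left)

lemma lmult_add_left: "lmult (a + b) P = lmult a P + lmult b P"
  by (auto simp: lmult_def distrib_right)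

lemma lmult_mult: "lmult (a * b) P = lmult a (lmult b P)"
  by (auto simp: lmult_def mult.assoc)

lemma lmult_zero [simp]: "lmult a 0 = 0" "lmult 0 P = 0"
  by (auto simp: lmult_def)

lemma lmult_cscale: "lmult a (cscale c P) = cscale c (lmult a P)"
  by (auto simp: lmult_def cscale_def scal_left_commute)

lemma xmult_add: "xmult j (P + Q) = xmult j P + xmult j Q"
  by (auto simp: xmult_def distrib_left)

lemma xmult_cscale: "xmult j (cscale c P) = cscale c (xmult j P)"
  unfolding xmult_def cscale_def by (simp only: scal_scal_commute)

lemma xmult_zero [simp]: "xmult j 0 = 0"
  by (auto simp: xmult_def)

lemma xmult_lmult: "xmult j (lmult a P) = lmult a (xmult j P)"
  by (auto simp: xmult_def lmult_def scal_left_commute)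

lemma xmult_xmult: "xmult j (xmult k P) = xmult k (xmult j P)"
  unfolding xmult_def cscale_def by (simp only: scal_scal_commute)

section \<open>Closure properties of polynomials, and induction over them\<close>

lemma subspace_cpoly: "cfun.subspace (cpoly J)"
  by (simp add: cpoly_def)

lemma const_in_cpoly: "a \<in> cliff J \<Longrightarrow> (\<lambda>_. a) \<in> cpoly J"
  unfolding cpoly_def
  by (rule cfun.span_base, rule CollectI, rule exI[of _ "\<lambda>_. 0"]) (auto simp: scal_one)

lemma one_in_cliff: "1 \<in> cliff J"
  by (metis cliff.intros(1) scal_one)

lemma lmult_in_cpoly:
  assumes "a \<in> cliff J" "P \<in> cpoly J"
  shows "lmult a P \<in> cpoly J"
  using assms(2) unfolding cpoly_def
proof (induction rule: cfun.span_induct_alt)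
  case base
  then show ?case by (metis lmult_zero(1) cfun.span_zero)
next
  case (step c P Q)
  then obtain \<alpha> b where "P = (\<lambda>y. scal (of_real (\<Prod>j\<in>J. y j ^ \<alpha> j)) * b)" "b \<in> cliff J" by blast
  then have "lmult a P = (\<lambda>y. scal (of_real (\<Prod>j\<in>J. y j ^ \<alpha> j)) * (a * b))" "a * b \<in> cliff J"
    using assms(1) by (auto simp: lmult_def scal_left_commute intro: cliff.intros)
  then show ?case
    using step unfolding lmult_add lmult_cscale
    by (intro cfun.span_add cfun.span_scale) (auto intro!: cfun.span_base)
qed

lemma xmult_in_cpoly:
  assumes "finite J" "j \<in> J" "P \<in> cpoly J"
  shows "xmult j P \<in> cpoly J"
  using assms(3) unfolding cpoly_def
proof (induction rule: cfun.span_induct_alt)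
  case base
  then show ?case by (metis xmult_zero cfun.span_zero)
next
  case (step c P Q)
  then obtain \<alpha> b where P: "P = (\<lambda>y. scal (of_real (\<Prod>j\<in>J. y j ^ \<alpha> j)) * b)" "b \<in> cliff J" by blast
  have "y j * (\<Prod>i\<in>J. y i ^ \<alpha> i) = (\<Prod>i\<in>J. y i ^ (\<alpha>(j := Suc (\<alpha> j))) i)" for y :: "nat \<Rightarrow> real"
    using assms by (simp add: prod.remove[of J j])
  then have "xmult j P = (\<lambda>y. scal (of_real (\<Prod>i\<in>J. y i ^ (\<alpha>(j := Suc (\<alpha> j))) i)) * b)"
    by (simp only: P(1) xmult_def mult.assoc[symmetric] scal_mult[symmetric] of_real_mult[symmetric])
  then show ?case
    using step P unfolding xmult_add xmult_cscale
    by (intro cfun.span_add cfun.span_scale) (auto intro!: cfun.span_base)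
qed

text \<open>Closure under the generators extends to all of \<open>cliff J\<close> by rule induction,
  and monomials are then built one variable and one power at a time. The conclusion is membership in
  a subspace, so that several properties can be carried along together.\<close>

lemma cpoly_induct [consumes 2, case_names subspace one xmult gen]:
  assumes "finite J" "P \<in> cpoly J"
    and S: "cfun.subspace S"
    and one: "(\<lambda>_. 1) \<in> S"
    and x: "\<And>j P. j \<in> J \<Longrightarrow> P \<in> S \<Longrightarrow> xmult j P \<in> S"
    and g: "\<And>j P. j \<in> J \<Longrightarrow> P \<in> S \<Longrightarrow> lmult (gen j) P \<in> S"
  shows "P \<in> S"
proof -
  have lm: "lmult a P \<in> S" if "a \<in> cliff J" "P \<in> S" for a P
    using that
  proof (induction arbitrary: P)
    case (1 c)
    then show ?case using S by (metis cscale_eq_lmult cfun.subspace_scale)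
  next
    case (3 a b)
    then show ?case using S by (metis lmult_add_left cfun.subspace_add)
  qed (auto simp: lmult_mult g)
  have mon: "(\<lambda>y. scal (of_real (\<Prod>j\<in>F. y j ^ \<alpha> j)) * a) \<in> S" if "finite F" "F \<subseteq> J" "a \<in> cliff J" for F \<alpha> a
    using that
  proof induction
    case empty
    then show ?case using lm[OF _ one, of a] by (simp add: lmult_def scal_one)
  next
    case (insert j F)
    have "(\<lambda>y. scal (of_real (y j ^ n * (\<Prod>i\<in>F. y i ^ \<alpha> i))) * a) \<in> S" for n
    proof (induction n)
      case 0
      then show ?case using insert by simp
    next
      case (Suc n)
      have "(\<lambda>y. scal (of_real (y j ^ Suc n * (\<Prod>i\<in>F. y i ^ \<alpha> i))) * a) =
          xmult j (\<lambda>y. scal (of_real (y j ^ n * (\<Prod>i\<in>F. y i ^ \<alpha> i))) * a)"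
        by (auto simp: xmult_def scal_mult mult.assoc)
      then show ?case using x[OF _ Suc] insert by simp
    qed
    then show ?case using insert by simp
  qed
  have "{\<lambda>y. scal (of_real (\<Prod>j\<in>J. y j ^ \<alpha> j)) * a | \<alpha> a. a \<in> cliff J} \<subseteq> S"
    using mon[OF assms(1)] by blast
  then have "cpoly J \<subseteq> S"
    unfolding cpoly_def using S by (rule cfun.span_minimal)
  then show ?thesis using assms(2) by blast
qed

lemma cpoly_mono:
  assumes "finite J'" "J \<subseteq> J'"
  shows "cpoly J \<subseteq> cpoly J'"
proof
  have J: "finite J" using assms finite_subset by blast
  fix P assume "P \<in> cpoly J"
  with J show "P \<in> cpoly J'"
  proof (induction rule: cpoly_induct)
    case (gen j P)
    then show ?case using assms by (blast intro: lmult_in_cpoly cliff.intros)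
  qed (use assms in \<open>auto intro: subspace_cpoly const_in_cpoly one_in_cliff xmult_in_cpoly\<close>)
qed

lemma cpoly_local:
  assumes "finite J" "P \<in> cpoly J" "\<And>j. j \<in> J \<Longrightarrow> y j = y' j"
  shows "P y = P y'"
proof -
  have "P \<in> {P. P y = P y'}"
    using assms(1,2)
  proof (induction rule: cpoly_induct)
    case subspace
    then show ?case by (auto simp: cfun.subspace_def cscale_def)
  qed (use assms(3) in \<open>auto simp: xmult_def lmult_def\<close>)
  then show ?thesis by simp
qed

text \<open>The product rule for \<open>xmult\<close> puts \<open>P\<close> itself into the
  derivative, so the induction also carries \<open>P \<in> cpoly J\<close>.\<close>

lemma cpoly_has_pd_in:
  assumes "finite J" "P \<in> cpoly J"
  shows "\<exists>P'\<in>cpoly J. has_pd j P P'"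
proof -
  have "P \<in> {P \<in> cpoly J. \<exists>P'\<in>cpoly J. has_pd j P P'}"
    using assms
  proof (induction rule: cpoly_induct)
    case subspace
    note V = subspace_cpoly[of J]
    show ?case
    proof (rule cfun.subspaceI)
      have "has_pd j 0 0" using has_pd_const[of j 0] by (simp add: zero_fun_def)
      then show "0 \<in> {P \<in> cpoly J. \<exists>P'\<in>cpoly J. has_pd j P P'}"
        using cfun.subspace_0[OF V] by blast
    next
      fix P Q assume "P \<in> {P \<in> cpoly J. \<exists>P'\<in>cpoly J. has_pd j P P'}"
        and "Q \<in> {P \<in> cpoly J. \<exists>P'\<in>cpoly J. has_pd j P P'}"
      then show "P + Q \<in> {P \<in> cpoly J. \<exists>P'\<in>cpoly J. has_pd j P P'}"
        using cfun.subspace_add[OF V] has_pd_add by blast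
    next
      fix c P assume "P \<in> {P \<in> cpoly J. \<exists>P'\<in>cpoly J. has_pd j P P'}"
      then show "cscale c P \<in> {P \<in> cpoly J. \<exists>P'\<in>cpoly J. has_pd j P P'}"
        using cfun.subspace_scale[OF V] has_pd_cscale by blast
    qed
  next
    case one
    show ?case using has_pd_const[of j 1] cfun.subspace_0[OF subspace_cpoly]
      by (auto intro: const_in_cpoly one_in_cliff)
  next
    case (xmult k P)
    then obtain P' where P': "P' \<in> cpoly J" "has_pd j P P'" by auto
    have "(if j = k then P else 0) + xmult k P' \<in> cpoly J"
      using xmult P' assms(1) by (auto intro!: cfun.subspace_add subspace_cpoly cfun.subspace_0 xmult_in_cpoly)
    then show ?case using has_pd_xmult[OF P'(2)] xmult assms(1) by (auto intro: xmult_in_cpoly)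
  next
    case (gen k P)
    then show ?case by (auto intro: has_pd_lmult lmult_in_cpoly cliff.intros)
  qed
  then show ?thesis by blast
qed

lemma has_pd_partial_deriv:
  assumes "finite J" "P \<in> cpoly J"
  shows "has_pd j P (partial_deriv j P)" "partial_deriv j P \<in> cpoly J"
  using cpoly_has_pd_in[OF assms, of j] partial_deriv_eqI by metis+

lemma partial_deriv_outside:
  assumes "finite J" "P \<in> cpoly J" "j \<notin> J"
  shows "partial_deriv j P = 0"
proof -
  have "P (y(j := t)) = P y" for y t
    by (rule cpoly_local[OF assms(1,2)]) (use assms(3) in auto)
  then have "has_pd j P 0" by (simp add: has_pd_def)
  then show ?thesis by (rule partial_deriv_eqI)
qed

section \<open>The ring of linear operators on polynomials\<close>

text \<open>A common domain for all finite coordinate sets, so that the operators of the plane, of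
  \<open>{3..m}\<close> and of \<open>{1..m}\<close> can be composed in one ring.\<close>

definition cpolys :: "cfun set" where
  "cpolys = (\<Union>J\<in>{J. finite J}. cpoly J)"

lemma cpolysI: "finite J \<Longrightarrow> P \<in> cpoly J \<Longrightarrow> P \<in> cpolys"
  by (auto simp: cpolys_def)

lemma cpolysE:
  assumes "P \<in> cpolys"
  obtains J where "finite J" "P \<in> cpoly J"
  using assms by (auto simp: cpolys_def)

lemma cpolysE2:
  assumes "P \<in> cpolys" "Q \<in> cpolys"
  obtains J where "finite J" "P \<in> cpoly J" "Q \<in> cpoly J"
proof -
  obtain J where J: "finite J" "P \<in> cpoly J" using assms(1) by (rule cpolysE)
  obtain J' where J': "finite J'" "Q \<in> cpoly J'" using assms(2) by (rule cpolysE)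
  have "P \<in> cpoly (J \<union> J')" "Q \<in> cpoly (J \<union> J')"
    using J J' cpoly_mono[of "J \<union> J'" J] cpoly_mono[of "J \<union> J'" J'] by auto
  then show ?thesis using that[of "J \<union> J'"] J J' by simp
qed

lemma subspace_cpolys: "cfun.subspace cpolys"
proof (rule cfun.subspaceI)
  show "0 \<in> cpolys"
    using cfun.subspace_0[OF subspace_cpoly[of "{}"]] by (auto intro: cpolysI[of "{}"])
next
  fix P Q assume "P \<in> cpolys" "Q \<in> cpolys"
  then show "P + Q \<in> cpolys"
    by (elim cpolysE2[of P Q]) (auto intro: cpolysI cfun.subspace_add[OF subspace_cpoly])
next
  fix c P assume "P \<in> cpolys"
  then show "cscale c P \<in> cpolys"
    by (elim cpolysE) (auto intro: cpolysI cfun.subspace_scale[OF subspace_cpoly])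
qed

lemmas cpolys_add = cfun.subspace_add[OF subspace_cpolys]
lemmas cpolys_cscale = cfun.subspace_scale[OF subspace_cpolys]
lemmas cpolys_zero = cfun.subspace_0[OF subspace_cpolys]
lemmas cpolys_diff = cfun.subspace_diff[OF subspace_cpolys]

lemma xmult_in_cpolys: "P \<in> cpolys \<Longrightarrow> xmult j P \<in> cpolys"
proof (elim cpolysE)
  fix J assume "finite J" "P \<in> cpoly J"
  then have "P \<in> cpoly (insert j J)" using cpoly_mono[of "insert j J" J] by auto
  with \<open>finite J\<close> show ?thesis by (auto intro: cpolysI[of "insert j J"] xmult_in_cpoly)
qed

lemma lmult_in_cpolys: "a \<in> cliff UNIV \<Longrightarrow> P \<in> cpolys \<Longrightarrow> lmult a P \<in> cpolys"
proof (induction arbitrary: P rule: cliff.induct)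
  case (1 c)
  then show ?case by (metis cscale_eq_lmult cpolys_cscale)
next
  case (2 j)
  then obtain J where "finite J" "P \<in> cpoly J" by (auto elim: cpolysE)
  then have "P \<in> cpoly (insert j J)" using cpoly_mono[of "insert j J" J] by auto
  with \<open>finite J\<close> show ?case by (auto intro!: cpolysI[of "insert j J"] lmult_in_cpoly cliff.intros)
next
  case (3 a b)
  then show ?case by (metis lmult_add_left cpolys_add)
next
  case (4 a b)
  then show ?case by (simp add: lmult_mult)
qed

lemma partial_deriv_in_cpolys: "P \<in> cpolys \<Longrightarrow> partial_deriv j P \<in> cpolys"
  by (meson cpolysE cpolysI has_pd_partial_deriv(2))

lemma cpolys_has_pd: "P \<in> cpolys \<Longrightarrow> has_pd j P (partial_deriv j P)"
  by (meson cpolysE has_pd_partial_deriv(1))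

lemma partial_deriv_add:
  "P \<in> cpolys \<Longrightarrow> Q \<in> cpolys \<Longrightarrow> partial_deriv j (P + Q) = partial_deriv j P + partial_deriv j Q"
  by (intro partial_deriv_eqI has_pd_add cpolys_has_pd)

lemma partial_deriv_lmult:
  "P \<in> cpolys \<Longrightarrow> partial_deriv j (lmult a P) = lmult a (partial_deriv j P)"
  by (intro partial_deriv_eqI has_pd_lmult cpolys_has_pd)

lemma partial_deriv_cscale:
  "P \<in> cpolys \<Longrightarrow> partial_deriv j (cscale c P) = cscale c (partial_deriv j P)"
  by (simp add: cscale_eq_lmult partial_deriv_lmult)

lemma partial_deriv_xmult:
  "P \<in> cpolys \<Longrightarrow> partial_deriv j (xmult k P) = (if j = k then P else 0) + xmult k (partial_deriv j P)"
  by (intro partial_deriv_eqI has_pd_xmult cpolys_has_pd)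

lemma partial_deriv_const: "partial_deriv j (\<lambda>_. a) = 0"
  by (intro partial_deriv_eqI has_pd_const)

lemma partial_deriv_zero: "partial_deriv j 0 = 0"
  using partial_deriv_const[of j 0] by (simp add: zero_fun_def)

text \<open>By induction over the polynomial instead of the symmetry of second derivatives: both
  orders obey the same product rule.\<close>

lemma partial_deriv_commute:
  assumes "P \<in> cpolys"
  shows "partial_deriv j (partial_deriv k P) = partial_deriv k (partial_deriv j P)"
proof -
  obtain J where J: "finite J" "P \<in> cpoly J" using assms by (rule cpolysE)
  have "P \<in> {P \<in> cpolys. partial_deriv j (partial_deriv k P) = partial_deriv k (partial_deriv j P)}"
    using J
  proof (induction rule: cpoly_induct)
    case subspace
    then show ?case
      by (auto simp: cfun.subspace_def cpolys_zero cpolys_add cpolys_cscale partial_deriv_zero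
          partial_deriv_add partial_deriv_cscale partial_deriv_in_cpolys)
  next
    case one
    then show ?case
      by (auto simp: partial_deriv_const partial_deriv_zero
          intro!: cpolysI[of "{}"] const_in_cpoly one_in_cliff)
  next
    case (xmult i P)
    then show ?case
      by (auto simp: partial_deriv_xmult partial_deriv_add partial_deriv_in_cpolys
          xmult_in_cpolys cpolys_zero partial_deriv_zero)
  next
    case (gen i P)
    then show ?case
      by (auto simp: partial_deriv_lmult partial_deriv_in_cpolys lmult_in_cpolys cliff.intros)
  qed
  then show ?thesis by simp
qed

text \<open>Extended by \<open>0\<close> outside \<open>cpolys\<close>, linear operators on polynomials are determined by their
  values on \<open>cpolys\<close> and form a ring, in which identities can be computed without side
  conditions.\<close>

definition is_polyop :: "(cfun \<Rightarrow> cfun) \<Rightarrow> bool" where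
  "is_polyop f \<longleftrightarrow> (\<forall>P\<in>cpolys. f P \<in> cpolys) \<and> (\<forall>P\<in>cpolys. \<forall>Q\<in>cpolys. f (P + Q) = f P + f Q) \<and>
     (\<forall>c. \<forall>P\<in>cpolys. f (cscale c P) = cscale c (f P))"

lemma is_polyopI:
  assumes "\<And>P. P \<in> cpolys \<Longrightarrow> f P \<in> cpolys"
    and "\<And>P Q. P \<in> cpolys \<Longrightarrow> Q \<in> cpolys \<Longrightarrow> f (P + Q) = f P + f Q"
    and "\<And>c P. P \<in> cpolys \<Longrightarrow> f (cscale c P) = cscale c (f P)"
  shows "is_polyop f"
  using assms by (simp add: is_polyop_def)

typedef polyop = "{f. is_polyop f \<and> (\<forall>P. P \<notin> cpolys \<longrightarrow> f P = 0)}"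
  morphisms ap Abs_polyop
  by (rule exI[of _ "\<lambda>_. 0"]) (auto simp: is_polyop_def cpolys_zero)

definition mkop :: "(cfun \<Rightarrow> cfun) \<Rightarrow> polyop" where
  "mkop f = Abs_polyop (\<lambda>P. if P \<in> cpolys then f P else 0)"

lemma ap_mkop [simp]:
  assumes "is_polyop f" "P \<in> cpolys"
  shows "ap (mkop f) P = f P"
proof -
  have "is_polyop (\<lambda>P. if P \<in> cpolys then f P else 0)"
    using assms(1) by (simp add: is_polyop_def cpolys_add cpolys_cscale)
  then show ?thesis
    using assms(2) by (simp add: mkop_def Abs_polyop_inverse)
qed

lemma ap_outside: "P \<notin> cpolys \<Longrightarrow> ap A P = 0"
  using ap[of A] by simp

lemma is_polyop_ap: "is_polyop (ap A)"
  using ap[of A] by simp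

lemma ap_in [simp]: "ap A P \<in> cpolys"
  using is_polyop_ap[of A] ap_outside[of P A] cpolys_zero by (cases "P \<in> cpolys") (auto simp: is_polyop_def)

lemma ap_add: "P \<in> cpolys \<Longrightarrow> Q \<in> cpolys \<Longrightarrow> ap A (P + Q) = ap A P + ap A Q"
  using is_polyop_ap[of A] by (simp add: is_polyop_def)

lemma ap_cscale: "P \<in> cpolys \<Longrightarrow> ap A (cscale c P) = cscale c (ap A P)"
  using is_polyop_ap[of A] by (simp add: is_polyop_def)

lemma ap_zero [simp]: "ap A 0 = 0"
  using ap_cscale[OF cpolys_zero, of A 0] by simp

lemma polyop_eqI: "(\<And>P. P \<in> cpolys \<Longrightarrow> ap A P = ap B P) \<Longrightarrow> A = B"
  by (metis ap_inject ap_outside ext)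

instantiation polyop :: ring_1
begin

definition "0 = mkop (\<lambda>P. 0)"
definition "1 = mkop (\<lambda>P. P)"
definition "A + B = mkop (\<lambda>P. ap A P + ap B P)"
definition "A - B = mkop (\<lambda>P. ap A P - ap B P)"
definition "- A = mkop (\<lambda>P. - ap A P)"
definition "A * B = mkop (\<lambda>P. ap A (ap B P))"

lemma ap_ring:
  assumes "P \<in> cpolys"
  shows "ap 0 P = 0" "ap 1 P = P" "ap (A + B) P = ap A P + ap B P" "ap (A - B) P = ap A P - ap B P"
    "ap (- A) P = - ap A P" "ap (A * B) P = ap A (ap B P)"
proof -
  note defs = zero_polyop_def one_polyop_def plus_polyop_def minus_polyop_def uminus_polyop_def
    times_polyop_def
  have "is_polyop (\<lambda>P. - ap A P)" for A
    by (intro is_polyopI)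
      (auto simp: cfun.subspace_neg[OF subspace_cpolys] ap_add ap_cscale cfun.scale_minus_right)
  moreover have "is_polyop (\<lambda>P. ap A P - ap B P)" for A B
    by (intro is_polyopI)
      (auto simp: cpolys_diff ap_add ap_cscale cfun.scale_right_diff_distrib)
  ultimately show "ap 0 P = 0" "ap 1 P = P" "ap (A + B) P = ap A P + ap B P" "ap (A - B) P = ap A P - ap B P"
    "ap (- A) P = - ap A P" "ap (A * B) P = ap A (ap B P)"
    unfolding defs using assms
    by (subst ap_mkop; auto intro!: is_polyopI
        simp: cpolys_zero cpolys_add cpolys_cscale ap_add ap_cscale cfun.scale_right_distrib algebra_simps)+
qed

instance
proof
  fix A B C :: polyop
  show "(0::polyop) \<noteq> 1"
  proof
    assume *: "(0::polyop) = 1"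
    have "(\<lambda>_. 1) \<in> cpolys"
      by (auto intro!: cpolysI[of "{}"] const_in_cpoly one_in_cliff)
    then have "(\<lambda>_. 1) = (0 :: cfun)"
      using ap_ring(1,2) * by metis
    then show False by (metis zero_fun_apply zero_neq_one)
  qed
qed (rule polyop_eqI, simp add: ap_ring ap_add cpolys_zero cpolys_add algebra_simps)+

end

declare ap_ring [simp]

lemma ap_sum: "P \<in> cpolys \<Longrightarrow> ap (sum f S) P = (\<Sum>s\<in>S. ap (f s) P)"
  by (induction S rule: infinite_finite_induct) auto

lemma cpolys_sum: "(\<And>s. s \<in> S \<Longrightarrow> f s \<in> cpolys) \<Longrightarrow> sum f S \<in> cpolys"
  by (rule cfun.subspace_sum[OF subspace_cpolys])

section \<open>The basic operators and their relations\<close>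

definition sc :: "complex \<Rightarrow> polyop" where "sc c = mkop (cscale c)"
definition lm :: "clifford \<Rightarrow> polyop" where "lm a = mkop (lmult a)"
definition xo :: "nat \<Rightarrow> polyop" where "xo j = mkop (xmult j)"
definition pd :: "nat \<Rightarrow> polyop" where "pd j = mkop (partial_deriv j)"

lemma ap_sc [simp]: "P \<in> cpolys \<Longrightarrow> ap (sc c) P = cscale c P"
  unfolding sc_def
  by (rule ap_mkop) (auto intro!: is_polyopI simp: cpolys_cscale cfun.scale_right_distrib mult.commute)

lemma ap_lm [simp]: "a \<in> cliff UNIV \<Longrightarrow> P \<in> cpolys \<Longrightarrow> ap (lm a) P = lmult a P"
  unfolding lm_def
  by (rule ap_mkop) (auto intro!: is_polyopI simp: lmult_in_cpolys lmult_add lmult_cscale)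

lemma ap_xo [simp]: "P \<in> cpolys \<Longrightarrow> ap (xo j) P = xmult j P"
  unfolding xo_def
  by (rule ap_mkop) (auto intro!: is_polyopI simp: xmult_in_cpolys xmult_add xmult_cscale)

lemma ap_pd [simp]: "P \<in> cpolys \<Longrightarrow> ap (pd j) P = partial_deriv j P"
  unfolding pd_def
  by (rule ap_mkop)
    (auto intro!: is_polyopI simp: partial_deriv_in_cpolys partial_deriv_add partial_deriv_cscale)

lemma sc_commute: "sc c * A = A * sc c"
  by (rule polyop_eqI) (simp add: ap_cscale cpolys_cscale)

lemma sc_commute2: "A * (sc c * B) = sc c * (A * B)"
  by (metis mult.assoc sc_commute)

lemma sc_add: "sc (c + d) = sc c + sc d"
  by (rule polyop_eqI) (simp add: cfun.scale_left_distrib)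

lemma sc_mult: "sc (c * d) = sc c * sc d"
  by (rule polyop_eqI) (simp add: cpolys_cscale)

lemma sc_one [simp]: "sc 1 = 1"
  by (rule polyop_eqI) simp

lemma sc_zero [simp]: "sc 0 = 0"
  by (rule polyop_eqI) simp

lemma sc_uminus: "sc (- c) = - sc c"
  by (rule polyop_eqI) simp

lemma sc_of_nat: "sc (of_nat n) = of_nat n"
  by (induction n) (auto simp: sc_add)

lemma ap_of_nat: "P \<in> cpolys \<Longrightarrow> ap (of_nat n) P = cscale (of_nat n) P"
  by (metis ap_sc sc_of_nat)

lemma sc_numeral: "sc (numeral n) = numeral n"
  using sc_of_nat[of "numeral n"] by simp

lemma cliff_UNIV: "a \<in> cliff J \<Longrightarrow> a \<in> cliff UNIV"
  by (induction rule: cliff.induct) (auto intro: cliff.intros)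

lemma lm_scal: "lm (scal c) = sc c"
  by (rule polyop_eqI) (simp add: cliff.intros cscale_eq_lmult)

lemma lm_one [simp]: "lm 1 = 1"
  using lm_scal[of 1] by (simp add: scal_one)

lemma lm_zero [simp]: "lm 0 = 0"
  using lm_scal[of 0] by simp

lemma lm_add: "a \<in> cliff UNIV \<Longrightarrow> b \<in> cliff UNIV \<Longrightarrow> lm (a + b) = lm a + lm b"
  by (rule polyop_eqI) (simp add: cliff.intros lmult_add_left)

lemma lm_mult: "a \<in> cliff UNIV \<Longrightarrow> b \<in> cliff UNIV \<Longrightarrow> lm (a * b) = lm a * lm b"
  by (rule polyop_eqI) (simp add: cliff.intros lmult_mult lmult_in_cpolys)

lemma gen_in_cliff: "gen j \<in> cliff UNIV"
  by (simp add: cliff.intros)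

lemma cliff_uminus: "a \<in> cliff J \<Longrightarrow> - a \<in> cliff J"
  using cliff.intros(4)[OF cliff.intros(1)[of "- 1"], of a] by (simp add: scal_uminus scal_one)

lemma lm_uminus: "a \<in> cliff UNIV \<Longrightarrow> lm (- a) = - lm a"
  using lm_add[of a "- a"] by (simp add: cliff_uminus eq_neg_iff_add_eq_0 add.commute)

lemma lm_gen_anticommute: "lm (gen a) * lm (gen b) + lm (gen b) * lm (gen a) = (if a = b then - 2 else 0)"
proof -
  have "lm (gen a) * lm (gen b) + lm (gen b) * lm (gen a) = lm (gen a * gen b + gen b * gen a)"
    by (simp add: lm_add lm_mult gen_in_cliff cliff.intros)
  also have "\<dots> = (if a = b then lm (scal (- 2)) else 0)"
    by (simp add: gen_anticommute scal_uminus scal_numeral)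
  finally show ?thesis by (simp add: lm_scal sc_uminus sc_numeral)
qed

lemma lm_gen_swap: "a \<noteq> b \<Longrightarrow> lm (gen a) * lm (gen b) = - (lm (gen b) * lm (gen a))"
  using lm_gen_anticommute[of a b] by (simp add: eq_neg_iff_add_eq_0)

text \<open>\<open>gen_anticommute\<close> gives only twice the square; the halving takes place in
  the complex coefficients.\<close>

lemma gen_square: "gen a * gen a = - 1"
proof (rule clifford_eqI)
  fix C
  have "coef (gen a * gen a + gen a * gen a) C = coef (- 2) C"
    using gen_anticommute[of a a] by simp
  moreover have "coef (- 2 :: clifford) C = - 2 * coef 1 C"
    using coef_scal_mult[of "- 2" 1 C] by (simp add: scal_uminus scal_numeral)
  ultimately show "coef (gen a * gen a) C = coef (- 1) C" by simp
qed

lemma lm_gen_square: "lm (gen a) * lm (gen a) = - 1"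
proof -
  have "lm (gen a) * lm (gen a) = lm (- 1)"
    by (metis gen_square lm_mult gen_in_cliff)
  then show ?thesis by (simp add: lm_uminus one_in_cliff)
qed

lemma xo_commute: "xo j * xo k = xo k * xo j"
  by (rule polyop_eqI) (simp add: xmult_in_cpolys xmult_xmult)

lemma pd_commute: "pd j * pd k = pd k * pd j"
  by (rule polyop_eqI) (simp add: partial_deriv_in_cpolys partial_deriv_commute)

lemma pd_xo: "pd j * xo k = xo k * pd j + (if j = k then 1 else 0)"
  by (rule polyop_eqI)
    (auto simp: xmult_in_cpolys partial_deriv_xmult partial_deriv_in_cpolys add.commute)

lemma xo_lm: "a \<in> cliff UNIV \<Longrightarrow> xo j * lm a = lm a * xo j"
  by (rule polyop_eqI) (simp add: xmult_in_cpolys lmult_in_cpolys xmult_lmult)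

lemma pd_lm: "a \<in> cliff UNIV \<Longrightarrow> pd j * lm a = lm a * pd j"
  by (rule polyop_eqI) (simp add: partial_deriv_in_cpolys lmult_in_cpolys partial_deriv_lmult)

text \<open>Keeps the index \<open>1\<close> in \<open>gen 1\<close>, \<open>xo 1\<close> and
  \<open>pd 1\<close> from being rewritten to \<open>Suc 0\<close>.\<close>

declare One_nat_def [simp del]

section \<open>Commutation relations\<close>

definition vx :: "nat set \<Rightarrow> polyop" where "vx K = (\<Sum>k\<in>K. lm (gen k) * xo k)"
definition dx :: "nat set \<Rightarrow> polyop" where "dx K = (\<Sum>k\<in>K. lm (gen k) * pd k)"
text \<open>The Euler operator, which measures the degree in the variables of
  \<open>K\<close>.\<close>

definition eu :: "nat set \<Rightarrow> polyop" where "eu K = (\<Sum>k\<in>K. xo k * pd k)"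

lemma sum_cfun_apply: "sum f S y = (\<Sum>s\<in>S. f s y)" for f :: "'i \<Rightarrow> cfun"
  by (induction S rule: infinite_finite_induct) auto

lemma ap_vx [simp]: "P \<in> cpolys \<Longrightarrow> ap (vx K) P = vmult K P"
proof -
  assume "P \<in> cpolys"
  then have "ap (vx K) P = (\<Sum>k\<in>K. lmult (gen k) (xmult k P))"
    by (simp add: vx_def ap_sum gen_in_cliff xmult_in_cpolys)
  then show ?thesis
    by (auto simp: lmult_def xmult_def vmult_def cvec_def scal_left_commute sum_distrib_right
        mult.assoc sum_cfun_apply fun_eq_iff)
qed

lemma ap_dx [simp]: "P \<in> cpolys \<Longrightarrow> ap (dx K) P = dirac K P"
  by (simp add: dx_def ap_sum gen_in_cliff partial_deriv_in_cpolys dirac_def)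

text \<open>This rule and its signed variant let rewriting move a factor through a right-nested
  product.\<close>

lemma mult_swap_assoc: "a * b = b * a \<Longrightarrow> a * (b * c) = b * (a * c)" for a b c :: "'a::ring_1"
  by (metis mult.assoc)

lemma mult_swap_neg_assoc: "a * b = - (b * a) \<Longrightarrow> a * (b * c) = - (b * (a * c))" for a b c :: "'a::ring_1"
  by (metis mult.assoc mult_minus_left)

lemma commute_sum:
  fixes a :: "'a::ring_1"
  assumes "\<And>k. k \<in> K \<Longrightarrow> a * f k = f k * a"
  shows "a * sum f K = sum f K * a"
  using assms by (simp add: sum_distrib_left sum_distrib_right)

lemma anticommute_sum:
  fixes a :: "'a::ring_1"
  assumes "\<And>k. k \<in> K \<Longrightarrow> a * f k = - (f k * a)"
  shows "a * sum f K = - (sum f K * a)"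
  using assms by (simp add: sum_distrib_left sum_distrib_right sum_negf)

lemma commute_mult: "a * b = b * a \<Longrightarrow> a * c = c * a \<Longrightarrow> a * (b * c) = (b * c) * a" for a b c :: "'a::ring_1"
  by (metis mult.assoc)

text \<open>In the anticommutator of the two sums the off-diagonal terms cancel, since distinct
  generators anticommute. Each diagonal term gives \<open>- 2 * (xo j * pd j) - 1\<close>, by the
  Leibniz rule and \<open>lm_gen_square\<close>.\<close>

lemma dx_vx:
  assumes "finite K"
  shows "dx K * vx K = - (vx K * dx K) - 2 * eu K - of_nat (card K)"
proof -
  have t: "lm (gen j) * pd j * (lm (gen k) * xo k) + lm (gen k) * xo k * (lm (gen j) * pd j) =
      (if j = k then - 2 * (xo j * pd j) - 1 else 0)" for j k
  proof -
    have "lm (gen j) * pd j * (lm (gen k) * xo k) = lm (gen j) * lm (gen k) * (pd j * xo k)"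
      by (metis mult.assoc pd_lm gen_in_cliff)
    moreover have "lm (gen k) * xo k * (lm (gen j) * pd j) = lm (gen k) * lm (gen j) * (xo k * pd j)"
      by (metis mult.assoc xo_lm gen_in_cliff)
    ultimately have "lm (gen j) * pd j * (lm (gen k) * xo k) + lm (gen k) * xo k * (lm (gen j) * pd j) =
        (lm (gen j) * lm (gen k) + lm (gen k) * lm (gen j)) * (xo k * pd j)
        + lm (gen j) * lm (gen k) * (if j = k then 1 else 0)"
      by (simp add: pd_xo algebra_simps)
    then show ?thesis
      by (auto simp: lm_gen_anticommute lm_gen_square)
  qed
  have "dx K * vx K + vx K * dx K =
      (\<Sum>j\<in>K. \<Sum>k\<in>K. lm (gen j) * pd j * (lm (gen k) * xo k) + lm (gen k) * xo k * (lm (gen j) * pd j))"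
    unfolding dx_def vx_def sum_product sum.distrib by (subst (4) sum.swap) (rule refl)
  also have "\<dots> = (\<Sum>j\<in>K. - 2 * (xo j * pd j) - 1)"
    using assms by (simp add: t)
  also have "\<dots> = - 2 * eu K - of_nat (card K)"
    by (simp add: eu_def sum_subtractf sum_distrib_left sum_negf)
  finally have "dx K * vx K + vx K * dx K = - 2 * eu K - of_nat (card K)" .
  then have "dx K * vx K = - 2 * eu K - of_nat (card K) - vx K * dx K"
    by (simp only: eq_diff_eq)
  then show ?thesis by simp
qed

lemma eu_xo: "finite K \<Longrightarrow> eu K * xo k = xo k * eu K + (if k \<in> K then xo k else 0)"
proof -
  assume K: "finite K"
  have "xo j * pd j * xo k = xo k * (xo j * pd j) + (if j = k then xo j else 0)" for j
  proof -
    have "xo j * pd j * xo k = xo j * (xo k * pd j + (if j = k then 1 else 0))"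
      by (simp add: mult.assoc pd_xo)
    then show ?thesis by (auto simp: distrib_left mult_swap_assoc[OF xo_commute[of j k]])
  qed
  then show ?thesis
    using K by (simp add: eu_def sum_distrib_left sum_distrib_right sum.distrib sum.delta)
qed

lemma eu_pd: "finite K \<Longrightarrow> eu K * pd k = pd k * eu K - (if k \<in> K then pd k else 0)"
proof -
  assume K: "finite K"
  have "pd k * (xo j * pd j) = xo j * pd j * pd k + (if j = k then pd j else 0)" for j
  proof -
    have "pd k * (xo j * pd j) = (xo j * pd k + (if k = j then 1 else 0)) * pd j"
      by (metis mult.assoc pd_xo)
    then show ?thesis by (auto simp: distrib_right mult.assoc pd_commute)
  qed
  then show ?thesis
    using K by (simp add: eu_def sum_distrib_left sum_distrib_right sum.distrib sum.delta)
qed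

lemma eu_lm: "a \<in> cliff UNIV \<Longrightarrow> eu K * lm a = lm a * eu K"
  unfolding eu_def by (rule commute_sum[symmetric]) (metis mult.assoc pd_lm xo_lm)

lemma eu_vx:
  assumes "finite J" "K \<subseteq> J"
  shows "eu J * vx K = vx K * eu J + vx K"
proof -
  have "eu J * (lm (gen k) * xo k) = lm (gen k) * xo k * eu J + lm (gen k) * xo k" if "k \<in> K" for k
    using that assms by (auto simp: mult_swap_assoc[OF eu_lm] gen_in_cliff mult.assoc eu_xo distrib_left)
  then show ?thesis
    by (simp add: vx_def sum_distrib_left sum_distrib_right sum.distrib)
qed

lemma eu_dx:
  assumes "finite J" "K \<subseteq> J"
  shows "eu J * dx K = dx K * eu J - dx K"
proof -
  have "eu J * (lm (gen k) * pd k) = lm (gen k) * pd k * eu J - lm (gen k) * pd k" if "k \<in> K" for k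
    using that assms by (auto simp: mult_swap_assoc[OF eu_lm] gen_in_cliff mult.assoc eu_pd right_diff_distrib)
  then show ?thesis
    by (simp add: dx_def sum_distrib_left sum_distrib_right sum_subtractf)
qed

text \<open>Twice the Scasimir operator of the superalgebra \<open>osp(1|2)\<close> spanned by \<open>x\<close>, \<open>\<partial>\<^sub>x\<close> and
  their anticommutators; both \<open>S\<^sub>v\<close> and \<open>\<Gamma>\<^sub>x - (m - 1)/2\<close> are built from it.\<close>

definition scas :: "nat set \<Rightarrow> polyop" where
  "scas K = dx K * vx K - vx K * dx K + 1"

text \<open>Applying \<open>dx_vx\<close> twice gives \<open>[dx, vx^2] = - 2 * vx\<close>: the
  Euler terms cancel up to the degree shift of \<open>eu_vx\<close>. The summand \<open>1\<close> in
  \<open>scas\<close> is exactly what turns this into an anticommutation.\<close>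

lemma scas_vx:
  assumes "finite K"
  shows "scas K * vx K = - (vx K * scas K)"
proof -
  let ?x = "vx K" and ?d = "dx K" and ?E = "eu K" and ?n = "of_nat (card K) :: polyop"
  have n: "?n * ?x = ?x * ?n" by (metis mult_of_nat_commute)
  have "?d * ?x * ?x = (- (?x * ?d) - 2 * ?E - ?n) * ?x"
    by (simp add: dx_vx[OF assms])
  also have "\<dots> = - (?x * (?d * ?x)) - 2 * (?E * ?x) - ?n * ?x"
    by (simp add: algebra_simps)
  also have "\<dots> = ?x * (?x * ?d) - 2 * ?x"
    by (simp add: dx_vx[OF assms] eu_vx[OF assms order.refl] n algebra_simps mult_2 mult_2_right)
  finally show ?thesis
    by (simp add: scas_def algebra_simps mult_2)
qed

lemma scas_dx:
  assumes "finite K"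
  shows "scas K * dx K = - (dx K * scas K)"
proof -
  let ?x = "vx K" and ?d = "dx K" and ?E = "eu K" and ?n = "of_nat (card K) :: polyop"
  have n: "?n * ?d = ?d * ?n" by (metis mult_of_nat_commute)
  have "?d * (?d * ?x) = ?d * (- (?x * ?d) - 2 * ?E - ?n)"
    by (simp add: dx_vx[OF assms])
  also have "\<dots> = - (?d * ?x * ?d) - 2 * (?d * ?E) - ?d * ?n"
    by (simp add: algebra_simps mult_2 mult_2_right)
  also have "\<dots> = ?x * ?d * ?d + 2 * (?E * ?d) + ?n * ?d - 2 * (?d * ?E) - ?d * ?n"
    by (simp add: dx_vx[OF assms] algebra_simps)
  also have "\<dots> = ?x * ?d * ?d - 2 * ?d"
    by (simp add: eu_dx[OF assms order.refl] n algebra_simps mult_2 mult_2_right)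
  finally show ?thesis
    by (simp add: scas_def algebra_simps mult_2)
qed

lemma vx_dx_outside:
  assumes "a \<notin> K"
  shows "lm (gen a) * vx K = - (vx K * lm (gen a))" "lm (gen a) * dx K = - (dx K * lm (gen a))"
    "xo a * vx K = vx K * xo a" "xo a * dx K = dx K * xo a"
    "pd a * vx K = vx K * pd a" "pd a * dx K = dx K * pd a"
proof -
  have g: "lm (gen a) * lm (gen k) = - (lm (gen k) * lm (gen a))" if "k \<in> K" for k
    using that assms by (intro lm_gen_swap) auto
  have px: "pd a * xo k = xo k * pd a" "pd k * xo a = xo a * pd k" if "k \<in> K" for k
    using that assms by (auto simp: pd_xo)
  note n = mult_swap_neg_assoc and s = mult_swap_assoc
  show "lm (gen a) * vx K = - (vx K * lm (gen a))"
    unfolding vx_def by (rule anticommute_sum) (simp add: mult.assoc xo_lm gen_in_cliff n[OF g])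
  show "lm (gen a) * dx K = - (dx K * lm (gen a))"
    unfolding dx_def by (rule anticommute_sum) (simp add: mult.assoc pd_lm gen_in_cliff n[OF g])
  show "xo a * vx K = vx K * xo a"
    unfolding vx_def
    by (rule commute_sum) (simp add: mult.assoc xo_commute[of _ a] s[OF xo_lm] gen_in_cliff)
  show "xo a * dx K = dx K * xo a"
    unfolding dx_def
    by (rule commute_sum) (simp add: mult.assoc px s[OF xo_lm] gen_in_cliff)
  show "pd a * vx K = vx K * pd a"
    unfolding vx_def
    by (rule commute_sum) (simp add: mult.assoc px s[OF pd_lm] gen_in_cliff)
  show "pd a * dx K = dx K * pd a"
    unfolding dx_def
    by (rule commute_sum) (simp add: mult.assoc pd_commute[of _ a] s[OF pd_lm] gen_in_cliff)
qed

text \<open>Both products in \<open>scas\<close> contain two factors that anticommute with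
  \<open>gen a\<close>, so the signs cancel.\<close>

lemma scas_outside:
  assumes "a \<notin> K"
  shows "scas K * lm (gen a) = lm (gen a) * scas K" "scas K * xo a = xo a * scas K"
    "scas K * pd a = pd a * scas K"
proof -
  note o = vx_dx_outside[OF assms]
  show "scas K * lm (gen a) = lm (gen a) * scas K"
    unfolding scas_def
    by (simp add: algebra_simps mult_swap_neg_assoc[OF o(1)] mult_swap_neg_assoc[OF o(2)] o(1,2))
  show "scas K * xo a = xo a * scas K"
    unfolding scas_def
    by (simp add: algebra_simps mult_swap_assoc[OF o(3)] mult_swap_assoc[OF o(4)] o(3,4))
  show "scas K * pd a = pd a * scas K"
    unfolding scas_def
    by (simp add: algebra_simps mult_swap_assoc[OF o(5)] mult_swap_assoc[OF o(6)] o(5,6))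
qed

lemma e12_in_cliff: "e12 \<in> cliff UNIV"
  by (simp add: e12_def cliff.intros)

lemma lm_e12: "lm e12 = lm (gen 1) * lm (gen 2)"
  by (simp add: e12_def lm_mult gen_in_cliff)

definition mo :: polyop where
  "mo = xo 1 * pd 2 - xo 2 * pd 1 - sc (1/2) * lm e12"

lemma ap_mo: "P \<in> cpolys \<Longrightarrow> ap mo P = M12 P"
proof -
  assume P: "P \<in> cpolys"
  then have "ap mo P = xmult 1 (partial_deriv 2 P) - xmult 2 (partial_deriv 1 P) - cscale (1/2) (lmult e12 P)"
    by (simp add: mo_def partial_deriv_in_cpolys e12_in_cliff lmult_in_cpolys)
  then show ?thesis
    by (auto simp: M12_def xmult_def lmult_def cscale_def fun_eq_iff mult.assoc)
qed

text \<open>The operator S_v. By \<open>Gam_scas\<close>, \<open>Gam K\<close> minus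
  \<open>(card K - 1) / 2\<close> is half of \<open>scas K\<close>, and \<open>card K - 1\<close> is
  \<open>m - 3\<close> for \<open>K = {3..m}\<close>.\<close>

definition sv :: "nat set \<Rightarrow> polyop" where
  "sv K = sc (\<i> / 2) * (lm e12 * scas K)"

lemma Gam_scas:
  assumes "P \<in> cpolys"
  shows "Gam K P - cscale ((of_nat (card K) - 1) / 2) P = cscale (1/2) (ap (scas K) P)"
proof -
  have V: "vmult K P \<in> cpolys" "dirac K P \<in> cpolys"
    using assms by (metis ap_in ap_vx, metis ap_in ap_dx)
  have "cscale (1/2) (cscale (of_nat (card K)) P) - cscale ((of_nat (card K) - 1) / 2) P = cscale (1/2) P"
    by (simp flip: cfun.scale_left_diff_distrib add: field_simps)
  then show ?thesis
    using assms V by (simp add: Gam_def scas_def cfun.scale_right_distrib)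
qed

lemma S_v_eq:
  assumes "P \<in> cpolys" "m \<ge> 3"
  shows "S_v m P = ap (sv {3..m}) P"
proof -
  have c: "of_nat (card {3..m}) - 1 = (of_nat m - 3 :: complex)"
    using assms(2) by (simp add: of_nat_diff)
  show ?thesis
    using assms Gam_scas[of P "{3..m}"]
    by (simp add: c S_v_def sv_def e12_in_cliff lmult_in_cpolys lmult_cscale)
qed

lemma S_x_eq: "P \<in> cpolys \<Longrightarrow> S_x m P = ap (sc (1/2) * scas {1..m}) P"
  using Gam_scas[of P "{1..m}"] by (simp add: S_x_def)

lemma S_u_eq: "P \<in> cpolys \<Longrightarrow> S_u P = ap (sc \<i> * mo) P"
  by (simp add: S_u_def ap_mo[symmetric])

text \<open>\<open>M\<^sub>1\<^sub>2\<close> rotates \<open>(x\<^sub>1, x\<^sub>2)\<close>, \<open>(\<partial>\<^sub>1, \<partial>\<^sub>2)\<close> and \<open>(e\<^sub>1, e\<^sub>2)\<close> in the same way, so it fixes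
  the invariants \<open>x\<close> and \<open>\<partial>\<^sub>x\<close>.\<close>

lemma mo_commute_pair:
  assumes "(xo 1 * pd 2 - xo 2 * pd 1) * y1 = y1 * (xo 1 * pd 2 - xo 2 * pd 1) - y2"
    and "(xo 1 * pd 2 - xo 2 * pd 1) * y2 = y2 * (xo 1 * pd 2 - xo 2 * pd 1) + y1"
    and "\<And>a. y1 * lm (gen a) = lm (gen a) * y1" "\<And>a. y2 * lm (gen a) = lm (gen a) * y2"
  shows "mo * (lm (gen 1) * y1 + lm (gen 2) * y2) = (lm (gen 1) * y1 + lm (gen 2) * y2) * mo"
proof -
  let ?L = "xo 1 * pd 2 - xo 2 * pd 1" and ?g = "lm (gen 1)" and ?h = "lm (gen 2)"
  have Lg: "?L * lm (gen a) = lm (gen a) * ?L" for a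
    by (simp add: algebra_simps pd_lm gen_in_cliff mult_swap_assoc[OF xo_lm])
  have hg: "?h * ?g = - (?g * ?h)"
    by (rule lm_gen_swap) simp
  note gg = lm_gen_square[of 1] lm_gen_square[of 2] hg
  have L: "?L * (?g * y1 + ?h * y2) = (?g * y1 + ?h * y2) * ?L + (?h * y1 - ?g * y2)"
  proof -
    have "?L * (?g * y1) = ?g * (y1 * ?L - y2)" "?L * (?h * y2) = ?h * (y2 * ?L + y1)"
      by (simp_all only: mult_swap_assoc[OF Lg] assms(1,2))
    then show ?thesis
      unfolding distrib_left[of ?L] by (simp add: algebra_simps)
  qed
  have "?g * ?h * (?g * y1) = ?h * y1" "?g * ?h * (?h * y2) = - (?g * y2)"
  proof -
    have "?g * ?h * (?g * y1) = - (?g * ?g * ?h * y1)"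
      by (metis gg(3) mult.assoc mult_minus_left mult_minus_right)
    then show "?g * ?h * (?g * y1) = ?h * y1" by (simp add: gg)
    have "?g * ?h * (?h * y2) = ?g * (?h * ?h) * y2"
      by (simp add: mult.assoc)
    then show "?g * ?h * (?h * y2) = - (?g * y2)" by (simp add: gg)
  qed
  moreover have "?g * y1 * (?g * ?h) = - (?h * y1)" "?h * y2 * (?g * ?h) = ?g * y2"
  proof -
    have "?g * y1 * (?g * ?h) = ?g * ?g * ?h * y1"
      by (metis assms(3) mult.assoc)
    then show "?g * y1 * (?g * ?h) = - (?h * y1)" by (simp add: gg)
    have "?h * y2 * (?g * ?h) = ?h * ?g * ?h * y2"
      by (metis assms(4) mult.assoc)
    also have "\<dots> = - (?g * (?h * ?h) * y2)"
      by (metis gg(3) mult.assoc mult_minus_left)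
    finally show "?h * y2 * (?g * ?h) = ?g * y2" by (simp add: gg)
  qed
  \<comment> \<open>The spin part produces the infinitesimal rotation twice; with the factor 1/2 in
    \<open>mo\<close> it cancels the one produced by the orbital part in \<open>L\<close>.\<close>
  ultimately have E: "?g * ?h * (?g * y1 + ?h * y2) = (?g * y1 + ?h * y2) * (?g * ?h) + 2 * (?h * y1 - ?g * y2)"
    by (simp add: distrib_left distrib_right algebra_simps mult_2)
  have half: "sc (1/2) * (2 * A) = A" for A
    using sc_mult[of "1/2" 2] by (simp add: sc_numeral flip: mult.assoc)
  have E': "sc (1/2) * lm e12 * (?g * y1 + ?h * y2) =
      (?g * y1 + ?h * y2) * (sc (1/2) * lm e12) + (?h * y1 - ?g * y2)"
    unfolding lm_e12 mult.assoc[of "sc (1/2)"] E by (simp add: distrib_left right_diff_distrib sc_commute2 half)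
  show ?thesis
    unfolding mo_def by (simp only: left_diff_distrib right_diff_distrib L[unfolded left_diff_distrib right_diff_distrib] E') (simp add: algebra_simps)
qed

section \<open>The splitting of R^J into the plane and R^K\<close>

locale split_dims =
  fixes K J :: "nat set"
  assumes fin: "finite K" and K: "1 \<notin> K" "2 \<notin> K" and J: "J = insert 1 (insert 2 K)"
begin

lemma finite_J: "finite J" and KJ: "K \<subseteq> J" and in_J: "1 \<in> J" "2 \<in> J"
  using fin J by auto

lemma vx_split: "vx J = lm (gen 1) * xo 1 + lm (gen 2) * xo 2 + vx K"
  and dx_split: "dx J = lm (gen 1) * pd 1 + lm (gen 2) * pd 2 + dx K"
  and eu_split: "eu J = xo 1 * pd 1 + xo 2 * pd 2 + eu K"
  using fin K by (simp_all add: J vx_def dx_def eu_def add.assoc)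

lemma e12_commute: "lm e12 * vx K = vx K * lm e12" "lm e12 * dx K = dx K * lm e12"
  using vx_dx_outside(1,2)[OF K(1)] vx_dx_outside(1,2)[OF K(2)]
  by (metis (no_types, lifting) lm_e12 mult.assoc minus_mult_minus mult_minus_left mult_minus_right minus_minus)+

lemma mo_commute_K:
  "mo * vx K = vx K * mo" "mo * dx K = dx K * mo"
proof -
  have "w * mo = mo * w"
    if "xo 1 * w = w * xo 1" "xo 2 * w = w * xo 2" "pd 1 * w = w * pd 1" "pd 2 * w = w * pd 2"
      "lm e12 * w = w * lm e12" for w
  proof -
    have "w * (xo 1 * pd 2) = xo 1 * pd 2 * w" "w * (xo 2 * pd 1) = xo 2 * pd 1 * w"
      "w * (sc (1/2) * lm e12) = sc (1/2) * lm e12 * w"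
      by (intro commute_mult that[symmetric] sc_commute[symmetric])+
    then show ?thesis
      by (simp only: mo_def left_diff_distrib right_diff_distrib)
  qed
  then show "mo * vx K = vx K * mo" "mo * dx K = dx K * mo"
    using vx_dx_outside[OF K(1)] vx_dx_outside[OF K(2)] e12_commute by metis+
qed

lemma mo_vx: "mo * vx J = vx J * mo"
proof -
  have "mo * (lm (gen 1) * xo 1 + lm (gen 2) * xo 2) = (lm (gen 1) * xo 1 + lm (gen 2) * xo 2) * mo"
    by (rule mo_commute_pair)
      (simp_all add: algebra_simps pd_xo xo_lm gen_in_cliff mult_swap_assoc[OF xo_commute] xo_commute[of 2 1])
  then show ?thesis
    by (simp only: vx_split distrib_left[of mo _ "vx K"] distrib_right[of _ "vx K" mo] mo_commute_K)
qed

lemma mo_dx: "mo * dx J = dx J * mo"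
proof -
  have "mo * (lm (gen 1) * pd 1 + lm (gen 2) * pd 2) = (lm (gen 1) * pd 1 + lm (gen 2) * pd 2) * mo"
  proof (rule mo_commute_pair)
    have p: "pd j * (xo k * A) = xo k * (pd j * A) + (if j = k then A else 0)" for j k A
      by (simp add: pd_xo distrib_right flip: mult.assoc)
    show "(xo 1 * pd 2 - xo 2 * pd 1) * pd 1 = pd 1 * (xo 1 * pd 2 - xo 2 * pd 1) - pd 2"
      "(xo 1 * pd 2 - xo 2 * pd 1) * pd 2 = pd 2 * (xo 1 * pd 2 - xo 2 * pd 1) + pd 1"
      by (simp_all add: algebra_simps p pd_commute[of 2 1])
  qed (simp_all add: pd_lm gen_in_cliff)
  then show ?thesis
    by (simp only: dx_split distrib_left[of mo _ "dx K"] distrib_right[of _ "dx K" mo] mo_commute_K)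
qed

text \<open>On the plane part, \<open>e12\<close> anticommutes with \<open>gen 1\<close> and
  \<open>gen 2\<close> while \<open>scas K\<close> commutes with everything there. On the remaining
  part \<open>w\<close> the roles are exchanged. Either way the product \<open>e12 * scas K\<close>
  picks up exactly one sign.\<close>

lemma sv_commute_pair:
  fixes y :: "nat \<Rightarrow> polyop"
  assumes "\<And>a. a \<in> {1, 2} \<Longrightarrow> y a * scas K = scas K * y a" "\<And>a j. y a * lm (gen j) = lm (gen j) * y a"
    and "lm e12 * w = w * lm e12" "scas K * w = - (w * scas K)"
  shows "sv K * (lm (gen 1) * y 1 + lm (gen 2) * y 2 + w) = - ((lm (gen 1) * y 1 + lm (gen 2) * y 2 + w) * sv K)"
proof -
  have e: "lm e12 * lm (gen a) = - (lm (gen a) * lm e12)" if "a \<in> {1, 2}" for a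
  proof -
    have hg: "lm (gen 2) * lm (gen 1) = - (lm (gen 1) * lm (gen 2))" by (rule lm_gen_swap) simp
    show ?thesis
      using that unfolding lm_e12
      by (auto simp: mult.assoc hg mult_swap_neg_assoc[OF hg])
  qed
  have y: "y a * lm e12 = lm e12 * y a" for a
    by (metis assms(2) lm_e12 mult.assoc)
  have "lm e12 * scas K * (lm (gen a) * y a) = - (lm (gen a) * y a * (lm e12 * scas K))" if "a \<in> {1, 2}" for a
  proof -
    have "a \<notin> K" using that K by auto
    then have "lm e12 * scas K * (lm (gen a) * y a) = lm e12 * lm (gen a) * (y a * scas K)"
      using assms(1)[OF that] by (metis scas_outside(1) mult.assoc)
    also have "\<dots> = - (lm (gen a) * (lm e12 * y a) * scas K)"
      by (simp add: e[OF that] mult.assoc)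
    also have "\<dots> = - (lm (gen a) * y a * (lm e12 * scas K))"
      by (simp only: y[symmetric] mult.assoc)
    finally show ?thesis .
  qed
  moreover have "lm e12 * scas K * w = - (w * (lm e12 * scas K))"
    by (metis assms(3,4) mult.assoc mult_minus_right)
  ultimately show ?thesis
    unfolding sv_def by (simp add: mult.assoc distrib_left distrib_right sc_commute2)
qed

lemma sv_vx: "sv K * vx J = - (vx J * sv K)"
  unfolding vx_split
  by (rule sv_commute_pair) (use K in \<open>auto simp: scas_outside xo_lm gen_in_cliff e12_commute scas_vx fin\<close>)

lemma sv_dx: "sv K * dx J = - (dx J * sv K)"
  unfolding dx_split
  by (rule sv_commute_pair) (use K in \<open>auto simp: scas_outside pd_lm gen_in_cliff e12_commute scas_dx fin\<close>)

lemma mo_e12: "mo * lm e12 = lm e12 * mo"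
  by (simp add: mo_def left_diff_distrib right_diff_distrib mult.assoc pd_lm e12_in_cliff
      mult_swap_assoc[OF xo_lm] sc_commute2)

lemma mo_scas_K: "mo * scas K = scas K * mo"
  using mo_commute_K
  by (simp add: scas_def algebra_simps mult_swap_assoc[OF mo_commute_K(1)] mult_swap_assoc[OF mo_commute_K(2)])

lemma mo_sv: "mo * sv K = sv K * mo"
  unfolding sv_def by (metis mo_e12 mo_scas_K mult.assoc sc_commute)

lemma mo_scas_J: "mo * scas J = scas J * mo"
  by (simp add: scas_def algebra_simps mo_vx mo_dx mult_swap_assoc[OF mo_vx] mult_swap_assoc[OF mo_dx])

lemma sv_scas_J: "sv K * scas J = scas J * sv K"
  by (simp add: scas_def algebra_simps sv_vx sv_dx mult_swap_neg_assoc[OF sv_vx] mult_swap_neg_assoc[OF sv_dx])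

end

text \<open>Rule induction eta-expands polynomials, and these rules would then unfold every sum of
  polynomials.\<close>

lemmas pointwise = plus_fun_apply zero_fun_apply minus_apply uminus_apply
declare pointwise [simp del]

lemma ap_sum_right:
  assumes "\<And>i. i \<in> S \<Longrightarrow> f i \<in> cpolys"
  shows "ap A (sum f S) = (\<Sum>i\<in>S. ap A (f i))"
  using assms by (induction S rule: infinite_finite_induct) (simp_all add: ap_add cpolys_sum)

section \<open>Joint eigenvectors\<close>

text \<open>To eliminate the new vector \<open>g a\<close>, choose for each \<open>b\<close> an
  operator \<open>T \<kappa>\<close> separating \<open>b\<close> from \<open>a\<close> and apply
  \<open>T \<kappa> - l \<kappa> a\<close> to the relation. This kills \<open>g a\<close> and
  rescales the other vectors, which keep their eigenvalues, so the induction hypothesis applies to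
  them.\<close>

lemma joint_eigen_zero:
  fixes g :: "'i \<Rightarrow> cfun" and T :: "'k \<Rightarrow> polyop"
  assumes "finite I" "\<And>\<iota>. \<iota> \<in> I \<Longrightarrow> g \<iota> \<in> cpolys"
    and "\<And>\<kappa> \<iota>. \<iota> \<in> I \<Longrightarrow> ap (T \<kappa>) (g \<iota>) = cscale (l \<kappa> \<iota>) (g \<iota>)"
    and "\<And>\<iota> \<iota>'. \<iota> \<in> I \<Longrightarrow> \<iota>' \<in> I \<Longrightarrow> \<iota> \<noteq> \<iota>' \<Longrightarrow> \<exists>\<kappa>. l \<kappa> \<iota> \<noteq> l \<kappa> \<iota>'"
    and "(\<Sum>\<iota>\<in>I. g \<iota>) = 0" "\<iota> \<in> I"
  shows "g \<iota> = 0"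
  using assms
proof (induction I arbitrary: g \<iota> rule: finite_induct)
  case (insert a I)
  have gI: "g b = 0" if b: "b \<in> I" for b
  proof -
    have "\<exists>\<kappa>. l \<kappa> b \<noteq> l \<kappa> a"
      by (rule insert.prems(3)) (use insert.hyps b in auto)
    then obtain \<kappa> where \<kappa>: "l \<kappa> b \<noteq> l \<kappa> a" ..
    have sum: "(\<Sum>\<iota>\<in>I. g \<iota>) = - g a"
      using insert.prems(4) insert.hyps by (simp add: eq_neg_iff_add_eq_0 add.commute)
    have V: "g \<iota> \<in> cpolys" if "\<iota> \<in> insert a I" for \<iota> using insert.prems(1) that by blast
    have "(\<Sum>\<iota>\<in>I. cscale (l \<kappa> \<iota> - l \<kappa> a) (g \<iota>)) = (\<Sum>\<iota>\<in>I. ap (T \<kappa>) (g \<iota>)) - cscale (l \<kappa> a) (\<Sum>\<iota>\<in>I. g \<iota>)"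
      by (simp add: cfun.scale_left_diff_distrib sum_subtractf cfun.scale_sum_right insert.prems(2))
    also have "(\<Sum>\<iota>\<in>I. ap (T \<kappa>) (g \<iota>)) = ap (T \<kappa>) (\<Sum>\<iota>\<in>I. g \<iota>)"
      using V by (simp add: ap_sum_right)
    also have "\<dots> = - cscale (l \<kappa> a) (g a)"
    proof -
      have "- g a = cscale (- 1) (g a)" by simp
      then have "ap (T \<kappa>) (- g a) = cscale (- 1) (ap (T \<kappa>) (g a))"
        using V[of a] by (metis ap_cscale insertI1)
      then show ?thesis using insert.prems(2)[of a] unfolding sum by simp
    qed
    finally have z: "(\<Sum>\<iota>\<in>I. cscale (l \<kappa> \<iota> - l \<kappa> a) (g \<iota>)) = 0"
      by (simp add: sum cfun.scale_minus_right)
    have "cscale (l \<kappa> b - l \<kappa> a) (g b) = 0"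
    proof (rule insert.IH[OF _ _ _ z b])
      show "cscale (l \<kappa> \<iota> - l \<kappa> a) (g \<iota>) \<in> cpolys" if "\<iota> \<in> I" for \<iota>
        using V that by (simp add: cpolys_cscale)
      show "ap (T \<kappa>') (cscale (l \<kappa> \<iota> - l \<kappa> a) (g \<iota>)) = cscale (l \<kappa>' \<iota>) (cscale (l \<kappa> \<iota> - l \<kappa> a) (g \<iota>))"
        if "\<iota> \<in> I" for \<kappa>' \<iota>
        using V that insert.prems(2) by (simp add: ap_cscale mult.commute)
      show "\<exists>\<kappa>. l \<kappa> \<iota> \<noteq> l \<kappa> \<iota>'" if "\<iota> \<in> I" "\<iota>' \<in> I" "\<iota> \<noteq> \<iota>'" for \<iota> \<iota>'
        by (rule insert.prems(3)) (use that in auto)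
    qed
    then show "g b = 0" using \<kappa> by (simp add: cfun.scale_eq_0_iff)
  qed
  moreover have "g a = 0" using insert.prems(4) insert.hyps gI by simp
  ultimately show ?case using insert.prems(5) by blast
qed simp

lemma sum_nonzero_eq: "finite S \<Longrightarrow> {\<iota>. h \<iota> \<noteq> 0} \<subseteq> S \<Longrightarrow> (\<Sum>\<iota> | h \<iota> \<noteq> 0. h \<iota>) = sum h S"
  for h :: "'i \<Rightarrow> 'a::comm_monoid_add"
  by (rule sum.mono_neutral_left) auto

lemma span_UN_decomp:
  assumes W: "\<And>\<iota>. cfun.subspace (W \<iota>)" and P: "P \<in> cfun.span (\<Union>\<iota>. W \<iota>)"
  shows "\<exists>h. (\<forall>\<iota>. h \<iota> \<in> W \<iota>) \<and> finite {\<iota>. h \<iota> \<noteq> 0} \<and> P = (\<Sum>\<iota> | h \<iota> \<noteq> 0. h \<iota>)"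
  using P
proof (induction rule: cfun.span_induct_alt)
  case base
  show ?case using cfun.subspace_0[OF W] by (intro exI[of _ "\<lambda>_. 0"]) (auto simp: fun_eq_iff)
next
  case (step c x y)
  then obtain h \<kappa> where h: "\<And>\<iota>. h \<iota> \<in> W \<iota>" "finite {\<iota>. h \<iota> \<noteq> 0}" "y = (\<Sum>\<iota> | h \<iota> \<noteq> 0. h \<iota>)"
    and x: "x \<in> W \<kappa>" by blast
  \<comment> \<open>The component at \<open>\<kappa>\<close> may cancel to \<open>0\<close>, so the
    new support is only contained in \<open>?S\<close>.\<close>
  let ?S = "insert \<kappa> {\<iota>. h \<iota> \<noteq> 0}" and ?h = "h(\<kappa> := cscale c x + h \<kappa>)"
  have S: "finite ?S" "{\<iota>. ?h \<iota> \<noteq> 0} \<subseteq> ?S" using h(2) by auto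
  have "sum h {\<iota>. h \<iota> \<noteq> 0} = sum h ?S"
    using h(2) by (intro sum_nonzero_eq) auto
  then have "cscale c x + y = sum ?h ?S"
    using S(1) by (simp add: h(3) sum.remove[of ?S \<kappa>] add.assoc)
  then have "cscale c x + y = (\<Sum>\<iota> | ?h \<iota> \<noteq> 0. ?h \<iota>)"
    by (simp only: sum_nonzero_eq[OF S])
  moreover have "\<forall>\<iota>. ?h \<iota> \<in> W \<iota>"
    using h(1) x W by (auto intro: cfun.subspace_add cfun.subspace_scale)
  moreover have "finite {\<iota>. ?h \<iota> \<noteq> 0}" using S finite_subset by blast
  ultimately show ?case by blast
qed

lemma subspace_vimage_ap:
  assumes "cfun.subspace W"
  shows "cfun.subspace {P \<in> cpolys. ap A P \<in> W}"
  using assms subspace_cpolys by (auto simp: cfun.subspace_def ap_add ap_cscale)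

lemma ap_span:
  assumes "cfun.subspace W" "B \<subseteq> cpolys" "\<And>P. P \<in> B \<Longrightarrow> ap A P \<in> W" "P \<in> cfun.span B"
  shows "ap A P \<in> W"
  using cfun.span_minimal[OF _ subspace_vimage_ap[OF assms(1)], of B A] assms(2-4) by blast

lemma subspace_eigen: "cfun.subspace {P \<in> cpolys. ap A P = cscale c P}"
  using subspace_cpolys
  by (auto simp: cfun.subspace_def ap_add ap_cscale cfun.scale_right_distrib mult.commute)

text \<open>Applying \<open>T - c\<close> to the decomposition of \<open>P\<close> gives a vanishing
  sum of the eigenvectors \<open>cscale (l n - c) (h n)\<close> with distinct eigenvalues.\<close>

lemma eigen_component:
  fixes h :: "'i \<Rightarrow> cfun"
  assumes h: "\<And>n. h n \<in> cpolys" "finite {n. h n \<noteq> 0}" "P = (\<Sum>n | h n \<noteq> 0. h n)"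
    and T: "\<And>n. ap T (h n) = cscale (l n) (h n)" "inj l" "ap T P = cscale c P"
    and n: "l n \<noteq> c"
  shows "h n = 0"
proof (cases "h n = 0")
  case False
  have "cscale (l n - c) (h n) = 0"
  proof (rule joint_eigen_zero[where I = "{n. h n \<noteq> 0}" and T = "\<lambda>_::unit. T" and l = "\<lambda>_. l"])
    have P: "P \<in> cpolys" using h by (simp add: cpolys_sum)
    have "ap T P = (\<Sum>n | h n \<noteq> 0. ap T (h n))"
      unfolding h(3) using h(1) by (rule ap_sum_right)
    then have "(\<Sum>n | h n \<noteq> 0. cscale (l n) (h n)) = cscale c (\<Sum>n | h n \<noteq> 0. h n)"
      using T by (simp add: h(3))
    then show "(\<Sum>n | h n \<noteq> 0. cscale (l n - c) (h n)) = 0"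
      by (simp add: cfun.scale_left_diff_distrib sum_subtractf cfun.scale_sum_right)
  qed (use h T False in \<open>auto simp: cpolys_cscale ap_cscale mult.commute inj_def\<close>)
  with n show ?thesis by (simp add: cfun.scale_eq_0_iff)
qed

section \<open>Homogeneous polynomials\<close>

text \<open>Both Euler's equation and the scaling property are recorded: the operator calculus
  yields the former, \<open>monogenic_hom\<close> is stated with the latter.
  \<open>hom_polyI_eu\<close> and \<open>hom_polyI_dilation\<close> show that each of them suffices
  for polynomials over \<open>K\<close>.\<close>

definition hom_poly :: "nat set \<Rightarrow> nat \<Rightarrow> cfun set" where
  "hom_poly K n = {P \<in> cpoly K. ap (eu K) P = cscale (of_nat n) P \<and>
     (\<forall>t y. P (\<lambda>j. t * y j) = scal (of_real (t ^ n)) * P y)}"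

lemma hom_poly_cpoly: "P \<in> hom_poly K n \<Longrightarrow> P \<in> cpoly K"
  by (simp add: hom_poly_def)

lemma subspace_hom_poly:
  assumes "finite K"
  shows "cfun.subspace (hom_poly K n)"
proof -
  have "hom_poly K n = {P \<in> cpolys. ap (eu K) P = cscale (of_nat n) P} \<inter> cpoly K \<inter>
      {P. \<forall>t y. P (\<lambda>j. t * y j) = scal (of_real (t ^ n)) * P y}"
    using assms cpolysI by (auto simp: hom_poly_def)
  moreover have "cfun.subspace {P. \<forall>t y. P (\<lambda>j. t * y j) = scal (of_real (t ^ n)) * P y}"
    by (auto simp: pointwise cfun.subspace_def distrib_left cscale_def scal_scal_commute simp del: of_real_power)
  ultimately show ?thesis
    by (simp only: cfun.subspace_inter subspace_eigen subspace_cpoly)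
qed

lemma one_hom_poly:
  assumes "finite K"
  shows "(\<lambda>_. 1) \<in> hom_poly K 0"
proof -
  have c: "(\<lambda>_. 1) \<in> cpoly K" by (simp add: const_in_cpoly one_in_cliff)
  then have "(\<lambda>_. 1) \<in> cpolys" using assms cpolysI by blast
  then have "ap (eu K) (\<lambda>_. 1) = 0"
    by (simp add: eu_def ap_sum partial_deriv_in_cpolys partial_deriv_const)
  then show ?thesis using c by (simp add: hom_poly_def scal_one)
qed

lemma xmult_hom_poly:
  assumes "finite K" "j \<in> K" "P \<in> hom_poly K n"
  shows "xmult j P \<in> hom_poly K (Suc n)"
proof -
  have P: "P \<in> cpolys" "P \<in> cpoly K" using assms cpolysI hom_poly_cpoly by blast+
  have "ap (eu K * xo j) P = ap (xo j * eu K + xo j) P"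
    using assms by (simp add: eu_xo)
  then have "ap (eu K) (xmult j P) = cscale (of_nat (Suc n)) (xmult j P)"
    using P assms(3) by (simp add: hom_poly_def xmult_in_cpolys cpolys_cscale xmult_cscale
        cfun.scale_left_distrib add.commute)
  moreover have "xmult j P (\<lambda>j. t * y j) = scal (of_real (t ^ Suc n)) * xmult j P y" for t y
    using assms(3) by (simp add: hom_poly_def xmult_def scal_mult mult.assoc scal_scal_commute[of "of_real (y j)"])
  ultimately show ?thesis
    using P assms by (simp add: hom_poly_def xmult_in_cpoly)
qed

lemma lmult_hom_poly:
  assumes "finite K" "a \<in> cliff K" "P \<in> hom_poly K n"
  shows "lmult a P \<in> hom_poly K n"
proof -
  have P: "P \<in> cpolys" "P \<in> cpoly K" using assms cpolysI hom_poly_cpoly by blast+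
  have "ap (eu K * lm a) P = ap (lm a * eu K) P"
    using assms cliff_UNIV by (simp add: eu_lm)
  then have "ap (eu K) (lmult a P) = cscale (of_nat n) (lmult a P)"
    using P assms cliff_UNIV[OF assms(2)]
    by (simp add: hom_poly_def lmult_in_cpolys cpolys_cscale lmult_cscale)
  moreover have "lmult a P (\<lambda>j. t * y j) = scal (of_real (t ^ n)) * lmult a P y" for t y
    using assms(3) by (simp add: hom_poly_def lmult_def scal_left_commute)
  ultimately show ?thesis
    using P assms by (simp add: hom_poly_def lmult_in_cpoly)
qed

lemma hom_poly_cpolys: "finite K \<Longrightarrow> P \<in> hom_poly K n \<Longrightarrow> P \<in> cpolys"
  using cpolysI hom_poly_cpoly by blast

lemma cpoly_span_hom:
  assumes "finite K" "P \<in> cpoly K"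
  shows "P \<in> cfun.span (\<Union>n. hom_poly K n)"
  using assms
proof (induction rule: cpoly_induct)
  case subspace
  show ?case by simp
next
  case one
  show ?case using one_hom_poly[OF assms(1)] by (auto intro: cfun.span_base)
next
  case (xmult j P)
  have sub: "(\<Union>n. hom_poly K n) \<subseteq> cpolys" using hom_poly_cpolys[OF assms(1)] by blast
  have "ap (xo j) Q \<in> cfun.span (\<Union>n. hom_poly K n)" if Q: "Q \<in> (\<Union>n. hom_poly K n)" for Q
  proof -
    obtain n where n: "Q \<in> hom_poly K n" using Q by blast
    have "Q \<in> cpolys" by (rule hom_poly_cpolys[OF assms(1) n])
    moreover have "xmult j Q \<in> (\<Union>n. hom_poly K n)"
      by (rule UN_I[of "Suc n"]) (simp_all add: xmult_hom_poly[OF assms(1) xmult(1) n])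
    ultimately show ?thesis by (simp add: gen_in_cliff cfun.span_base)
  qed
  then have "ap (xo j) P \<in> cfun.span (\<Union>n. hom_poly K n)"
    using ap_span[OF cfun.subspace_span sub _ xmult(2)] by blast
  moreover have "P \<in> cpolys" using xmult(2) sub cfun.span_minimal[OF sub subspace_cpolys] by blast
  ultimately show ?case by simp
next
  case (gen j P)
  have sub: "(\<Union>n. hom_poly K n) \<subseteq> cpolys" using hom_poly_cpolys[OF assms(1)] by blast
  have "ap (lm (gen j)) Q \<in> cfun.span (\<Union>n. hom_poly K n)" if Q: "Q \<in> (\<Union>n. hom_poly K n)" for Q
  proof -
    obtain n where n: "Q \<in> hom_poly K n" using Q by blast
    have "Q \<in> cpolys" by (rule hom_poly_cpolys[OF assms(1) n])
    moreover have "lmult (gen j) Q \<in> (\<Union>n. hom_poly K n)"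
      by (rule UN_I[of n]) (simp_all add: lmult_hom_poly[OF assms(1) cliff.intros(2)[OF gen(1)] n])
    ultimately show ?thesis by (simp add: gen_in_cliff cfun.span_base)
  qed
  then have "ap (lm (gen j)) P \<in> cfun.span (\<Union>n. hom_poly K n)"
    using ap_span[OF cfun.subspace_span sub _ gen(2)] by blast
  moreover have "P \<in> cpolys" using gen(2) sub cfun.span_minimal[OF sub subspace_cpolys] by blast
  ultimately show ?case by (simp add: gen_in_cliff)
qed

lemma hom_decomp:
  assumes "finite K" "P \<in> cpoly K"
  obtains h where "\<And>n. h n \<in> hom_poly K n" "finite {n. h n \<noteq> 0}" "P = (\<Sum>n | h n \<noteq> 0. h n)"
  using span_UN_decomp[OF subspace_hom_poly[OF assms(1)] cpoly_span_hom[OF assms]] by blast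

text \<open>The only eigenvalues of the Euler operator on polynomials are degrees. This is what
  excludes negative and fractional eigenvalues below.\<close>

lemma eu_injective:
  assumes "finite K" "P \<in> cpoly K" "ap (eu K) P = cscale c P" "\<And>n. c \<noteq> of_nat n"
  shows "P = 0"
proof -
  obtain h where h: "\<And>n. h n \<in> hom_poly K n" "finite {n. h n \<noteq> 0}" "P = (\<Sum>n | h n \<noteq> 0. h n)"
    using hom_decomp[OF assms(1,2)] by blast
  have "h n = 0" for n
    by (rule eigen_component[where T = "eu K" and l = of_nat, OF hom_poly_cpolys[OF assms(1) h(1)]
          h(2,3) _ _ assms(3)])
      (use h(1) assms(4)[of n] in \<open>auto simp: hom_poly_def inj_def\<close>)
  then show ?thesis using h(3) by simp
qed

text \<open>An operator that acts on each degree by its own scalar detects the degree: all other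
  homogeneous components of \<open>P\<close> vanish by \<open>eigen_component\<close>. The Euler
  operator and a dilation are the two instances.\<close>

lemma hom_polyI_eigen:
  assumes "finite K" "P \<in> cpoly K" "ap T P = cscale (l n) P" "inj l"
    and "\<And>n Q. Q \<in> hom_poly K n \<Longrightarrow> ap T Q = cscale (l n) Q"
  shows "P \<in> hom_poly K n"
proof -
  obtain h where h: "\<And>n. h n \<in> hom_poly K n" "finite {n. h n \<noteq> 0}" "P = (\<Sum>n | h n \<noteq> 0. h n)"
    using hom_decomp[OF assms(1,2)] by blast
  have "h k = 0" if "k \<noteq> n" for k
    by (rule eigen_component[where T = T and l = l, OF hom_poly_cpolys[OF assms(1) h(1)] h(2,3)
          assms(5)[OF h(1)] assms(4,3)])
      (use that \<open>inj l\<close> in \<open>simp add: inj_eq\<close>)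
  then have "{k. h k \<noteq> 0} \<subseteq> {n}" by auto
  then have "P = h n" using h(3) sum_nonzero_eq[of "{n}" h] by simp
  then show ?thesis using h by simp
qed

lemma hom_polyI_eu:
  assumes "finite K" "P \<in> cpoly K" "ap (eu K) P = cscale (of_nat n) P"
  shows "P \<in> hom_poly K n"
  by (rule hom_polyI_eigen[where l = of_nat, OF assms]) (auto simp: inj_def hom_poly_def)

text \<open>The single dilation by \<open>2\<close> already separates the degrees, its eigenvalues
  \<open>2 ^ n\<close> being distinct.\<close>

lemma hom_polyI_dilation:
  assumes "finite K" "P \<in> cpoly K" "\<And>t y. P (\<lambda>j. t * y j) = scal (of_real (t ^ n)) * P y"
  shows "P \<in> hom_poly K n"
proof -
  let ?f = "\<lambda>(P :: cfun) y. P (\<lambda>j. 2 * y j)"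
  have f: "?f Q \<in> cpoly J" if "finite J" "Q \<in> cpoly J" for J Q
  proof -
    have "Q \<in> {Q. ?f Q \<in> cpoly J}"
      using that
    proof (induction rule: cpoly_induct)
      case subspace
      have "?f 0 = 0" "?f (P + Q) = ?f P + ?f Q" "?f (cscale c P) = cscale c (?f P)" for P Q c
        by (auto simp: pointwise cscale_def)
      then show ?case using subspace_cpoly[of J] by (simp add: cfun.subspace_def)
    next
      case one
      show ?case by (simp add: const_in_cpoly one_in_cliff)
    next
      case (xmult j P)
      have "?f (xmult j P) = cscale 2 (xmult j (?f P))"
        by (auto simp: xmult_def cscale_def scal_mult mult.assoc)
      then show ?case
        using xmult that subspace_cpoly[of J] by (auto simp: cfun.subspace_def xmult_in_cpoly)
    next
      case (gen j P)
      have "?f (lmult (gen j) P) = lmult (gen j) (?f P)" by (auto simp: lmult_def)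
      then show ?case using gen by (auto intro: lmult_in_cpoly cliff.intros)
    qed
    then show ?thesis by simp
  qed
  have p: "is_polyop ?f"
  proof (rule is_polyopI)
    show "?f Q \<in> cpolys" if "Q \<in> cpolys" for Q
      using that f by (meson cpolysE cpolysI)
  qed (auto simp: cscale_def pointwise)
  have Pc: "Q \<in> hom_poly K n \<Longrightarrow> Q \<in> cpolys" for Q n using assms(1) hom_poly_cpolys by blast
  show ?thesis
  proof (rule hom_polyI_eigen[where T = "mkop ?f" and l = "\<lambda>n. 2 ^ n", OF assms(1,2)])
    show "ap (mkop ?f) P = cscale (2 ^ n) P"
      using p assms cpolysI by (auto simp: cscale_def)
    show "inj (\<lambda>n. 2 ^ n :: complex)"
    proof (rule injI)
      fix a b :: nat assume "2 ^ a = (2 ^ b :: complex)"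
      then have "norm (2 ^ a :: complex) = norm (2 ^ b :: complex)" by simp
      then show "a = b" by (simp add: norm_power)
    qed
    show "ap (mkop ?f) Q = cscale (2 ^ n) Q" if "Q \<in> hom_poly K n" for n Q
      using that p Pc[OF that] by (auto simp: hom_poly_def cscale_def)
  qed
qed

section \<open>The Fischer decomposition\<close>

lemma vx_in_cpoly: "finite J \<Longrightarrow> K \<subseteq> J \<Longrightarrow> P \<in> cpoly J \<Longrightarrow> ap (vx K) P \<in> cpoly J"
  using cpolysI[of J P]
  by (auto simp: vx_def ap_sum xmult_in_cpolys gen_in_cliff simp del: ap_vx
      intro!: cfun.subspace_sum[OF subspace_cpoly] lmult_in_cpoly xmult_in_cpoly cliff.intros)

lemma dx_in_cpoly: "finite J \<Longrightarrow> K \<subseteq> J \<Longrightarrow> P \<in> cpoly J \<Longrightarrow> ap (dx K) P \<in> cpoly J"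
  using cpolysI[of J P]
  by (auto simp: dx_def ap_sum partial_deriv_in_cpolys gen_in_cliff simp del: ap_dx
      intro!: cfun.subspace_sum[OF subspace_cpoly] lmult_in_cpoly has_pd_partial_deriv(2) cliff.intros)

lemma eu_in_cpoly: "finite J \<Longrightarrow> K \<subseteq> J \<Longrightarrow> P \<in> cpoly J \<Longrightarrow> ap (eu K) P \<in> cpoly J"
  using cpolysI[of J P]
  by (auto simp: eu_def ap_sum partial_deriv_in_cpolys
      intro!: cfun.subspace_sum[OF subspace_cpoly] xmult_in_cpoly has_pd_partial_deriv(2))

lemma monogenic_iff: "finite K \<Longrightarrow> P \<in> monogenic K \<longleftrightarrow> P \<in> cpoly K \<and> ap (dx K) P = 0"
  using cpolysI[of K P] by (auto simp: monogenic_def)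

lemma subspace_monogenic:
  assumes "finite K"
  shows "cfun.subspace (monogenic K)"
proof -
  have "monogenic K = cpoly K \<inter> {P \<in> cpolys. ap (dx K) P \<in> {0}}"
    using assms cpolysI by (auto simp: monogenic_iff)
  then show ?thesis
    by (simp only: cfun.subspace_inter subspace_cpoly subspace_vimage_ap cfun.subspace_single_0)
qed

lemma monogenic_hom_eq: "finite K \<Longrightarrow> monogenic_hom K n = monogenic K \<inter> hom_poly K n"
  by (auto simp: monogenic_hom_def monogenic_iff intro: hom_polyI_dilation) (auto simp: hom_poly_def)

section \<open>Powers of the vector variable against the Euler and Dirac operators\<close>

lemma eu_vx_power: "finite K \<Longrightarrow> eu K * vx K ^ s = vx K ^ s * eu K + of_nat s * vx K ^ s"
proof (induction s)
  case (Suc s)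
  have "eu K * vx K ^ Suc s = (vx K * eu K + vx K) * vx K ^ s"
    using eu_vx[OF Suc.prems order.refl] by (simp flip: mult.assoc)
  also have "\<dots> = vx K * (eu K * vx K ^ s) + vx K ^ Suc s"
    by (simp add: algebra_simps)
  also have "vx K * (of_nat s * vx K ^ s) = of_nat s * (vx K * vx K ^ s)"
    by (metis mult.assoc mult_of_nat_commute)
  then have "vx K * (eu K * vx K ^ s) = vx K ^ Suc s * eu K + of_nat s * vx K ^ Suc s"
    using Suc by (simp add: distrib_left mult.assoc)
  finally show ?case by (simp add: algebra_simps)
qed simp

text \<open>The commutator of \<open>\<partial>\<^sub>x\<close> with \<open>x\<^sup>s\<close>, up to the factor \<open>x\<^bsup>s - 1\<^esup>\<close>: a nonzero scalar on
  homogeneous polynomials.\<close>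

definition dx_coeff :: "nat set \<Rightarrow> nat \<Rightarrow> polyop" where
  "dx_coeff K s = (if even s then - of_nat s else - (2 * eu K + of_nat (card K + (s - 1))))"

lemma dx_vx_power:
  assumes "finite K"
  shows "dx K * vx K ^ Suc s = (- 1) ^ Suc s * vx K ^ Suc s * dx K + vx K ^ s * dx_coeff K (Suc s)"
proof (induction s)
  case 0
  then show ?case by (simp add: dx_vx[OF assms] dx_coeff_def)
next
  case (Suc s)
  let ?x = "vx K" and ?d = "dx K" and ?E = "eu K" and ?n = "of_nat (card K) :: polyop"
  have c: "A * of_nat j = of_nat j * A" for A :: polyop and j by (rule mult_of_nat_commute[symmetric])
  have m: "?x * ((- 1) ^ k * A) = (- 1) ^ k * (?x * A)" for k A
    by (cases "even k") simp_all
  have "?d * ?x ^ Suc (Suc s) = (- (?x * ?d) - 2 * ?E - ?n) * ?x ^ Suc s"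
    using dx_vx[OF assms] by (simp flip: mult.assoc)
  also have "\<dots> = - (?x * (?d * ?x ^ Suc s)) - 2 * (?E * ?x ^ Suc s) - ?n * ?x ^ Suc s"
    by (simp only: left_diff_distrib mult_minus_left mult.assoc)
  also have "\<dots> = (- 1) ^ Suc (Suc s) * ?x ^ Suc (Suc s) * ?d
      + (- (?x ^ Suc s * dx_coeff K (Suc s)) - 2 * (?x ^ Suc s * ?E) - of_nat (2 * Suc s + card K) * ?x ^ Suc s)"
    unfolding Suc eu_vx_power[OF assms]
    by (simp add: distrib_left distrib_right mult.assoc m) (simp add: algebra_simps m mult_2)
  also have "- (?x ^ Suc s * dx_coeff K (Suc s)) - 2 * (?x ^ Suc s * ?E) - of_nat (2 * Suc s + card K) * ?x ^ Suc s
      = ?x ^ Suc s * (- dx_coeff K (Suc s) - 2 * ?E - of_nat (2 * Suc s + card K))"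
    by (simp only: right_diff_distrib mult_minus_right c mult_2 distrib_left distrib_right)
  \<comment> \<open>The recursion behind the two cases of \<open>dx_coeff\<close>: for even
    \<open>s\<close> the Euler terms and \<open>card K\<close> cancel, leaving
    \<open>- (s + 2)\<close>; for odd \<open>s\<close> the earlier coefficient is a scalar and the
    Euler term survives.\<close>
  also have "- dx_coeff K (Suc s) - 2 * ?E - of_nat (2 * Suc s + card K) = dx_coeff K (Suc (Suc s))"
  proof (cases "even s")
    case True
    have "2 * Suc s + card K = (card K + s) + Suc (Suc s)" by simp
    then have "of_nat (2 * Suc s + card K) = of_nat (card K + s) + (of_nat (Suc (Suc s)) :: polyop)"
      by (simp only: of_nat_add)
    then show ?thesis using True by (simp add: dx_coeff_def del: of_nat_add of_nat_Suc)
  next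
    case False
    have "2 * Suc s + card K = Suc s + (card K + Suc s)" by simp
    then have "of_nat (2 * Suc s + card K) = of_nat (Suc s) + (of_nat (card K + Suc s) :: polyop)"
      by (simp only: of_nat_add)
    then show ?thesis using False by (simp add: dx_coeff_def del: of_nat_add of_nat_Suc)
  qed
  finally show ?case .
qed

lemma dx_vx_power_monogenic:
  assumes "finite K" "h \<in> monogenic K"
  shows "ap (dx K) (ap (vx K ^ Suc s) h) = ap (vx K ^ s) (ap (dx_coeff K (Suc s)) h)"
proof -
  have h: "h \<in> cpolys" "ap (dx K) h = 0" using assms cpolysI by (auto simp: monogenic_iff)
  have "ap (dx K) (ap (vx K ^ Suc s) h) = ap (dx K * vx K ^ Suc s) h"
    using h(1) by simp
  also have "\<dots> = ap ((- 1) ^ Suc s * vx K ^ Suc s) (ap (dx K) h) + ap (vx K ^ s) (ap (dx_coeff K (Suc s)) h)"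
    unfolding dx_vx_power[OF assms(1)] using h(1) by (simp only: ap_ring)
  finally show ?thesis using h by simp
qed

lemma vx_power_hom_poly:
  assumes "finite K" "P \<in> hom_poly K n"
  shows "ap (vx K ^ s) P \<in> hom_poly K (n + s)"
proof -
  have P: "P \<in> cpolys" "P \<in> cpoly K" using assms hom_poly_cpoly hom_poly_cpolys by blast+
  have "ap (vx K ^ s) P \<in> cpoly K"
    using P assms by (induction s) (auto simp: vx_in_cpoly simp del: ap_vx)
  moreover have "ap (eu K) (ap (vx K ^ s) P) = cscale (of_nat (n + s)) (ap (vx K ^ s) P)"
  proof -
    have "ap (eu K) (ap (vx K ^ s) P) = ap (vx K ^ s * eu K + of_nat s * vx K ^ s) P"
      using P by (simp flip: eu_vx_power[OF assms(1)])
    then show ?thesis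
      using P assms(2) by (simp add: ap_of_nat hom_poly_def ap_cscale cfun.scale_left_distrib)
  qed
  ultimately show ?thesis using hom_polyI_eu[OF assms(1)] by blast
qed

context
  fixes K :: "nat set"
  assumes fin: "finite K" and ne: "K \<noteq> {}"
begin

lemma dx_coeff_hom:
  assumes "P \<in> hom_poly K n"
  obtains c where "c \<noteq> 0" "ap (dx_coeff K (Suc s)) P = cscale c P"
proof -
  have P: "P \<in> cpolys" using assms hom_poly_cpolys[OF fin] by blast
  \<comment> \<open>This keeps the scalar nonzero also for \<open>n = s = 0\<close>.\<close>
  have "card K > 0" using fin ne by (simp add: card_gt_0_iff)
  then have c: "- of_nat (2 * n + card K + s) \<noteq> (0::complex)" by (simp only: neg_equal_0_iff_equal of_nat_eq_0_iff)
  show ?thesis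
  proof (cases "even (Suc s)")
    case True
    then have "ap (dx_coeff K (Suc s)) P = cscale (- of_nat (Suc s)) P"
      using P by (simp only: dx_coeff_def if_True ap_ring ap_of_nat cfun.scale_minus_left)
    moreover have "- of_nat (Suc s) \<noteq> (0::complex)"
      by (simp only: neg_equal_0_iff_equal of_nat_eq_0_iff)
    ultimately show ?thesis using that by blast
  next
    case False
    then have "ap (dx_coeff K (Suc s)) P =
        - (cscale (of_nat n) P + cscale (of_nat n) P + cscale (of_nat (card K + s)) P)"
      using P assms by (simp add: dx_coeff_def ap_of_nat hom_poly_def mult_2 del: of_nat_add)
    also have "\<dots> = cscale (- (of_nat n + of_nat n + of_nat (card K + s))) P"
      by (simp only: cfun.scale_minus_left cfun.scale_left_distrib)
    also have "- (of_nat n + of_nat n + of_nat (card K + s)) = (- of_nat (2 * n + card K + s) :: complex)"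
      by simp
    finally show ?thesis using that c by blast
  qed
qed

text \<open>A preimage under \<open>\<partial>\<^sub>x\<close> of the decomposition of \<open>\<partial>\<^sub>x P\<close> is obtained by raising all powers of
  \<open>x\<close> by one; it differs from \<open>P\<close> by a monogenic polynomial.\<close>

lemma hom_poly_fischer:
  assumes "P \<in> hom_poly K n"
  shows "P \<in> cfun.span (\<Union>s\<in>{..n}. ap (vx K ^ s) ` monogenic_hom K (n - s))"
  using assms
proof (induction n arbitrary: P)
  case 0
  have P: "P \<in> cpolys" "P \<in> cpoly K" "ap (eu K) P = 0"
    using 0 hom_poly_cpolys[OF fin 0] by (auto simp: hom_poly_def)
  have "ap (eu K) (ap (dx K) P) = ap (dx K * eu K - dx K) P"
    using P(1) by (metis ap_ring(6) eu_dx[OF fin order.refl])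
  \<comment> \<open>The image would be homogeneous of degree -1, which forces it to vanish.\<close>
  then have "ap (eu K) (ap (dx K) P) = cscale (- 1) (ap (dx K) P)"
    using P by (simp del: ap_dx)
  moreover have "- 1 \<noteq> (of_nat n :: complex)" for n
    by (metis Re_complex_of_real complex_Re_of_nat of_nat_0_le_iff of_real_minus of_real_1 zero_le_one neg_0_le_iff_le not_one_le_zero one_complex.sel(1) uminus_complex.sel(1))
  ultimately have "ap (dx K) P = 0"
    using eu_injective[OF fin dx_in_cpoly[OF fin order.refl P(2)]] by blast
  then have "P \<in> monogenic_hom K 0"
    using P 0 by (simp add: monogenic_hom_eq fin monogenic_iff del: ap_dx)
  moreover have "ap (vx K ^ 0) P = P" using P by simp
  ultimately show ?case by (intro cfun.span_base) force
next
  case (Suc n)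
  let ?B = "\<lambda>n. \<Union>s\<in>{..n}. ap (vx K ^ s) ` monogenic_hom K (n - s)"
  have P: "P \<in> cpolys" "P \<in> cpoly K" "ap (eu K) P = cscale (of_nat (Suc n)) P"
    using Suc.prems hom_poly_cpolys[OF fin Suc.prems] by (auto simp: hom_poly_def)
  \<comment> \<open>The preimage \<open>R\<close> found below has to be homogeneous of degree
    \<open>Suc n\<close>, so that \<open>P - R\<close> lies in
    \<open>monogenic_hom K (Suc n)\<close>.\<close>
  have B: "cfun.span (?B n) \<subseteq> hom_poly K n" for n
  proof (rule cfun.span_minimal[OF _ subspace_hom_poly[OF fin]])
    show "?B n \<subseteq> hom_poly K n"
    proof
      fix Q assume "Q \<in> ?B n"
      then obtain s h where h: "s \<le> n" "h \<in> monogenic_hom K (n - s)" "Q = ap (vx K ^ s) h" by blast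
      then have "h \<in> hom_poly K (n - s)" by (simp add: monogenic_hom_eq fin)
      from vx_power_hom_poly[OF fin this, of s] show "Q \<in> hom_poly K n" using h by simp
    qed
  qed
  have "ap (eu K) (ap (dx K) P) = ap (dx K * eu K - dx K) P"
    using P(1) by (metis ap_ring(6) eu_dx[OF fin order.refl])
  then have "ap (eu K) (ap (dx K) P) = cscale (of_nat n) (ap (dx K) P)"
    using P by (simp add: ap_add ap_cscale cpolys_cscale cfun.scale_left_distrib del: ap_dx)
  then have "ap (dx K) P \<in> hom_poly K n"
    using hom_polyI_eu[OF fin dx_in_cpoly[OF fin order.refl P(2)]] by blast
  then have "ap (dx K) P \<in> cfun.span (?B n)" by (rule Suc.IH)
  moreover have "\<exists>R\<in>cfun.span (?B (Suc n)). ap (dx K) R = Q" if "Q \<in> cfun.span (?B n)" for Q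
    using that
  proof (induction rule: cfun.span_induct_alt)
    case base
    then show ?case using cfun.span_zero[of "?B (Suc n)"] ap_zero[of "dx K"] by blast
  next
    case (step c Q Q')
    then obtain s h where Q: "s \<le> n" "h \<in> monogenic_hom K (n - s)" "Q = ap (vx K ^ s) h" by blast
    obtain R where R: "R \<in> cfun.span (?B (Suc n))" "ap (dx K) R = Q'" using step by blast
    have h: "h \<in> hom_poly K (n - s)" "h \<in> monogenic K" "h \<in> cpolys"
      using Q fin hom_poly_cpolys[OF fin] by (auto simp: monogenic_hom_eq)
    obtain d where d: "d \<noteq> 0" "ap (dx_coeff K (Suc s)) h = cscale d h"
      using dx_coeff_hom[OF h(1)] by blast
    let ?R = "ap (vx K ^ Suc s) h"
    have "?R \<in> ?B (Suc n)" using Q by (auto intro!: bexI[of _ "Suc s"])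
    \<comment> \<open>Division by \<open>d\<close> undoes the scalar that \<open>dx K\<close>
      produces when it lowers the power from \<open>Suc s\<close> to \<open>s\<close>.\<close>
    then have "cscale (c / d) ?R + R \<in> cfun.span (?B (Suc n))"
      by (rule cfun.span_add[OF cfun.span_scale[OF cfun.span_base] R(1)])
    moreover have "ap (dx K) (cscale (c / d) ?R + R) = cscale c Q + Q'"
    proof -
      have RV: "R \<in> cpolys" using R B[of "Suc n"] hom_poly_cpolys[OF fin] by blast
      have "ap (dx K) ?R = cscale d Q"
        using dx_vx_power_monogenic[OF fin h(2), of s] h(3) by (simp only: d(2) Q(3) ap_cscale)
      then show ?thesis
        using RV R(2) d(1) by (simp add: ap_add ap_cscale cpolys_cscale del: ap_dx power_Suc)
    qed
    ultimately show ?case by blast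
  qed
  ultimately obtain R where R: "R \<in> cfun.span (?B (Suc n))" "ap (dx K) R = ap (dx K) P" by blast
  then have RH: "R \<in> hom_poly K (Suc n)" "R \<in> cpolys" using B hom_poly_cpolys[OF fin] by blast+
  have PR: "P - R \<in> hom_poly K (Suc n)"
    using Suc RH cfun.subspace_diff[OF subspace_hom_poly[OF fin]] by blast
  have "ap (dx K) (P - R + R) = ap (dx K) (P - R) + ap (dx K) R"
    using PR RH hom_poly_cpolys[OF fin] by (blast intro: ap_add)
  then have "ap (dx K) (P - R) = 0" using R(2) by simp
  then have "P - R \<in> monogenic_hom K (Suc n)"
    using PR by (simp add: monogenic_hom_eq fin monogenic_iff hom_poly_cpoly del: ap_dx)
  moreover have "ap (vx K ^ 0) (P - R) = P - R" using PR hom_poly_cpolys[OF fin] by simp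
  ultimately have "P - R \<in> cfun.span (?B (Suc n))"
    by (intro cfun.span_base) (force intro!: bexI[of _ "0::nat"])
  then have "P - R + R \<in> cfun.span (?B (Suc n))" using R(1) by (rule cfun.span_add)
  then show ?case by simp
qed

lemma cpoly_fischer_hom:
  assumes "P \<in> cpoly K"
  shows "P \<in> cfun.span (\<Union>s n. ap (vx K ^ s) ` monogenic_hom K n)"
proof -
  have "cfun.span (\<Union>n. hom_poly K n) \<subseteq> cfun.span (\<Union>s n. ap (vx K ^ s) ` monogenic_hom K n)"
  proof (rule cfun.span_minimal)
    have "cfun.span (\<Union>s\<in>{..n}. ap (vx K ^ s) ` monogenic_hom K (n - s)) \<subseteq>
        cfun.span (\<Union>s n. ap (vx K ^ s) ` monogenic_hom K n)" for n
      by (rule cfun.span_mono) blast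
    then show "(\<Union>n. hom_poly K n) \<subseteq> cfun.span (\<Union>s n. ap (vx K ^ s) ` monogenic_hom K n)"
      using hom_poly_fischer by blast
  qed simp
  then show ?thesis using cpoly_span_hom[OF fin assms] by blast
qed

lemma ap_vx_power: "P \<in> cpolys \<Longrightarrow> ap (vx K ^ s) P = (vmult K ^^ s) P"
proof (induction s)
  case (Suc s)
  then show ?case by (metis ap_in ap_ring(6) ap_vx funpow.simps(2) o_apply power_Suc)
qed simp

lemma monogenic_cpolys: "P \<in> monogenic K \<Longrightarrow> P \<in> cpolys"
  using fin cpolysI by (auto simp: monogenic_iff)

lemma cpoly_fischer:
  assumes "P \<in> cpoly K"
  obtains h where "\<And>s. h s \<in> monogenic K" "finite {s. h s \<noteq> 0}"
    "P = (\<Sum>s | h s \<noteq> 0. ap (vx K ^ s) (h s))"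
proof -
  have sub: "cfun.subspace (ap (vx K ^ s) ` monogenic K)" for s
  proof (rule cfun.subspaceI)
    note M = subspace_monogenic[OF fin]
    show "0 \<in> ap (vx K ^ s) ` monogenic K"
      using cfun.subspace_0[OF M] ap_zero by (metis imageI)
    fix P Q assume "P \<in> ap (vx K ^ s) ` monogenic K" "Q \<in> ap (vx K ^ s) ` monogenic K"
    then obtain P' Q' where "P' \<in> monogenic K" "Q' \<in> monogenic K" "P = ap (vx K ^ s) P'" "Q = ap (vx K ^ s) Q'"
      by blast
    then show "P + Q \<in> ap (vx K ^ s) ` monogenic K"
      using cfun.subspace_add[OF M] ap_add monogenic_cpolys by (metis imageI)
  next
    note M = subspace_monogenic[OF fin]
    fix c P assume "P \<in> ap (vx K ^ s) ` monogenic K"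
    then show "cscale c P \<in> ap (vx K ^ s) ` monogenic K"
      using cfun.subspace_scale[OF M] ap_cscale monogenic_cpolys by (smt (verit) imageE imageI)
  qed
  have "(\<Union>s n. ap (vx K ^ s) ` monogenic_hom K n) \<subseteq> (\<Union>s. ap (vx K ^ s) ` monogenic K)"
    using fin by (auto simp: monogenic_hom_eq)
  then have "P \<in> cfun.span (\<Union>s. ap (vx K ^ s) ` monogenic K)"
    using cpoly_fischer_hom[OF assms] cfun.span_mono by blast
  from span_UN_decomp[OF sub this] obtain g where g: "\<And>s. g s \<in> ap (vx K ^ s) ` monogenic K"
    "finite {s. g s \<noteq> 0}" "P = (\<Sum>s | g s \<noteq> 0. g s)" by blast
  \<comment> \<open>Injectivity of \<open>vx K ^ s\<close> on monogenics is not yet known; choosing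
    \<open>0\<close> for a zero component makes the supports of \<open>g\<close> and
    \<open>h\<close> agree.\<close>
  define h where "h s = (if g s = 0 then 0 else SOME h. h \<in> monogenic K \<and> g s = ap (vx K ^ s) h)" for s
  have h: "h s \<in> monogenic K \<and> g s = ap (vx K ^ s) (h s)" for s
  proof (cases "g s = 0")
    case True
    then show ?thesis using cfun.subspace_0[OF subspace_monogenic[OF fin]] by (simp add: h_def)
  next
    case False
    have "\<exists>h. h \<in> monogenic K \<and> g s = ap (vx K ^ s) h" using g(1) by blast
    from someI_ex[OF this] show ?thesis using False by (simp add: h_def)
  qed
  have "h s = 0 \<longleftrightarrow> g s = 0" for s
  proof
    assume "h s = 0"
    then show "g s = 0" using h[of s] by simp
  qed (simp add: h_def)
  then have e: "{s. h s \<noteq> 0} = {s. g s \<noteq> 0}" by simp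
  show ?thesis
    by (rule that[of h]) (use h g in \<open>auto simp: e intro!: sum.cong\<close>)
qed

text \<open>Here \<open>h\<close> need not be homogeneous, so for odd \<open>Suc s\<close> the
  coefficient is no scalar. An element of its kernel would be an eigenvector of \<open>eu K\<close>
  with the negative eigenvalue \<open>- (card K + s) / 2\<close>, which is no degree.\<close>

lemma dx_coeff_monogenic:
  assumes "h \<in> monogenic K"
  shows "ap (dx_coeff K (Suc s)) h \<in> monogenic K"
    and "ap (dx_coeff K (Suc s)) h = 0 \<Longrightarrow> h = 0"
proof -
  have h: "h \<in> cpolys" "h \<in> cpoly K" "ap (dx K) h = 0"
    using assms fin cpolysI by (auto simp: monogenic_iff)
  have "ap (dx K) (ap (eu K) h) = ap (eu K * dx K + dx K) h"
    using h(1) eu_dx[OF fin order.refl] by simp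
  then have E: "ap (eu K) h \<in> monogenic K"
    using h by (simp add: monogenic_iff fin eu_in_cpoly del: ap_dx)
  note M = subspace_monogenic[OF fin]
  have c: "ap (dx_coeff K (Suc s)) h = (if even (Suc s) then cscale (- of_nat (Suc s)) h
      else cscale (- 2) (ap (eu K) h) - cscale (of_nat (card K + s)) h)"
  proof (cases "even (Suc s)")
    case False
    have "cscale (- 2) Q = - (Q + Q)" for Q :: cfun
      using cfun.scale_left_distrib[of "-1" "-1" Q] by simp
    then show ?thesis
      using False h(1) by (simp add: dx_coeff_def ap_of_nat mult_2 del: of_nat_add)
  qed (use h(1) in \<open>simp add: dx_coeff_def ap_of_nat del: of_nat_Suc\<close>)
  show "ap (dx_coeff K (Suc s)) h \<in> monogenic K"
    unfolding c using E assms cfun.subspace_scale[OF M] cfun.subspace_diff[OF M] by (simp only: split: if_split) blast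
  assume 0: "ap (dx_coeff K (Suc s)) h = 0"
  show "h = 0"
  proof (cases "even (Suc s)")
    case True
    then have "cscale (- of_nat (Suc s)) h = 0" using 0 c by simp
    then show ?thesis by (simp only: cfun.scale_eq_0_iff neg_equal_0_iff_equal of_nat_eq_0_iff) simp
  next
    case False
    define r :: real where "r = of_nat (card K + s) / 2"
    have "card K > 0" using fin ne by (simp add: card_gt_0_iff)
    then have r: "r > 0" by (simp add: r_def)
    have "cscale (- 2) (ap (eu K) h) = cscale (of_nat (card K + s)) h"
      using 0 c False by simp
    then have "cscale (- 1 / 2) (cscale (- 2) (ap (eu K) h)) = cscale (- 1 / 2) (cscale (of_nat (card K + s)) h)"
      by (simp only:)
    then have "ap (eu K) h = cscale (- of_real r) h"
      by (simp add: r_def)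
    moreover have "- of_real r \<noteq> (of_nat n :: complex)" for n
    proof
      assume "- of_real r = (of_nat n :: complex)"
      then have "Re (- of_real r) = Re (of_nat n)" by simp
      then show False using r by simp
    qed
    ultimately show ?thesis using eu_injective[OF fin h(2)] by blast
  qed
qed

text \<open>Applying \<open>dx K\<close> removes \<open>h 0\<close> and lowers every other power by
  one, at the cost of the injective \<open>dx_coeff\<close>. By the induction hypothesis all
  \<open>h (Suc s)\<close> vanish, and the original relation then leaves only
  \<open>h 0\<close>.\<close>

lemma fischer_unique:
  assumes "\<And>s. h s \<in> monogenic K" "(\<Sum>s<N. ap (vx K ^ s) (h s)) = 0" "s < N"
  shows "h s = 0"
  using assms
proof (induction N arbitrary: h s)
  case (Suc N)
  have V: "h s \<in> cpolys" for s using Suc.prems(1) monogenic_cpolys by blast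
  have split: "(\<Sum>s<Suc N. ap (vx K ^ s) (h s)) = h 0 + (\<Sum>s<N. ap (vx K ^ Suc s) (h (Suc s)))"
    using V by (simp add: sum.lessThan_Suc_shift del: power_Suc sum.lessThan_Suc)
  have "ap (dx K) (h 0 + (\<Sum>s<N. ap (vx K ^ Suc s) (h (Suc s)))) =
      ap (dx K) (h 0) + (\<Sum>s<N. ap (dx K) (ap (vx K ^ Suc s) (h (Suc s))))"
    using V by (simp add: ap_add ap_sum_right cpolys_sum del: ap_dx power_Suc)
  also have "ap (dx K) (h 0) = 0" using Suc.prems(1)[of 0] fin by (simp add: monogenic_iff)
  finally have "(\<Sum>s<N. ap (vx K ^ s) (ap (dx_coeff K (Suc s)) (h (Suc s)))) = 0"
    using Suc.prems(1,2) split by (simp add: dx_vx_power_monogenic fin del: power_Suc ap_dx)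
  then have "ap (dx_coeff K (Suc s)) (h (Suc s)) = 0" if "s < N" for s
    by (rule Suc.IH[rotated]) (use dx_coeff_monogenic(1) Suc.prems(1) that in auto)
  then have hS: "h (Suc s) = 0" if "s < N" for s
    using dx_coeff_monogenic(2) Suc.prems(1) that by blast
  then have "h 0 = 0" using Suc.prems(2) split by simp
  then show ?case using hS Suc.prems(3) by (cases s) auto
qed simp

end

section \<open>The monogenic projection\<close>

context
  fixes K :: "nat set"
  assumes fin: "finite K" and ne: "K \<noteq> {}"
begin

lemma vx_power_in_cpoly: "P \<in> cpoly K \<Longrightarrow> ap (vx K ^ s) P \<in> cpoly K"
proof (induction s)
  case (Suc s)
  then have "ap (vx K) (ap (vx K ^ s) P) \<in> cpoly K" by (simp add: vx_in_cpoly fin del: ap_vx)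
  then show ?case using Suc.prems cpolysI[OF fin] by simp
qed (use cpolysI[OF fin] in simp)

lemma fischer_coeffs_unique:
  assumes "\<And>s. f s \<in> monogenic K" "finite {s. f s \<noteq> 0}"
    and "\<And>s. g s \<in> monogenic K" "finite {s. g s \<noteq> 0}"
    and "(\<Sum>s | f s \<noteq> 0. ap (vx K ^ s) (f s)) = (\<Sum>s | g s \<noteq> 0. ap (vx K ^ s) (g s))"
  shows "f = g"
proof -
  obtain N where N: "{s. f s \<noteq> 0} \<union> {s. g s \<noteq> 0} \<subseteq> {..<N}"
    using finite_nat_set_iff_bounded[of "{s. f s \<noteq> 0} \<union> {s. g s \<noteq> 0}"] assms(2,4) by auto
  have V: "f s \<in> cpolys" "g s \<in> cpolys" for s
    using assms(1,3) monogenic_cpolys[OF fin ne] by blast+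
  have "(\<Sum>s<N. ap (vx K ^ s) (f s)) = (\<Sum>s | f s \<noteq> 0. ap (vx K ^ s) (f s))"
    "(\<Sum>s<N. ap (vx K ^ s) (g s)) = (\<Sum>s | g s \<noteq> 0. ap (vx K ^ s) (g s))"
    using N by (auto intro!: sum.mono_neutral_right)
  then have "(\<Sum>s<N. ap (vx K ^ s) (f s) - ap (vx K ^ s) (g s)) = 0"
    using assms(5) by (simp add: sum_subtractf)
  moreover have "ap (vx K ^ s) (f s - g s) = ap (vx K ^ s) (f s) - ap (vx K ^ s) (g s)" for s
    using V ap_add[of "f s - g s" "g s" "vx K ^ s"] cpolys_diff
    by (simp add: algebra_simps)
  ultimately have "(\<Sum>s<N. ap (vx K ^ s) (f s - g s)) = 0" by simp
  then have "f s - g s = 0" if "s < N" for s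
    by (rule fischer_unique[OF fin ne, rotated])
      (use that assms(1,3) cfun.subspace_diff[OF subspace_monogenic[OF fin]] in auto)
  moreover have "f s = 0 \<and> g s = 0" if "\<not> s < N" for s
    using N that by auto
  ultimately show ?thesis by (metis eq_iff_diff_eq_0 ext)
qed

text \<open>Any splitting into a monogenic part and a multiple of \<open>x\<close> determines the
  projection: decompose \<open>R\<close>, shift all powers up by one, and use uniqueness of the
  coefficients.\<close>

lemma monogenic_proj_eq:
  assumes "h \<in> monogenic K" "R \<in> cpoly K"
  shows "monogenic_proj K (h + ap (vx K) R) = h"
proof -
  obtain r where r: "\<And>s. r s \<in> monogenic K" "finite {s. r s \<noteq> 0}"
    "R = (\<Sum>s | r s \<noteq> 0. ap (vx K ^ s) (r s))"
    using cpoly_fischer[OF fin ne assms(2)] by blast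
  have V: "r s \<in> cpolys" for s
    using r(1) monogenic_cpolys[OF fin ne] by blast
  define f where "f s = (case s of 0 \<Rightarrow> h | Suc s \<Rightarrow> r s)" for s
  obtain N where N: "{s. r s \<noteq> 0} \<subseteq> {..<N}"
    using finite_nat_set_iff_bounded[of "{s. r s \<noteq> 0}"] r(2) by auto
  have fN: "{s. f s \<noteq> 0} \<subseteq> {..<Suc N}"
  proof
    fix s assume "s \<in> {s. f s \<noteq> 0}"
    then show "s \<in> {..<Suc N}" using N by (cases s) (auto simp: f_def)
  qed
  then have ff: "finite {s. f s \<noteq> 0}" using finite_subset by blast
  have fM: "f s \<in> monogenic K" for s
    using assms(1) r(1) by (auto simp: f_def split: nat.split)
  have "R = (\<Sum>s<N. ap (vx K ^ s) (r s))"
    unfolding r(3) using N by (intro sum.mono_neutral_left) auto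
  then have "ap (vx K) R = (\<Sum>s<N. ap (vx K ^ Suc s) (r s))"
    using V by (simp add: ap_sum_right del: ap_vx)
  then have "h + ap (vx K) R = (\<Sum>s<Suc N. ap (vx K ^ s) (f s))"
    using monogenic_cpolys[OF fin ne assms(1)]
    by (simp only: sum.lessThan_Suc_shift) (simp add: f_def del: power_Suc ap_vx)
  also have "\<dots> = (\<Sum>s | f s \<noteq> 0. ap (vx K ^ s) (f s))"
    using fN by (intro sum.mono_neutral_right) auto
  finally have P: "h + ap (vx K) R = (\<Sum>s | f s \<noteq> 0. ap (vx K ^ s) (f s))" .
  have conv: "(\<Sum>s | g s \<noteq> 0. (vmult K ^^ s) (g s)) = (\<Sum>s | g s \<noteq> 0. ap (vx K ^ s) (g s))"
    if "\<And>s. g s \<in> monogenic K" for g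
    using that monogenic_cpolys[OF fin ne] by (intro sum.cong refl) (simp add: ap_vx_power[OF fin ne])
  show ?thesis
    unfolding monogenic_proj_def
  proof (rule the_equality)
    show "\<exists>g. (\<forall>s. g s \<in> monogenic K) \<and> finite {s. g s \<noteq> 0} \<and>
        h + ap (vx K) R = (\<Sum>s | g s \<noteq> 0. (vmult K ^^ s) (g s)) \<and> h = g 0"
      using fM ff P conv[of f] by (intro exI[of _ f]) (simp add: f_def)
  next
    fix Q assume "\<exists>g. (\<forall>s. g s \<in> monogenic K) \<and> finite {s. g s \<noteq> 0} \<and>
        h + ap (vx K) R = (\<Sum>s | g s \<noteq> 0. (vmult K ^^ s) (g s)) \<and> Q = g 0"
    then obtain g where g: "\<And>s. g s \<in> monogenic K" "finite {s. g s \<noteq> 0}"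
        "h + ap (vx K) R = (\<Sum>s | g s \<noteq> 0. (vmult K ^^ s) (g s))" "Q = g 0" by blast
    have "f = g"
      by (rule fischer_coeffs_unique[OF fM ff g(1,2)]) (use P g(3) conv[OF g(1)] in \<open>simp only:\<close>)
    then have "g 0 = f 0" by simp
    then show "Q = h" using g(4) by (simp add: f_def)
  qed
qed

lemma monogenic_proj_decomp:
  assumes "P \<in> cpoly K"
  obtains R where "monogenic_proj K P \<in> monogenic K" "R \<in> cpoly K" "P = monogenic_proj K P + ap (vx K) R"
proof -
  obtain f where f: "\<And>s. f s \<in> monogenic K" "finite {s. f s \<noteq> 0}"
    "P = (\<Sum>s | f s \<noteq> 0. ap (vx K ^ s) (f s))"
    using cpoly_fischer[OF fin ne assms] by blast
  have V: "f s \<in> cpolys" "f s \<in> cpoly K" for s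
    using f(1) monogenic_cpolys[OF fin ne] monogenic_iff[OF fin] by blast+
  obtain N where N: "{s. f s \<noteq> 0} \<subseteq> {..<N}"
    using finite_nat_set_iff_bounded[of "{s. f s \<noteq> 0}"] f(2) by auto
  have "P = (\<Sum>s<Suc N. ap (vx K ^ s) (f s))"
    unfolding f(3) using N by (intro sum.mono_neutral_left) auto
  also have "\<dots> = f 0 + (\<Sum>s<N. ap (vx K ^ Suc s) (f (Suc s)))"
    using V by (simp only: sum.lessThan_Suc_shift) simp
  also have "\<dots> = f 0 + ap (vx K) (\<Sum>s<N. ap (vx K ^ s) (f (Suc s)))"
    using V by (simp add: ap_sum_right del: ap_vx)
  finally have P: "P = f 0 + ap (vx K) (\<Sum>s<N. ap (vx K ^ s) (f (Suc s)))" .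
  have R: "(\<Sum>s<N. ap (vx K ^ s) (f (Suc s))) \<in> cpoly K"
    using V by (intro cfun.subspace_sum[OF subspace_cpoly] vx_power_in_cpoly)
  have "monogenic_proj K P = f 0"
    using monogenic_proj_eq[OF f(1) R, of 0] P by simp
  then show ?thesis using that[OF _ R] f(1) P by simp
qed

lemma monogenic_proj_in: "P \<in> cpoly K \<Longrightarrow> monogenic_proj K P \<in> monogenic K"
  using monogenic_proj_decomp by metis

lemma monogenic_proj_monogenic: "P \<in> monogenic K \<Longrightarrow> monogenic_proj K P = P"
  using monogenic_proj_eq[of P 0] cfun.subspace_0[OF subspace_cpoly] by simp

lemma monogenic_proj_vx: "R \<in> cpoly K \<Longrightarrow> monogenic_proj K (ap (vx K) R) = 0"
  using monogenic_proj_eq[of 0 R] cfun.subspace_0[OF subspace_monogenic[OF fin]] by simp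

text \<open>An additive map that preserves the monogenics and the image of \<open>x\<close>
  preserves the splitting of \<open>monogenic_proj_decomp\<close>. Asking only for some
  \<open>R'\<close> covers operators that anticommute with \<open>x\<close> or shift past it, as
  well as scalars and reflections.\<close>

lemma monogenic_proj_commute:
  assumes add: "\<And>P Q. P \<in> cpoly K \<Longrightarrow> Q \<in> cpoly K \<Longrightarrow> T (P + Q) = T P + T Q"
    and mon: "\<And>P. P \<in> monogenic K \<Longrightarrow> T P \<in> monogenic K"
    and vx: "\<And>R. R \<in> cpoly K \<Longrightarrow> \<exists>R'\<in>cpoly K. T (ap (vx K) R) = ap (vx K) R'"
    and P: "P \<in> cpoly K"
  shows "T (monogenic_proj K P) = monogenic_proj K (T P)"
proof -
  obtain R where R: "monogenic_proj K P \<in> monogenic K" "R \<in> cpoly K"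
    "P = monogenic_proj K P + ap (vx K) R"
    using monogenic_proj_decomp[OF P] by blast
  obtain R' where R': "R' \<in> cpoly K" "T (ap (vx K) R) = ap (vx K) R'" using vx[OF R(2)] by blast
  have "T P = T (monogenic_proj K P + ap (vx K) R)" using R(3) by (rule arg_cong)
  also have "\<dots> = T (monogenic_proj K P) + ap (vx K) R'"
    using R(1,2) monogenic_iff[OF fin] vx_in_cpoly[OF fin order.refl] R'(2) by (metis add)
  finally show ?thesis using monogenic_proj_eq[OF mon[OF R(1)] R'(1)] by simp
qed

lemma monogenic_proj_cscale:
  assumes "P \<in> cpoly K"
  shows "monogenic_proj K (cscale c P) = cscale c (monogenic_proj K P)"
proof (rule monogenic_proj_commute[OF _ _ _ assms, symmetric])
  show "\<exists>R'\<in>cpoly K. cscale c (ap (vx K) R) = ap (vx K) R'" if "R \<in> cpoly K" for R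
    using that cpolysI[OF fin that]
    by (intro bexI[of _ "cscale c R"]) (auto simp: ap_cscale cfun.subspace_scale[OF subspace_cpoly] simp del: ap_vx)
qed (auto simp: cfun.scale_right_distrib cfun.subspace_scale[OF subspace_monogenic[OF fin]])

lemma monogenic_proj_add:
  assumes "P \<in> cpoly K" "Q \<in> cpoly K"
  shows "monogenic_proj K (P + Q) = monogenic_proj K P + monogenic_proj K Q"
proof -
  obtain R where R: "monogenic_proj K P \<in> monogenic K" "R \<in> cpoly K"
    "P = monogenic_proj K P + ap (vx K) R"
    using monogenic_proj_decomp[OF assms(1)] by blast
  obtain R' where R': "monogenic_proj K Q \<in> monogenic K" "R' \<in> cpoly K"
    "Q = monogenic_proj K Q + ap (vx K) R'"
    using monogenic_proj_decomp[OF assms(2)] by blast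
  have "P + Q = (monogenic_proj K P + monogenic_proj K Q) + (ap (vx K) R + ap (vx K) R')"
    by (subst R(3), subst R'(3)) (simp add: algebra_simps)
  also have "ap (vx K) R + ap (vx K) R' = ap (vx K) (R + R')"
    using R(2) R'(2) cpolysI[OF fin] by (simp add: ap_add del: ap_vx)
  finally show ?thesis
    using monogenic_proj_eq R R' cfun.subspace_add[OF subspace_cpoly]
      cfun.subspace_add[OF subspace_monogenic[OF fin]] by metis
qed

end

section \<open>The Clifford algebra of the plane\<close>

text \<open>Since \<open>e\<^sub>1, e\<^sub>2, e\<^sub>1\<^sub>2\<close> multiply like the quaternion units, products reduce to arithmetic with
  complex coefficients.\<close>

definition c2 :: "complex \<Rightarrow> complex \<Rightarrow> complex \<Rightarrow> complex \<Rightarrow> clifford" where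
  "c2 p q r t = scal p + scal q * gen 1 + scal r * gen 2 + scal t * e12"

lemma gen_swap: "a \<noteq> b \<Longrightarrow> gen a * gen b = - (gen b * gen a)"
  using gen_anticommute[of a b] by (simp add: eq_neg_iff_add_eq_0)

lemma c2_mult:
  "c2 p q r t * c2 p' q' r' t' = c2 (p * p' - q * q' - r * r' - t * t') (p * q' + q * p' + r * t' - t * r')
     (p * r' + r * p' + t * q' - q * t') (p * t' + t * p' + q * r' - r * q')"
proof -
  let ?g = "gen 1" and ?h = "gen 2"
  have gg: "?g * ?g = - 1" "?h * ?h = - 1" "?h * ?g = - (?g * ?h)"
    by (rule gen_square, rule gen_square, rule gen_swap, simp)
  have a: "?g * ?h * ?g = ?h" "?g * (?g * ?h) = - ?h" "?h * (?g * ?h) = ?g" "?g * ?h * ?h = - ?g"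
    "?g * ?h * (?g * ?h) = - 1"
  proof -
    show 1: "?g * ?h * ?g = ?h" "?g * ?h * ?h = - ?g" by (simp_all add: gg mult.assoc) (simp add: gg flip: mult.assoc)
    show "?g * (?g * ?h) = - ?h" by (simp add: gg flip: mult.assoc)
    show 2: "?h * (?g * ?h) = ?g" by (simp add: gg mult.assoc flip: mult.assoc[of ?h])
    show "?g * ?h * (?g * ?h) = - 1" by (simp only: mult.assoc 2 gg)
  qed
  have s: "(scal x * u) * (scal y * v) = scal (x * y) * (u * v)" for x y u v
    by (metis mult.assoc scal_central scal_mult)
  have s1: "scal x * (scal y * v) = scal (x * y) * v" "(scal x * u) * scal y = scal (x * y) * u" for x y u v
    by (simp add: scal_mult mult.assoc) (metis mult.assoc mult.commute scal_central scal_mult)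
  show ?thesis
    unfolding c2_def e12_def
    by (simp only: distrib_left distrib_right s s1 scal_mult[symmetric] gg a mult_minus_right mult_1_right scal_add scal_diff left_diff_distrib)
      (simp add: algebra_simps)
qed

lemma c2_add: "c2 p q r t + c2 p' q' r' t' = c2 (p + p') (q + q') (r + r') (t + t')"
  by (simp add: c2_def scal_add algebra_simps)

lemma c2_uminus: "- c2 p q r t = c2 (- p) (- q) (- r) (- t)"
  by (simp add: c2_def scal_uminus)

lemma c2_scal: "scal c * c2 p q r t = c2 (c * p) (c * q) (c * r) (c * t)"
  by (simp add: c2_def distrib_left scal_mult mult.assoc)

lemma c2_units:
  "scal p = c2 p 0 0 0" "1 = c2 1 0 0 0" "gen 1 = c2 0 1 0 0" "gen 2 = c2 0 0 1 0" "e12 = c2 0 0 0 1"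
  "0 = c2 0 0 0 0"
  by (simp_all add: c2_def scal_one)

lemma Tplus_c2: "Tplus = c2 0 (1/2) (\<i>/2) 0"
  unfolding Tplus_def by (simp only: c2_units c2_add c2_scal c2_uminus c2_mult) simp

lemma Tminus_c2: "Tminus = c2 0 (1/2) (- \<i>/2) 0"
  unfolding Tminus_def diff_conv_add_uminus by (simp only: c2_units c2_add c2_scal c2_uminus c2_mult) simp

lemma Iplus_c2: "Iplus = c2 (1/2) 0 0 (\<i>/2)"
  unfolding Iplus_def Tplus_c2 Tminus_c2 c2_uminus c2_mult by simp

lemma Iminus_c2: "Iminus = c2 (1/2) 0 0 (- \<i>/2)"
  unfolding Iminus_def Tplus_c2 Tminus_c2 c2_uminus c2_mult by simp

lemmas c2_units' = Tplus_c2 Tminus_c2 Iplus_c2 Iminus_c2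

lemma c2_in_cliff: "c2 p q r t \<in> cliff {1, 2}"
  unfolding c2_def e12_def by (intro cliff.intros) auto

text \<open>The eigenvalue of left multiplication by \<open>\<i> * e12\<close> on the factors of a
  kind: I_+ and T_+ span its eigenspace for 1 in the algebra of the plane, I_- and T_- the one for
  -1. Hence the pairing of the two choices of X.\<close>

fun kind_sign :: "kind \<Rightarrow> int" where
  "kind_sign Ka = 1" | "kind_sign Kb = - 1" | "kind_sign Kc = - 1" | "kind_sign Kd = 1"

lemma kind_factor_c2: "X \<in> kind_factors \<tau> \<Longrightarrow> \<exists>p q r t. X = c2 p q r t"
  by (cases \<tau>) (auto simp: c2_units')

lemma e12_kind_factor:
  assumes "X \<in> kind_factors \<tau>"
  shows "e12 * X = scal (- \<i> * of_int (kind_sign \<tau>)) * X"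
  using assms by (cases \<tau>) (auto simp: c2_units' c2_units(5) c2_scal c2_mult)

section \<open>The generators of the summands\<close>

definition zo :: polyop where "zo = xo 1 + sc \<i> * xo 2"
definition zb :: polyop where "zb = xo 1 - sc \<i> * xo 2"

text \<open>The generators before projection, written as operators applied to polynomials in v, so
  that their eigenvalues follow from commutation relations.\<close>

definition gop :: "nat \<Rightarrow> nat \<Rightarrow> clifford \<Rightarrow> polyop" where
  "gop a b X = zo ^ a * zb ^ b * lm X"

lemma ap_zo: "P \<in> cpolys \<Longrightarrow> ap zo P = (\<lambda>y. scal (zc y) * P y)"
proof -
  assume P: "P \<in> cpolys"
  then have "ap zo P = xmult 1 P + cscale \<i> (xmult 2 P)" by (simp add: zo_def xmult_in_cpolys)
  moreover have "scal (zc y) = scal (of_real (y 1)) + scal \<i> * scal (of_real (y 2))" for y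
    unfolding zc_def Complex_eq scal_add scal_mult ..
  ultimately show ?thesis
    by (auto simp: xmult_def cscale_def distrib_right mult.assoc pointwise)
qed

lemma ap_zb: "P \<in> cpolys \<Longrightarrow> ap zb P = (\<lambda>y. scal (cnj (zc y)) * P y)"
proof -
  assume P: "P \<in> cpolys"
  then have "ap zb P = xmult 1 P - cscale \<i> (xmult 2 P)" by (simp add: zb_def xmult_in_cpolys)
  moreover have "cnj (zc y) = of_real (y 1) - \<i> * of_real (y 2)" for y
    by (simp add: zc_def complex_eq_iff)
  then have "scal (cnj (zc y)) = scal (of_real (y 1)) - scal \<i> * scal (of_real (y 2))" for y
    by (simp add: scal_diff scal_mult)
  ultimately show ?thesis
    by (auto simp: xmult_def cscale_def left_diff_distrib mult.assoc pointwise)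
qed

lemma ap_power_mult:
  assumes "\<And>P. P \<in> cpolys \<Longrightarrow> ap A P = (\<lambda>y. scal (f y) * P y)" "P \<in> cpolys"
  shows "ap (A ^ n) P = (\<lambda>y. scal (f y ^ n) * P y)"
proof (induction n)
  case (Suc n)
  have "ap (A ^ Suc n) P = ap A (ap (A ^ n) P)" using assms(2) by simp
  also have "\<dots> = (\<lambda>y. scal (f y) * ap (A ^ n) P y)" by (rule assms(1)[OF ap_in])
  finally show ?case by (simp add: Suc scal_mult mult.assoc)
qed (use assms(2) in \<open>simp add: scal_one\<close>)

lemma ap_gop:
  assumes "Q \<in> cpolys" "X \<in> cliff UNIV"
  shows "ap (gop a b X) Q = (\<lambda>y. scal (zc y ^ a * cnj (zc y) ^ b) * X * Q y)"
proof -
  have "ap (gop a b X) Q = ap (zo ^ a) (ap (zb ^ b) (lmult X Q))"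
    using assms by (simp add: gop_def lmult_in_cpolys)
  also have "\<dots> = (\<lambda>y. scal (zc y ^ a) * ap (zb ^ b) (lmult X Q) y)"
    by (rule ap_power_mult[OF ap_zo ap_in])
  also have "ap (zb ^ b) (lmult X Q) = (\<lambda>y. scal (cnj (zc y) ^ b) * lmult X Q y)"
    using assms by (intro ap_power_mult[OF ap_zb] lmult_in_cpolys)
  finally show ?thesis by (simp add: lmult_def scal_mult mult.assoc)
qed

lemmas sc_pull = sc_commute[where A = "xo j" for j, symmetric] sc_commute[where A = "pd j" for j, symmetric]
  sc_commute2[of "xo j" for j] sc_commute2[of "pd j" for j]

lemma zo_commuteI: "A * xo 1 = xo 1 * A \<Longrightarrow> A * xo 2 = xo 2 * A \<Longrightarrow> A * zo = zo * A"
  and zb_commuteI: "A * xo 1 = xo 1 * A \<Longrightarrow> A * xo 2 = xo 2 * A \<Longrightarrow> A * zb = zb * A"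
  by (simp_all only: zo_def zb_def distrib_left distrib_right left_diff_distrib right_diff_distrib
      sc_commute2[of A] mult.assoc)

lemma zz_commute: "zb * zo = zo * zb"
  by (intro zo_commuteI zb_commuteI[symmetric] xo_commute)

lemma power_commute: "A * z = z * A \<Longrightarrow> A * z ^ n = z ^ n * A" for A :: "'a::ring_1"
  by (metis power_commuting_commutes)

lemma zpow_commuteI:
  assumes "A * xo 1 = xo 1 * A" "A * xo 2 = xo 2 * A"
  shows "A * (zo ^ a * zb ^ b) = zo ^ a * zb ^ b * A"
  using assms by (intro commute_mult power_commute zo_commuteI zb_commuteI)

lemma zo_gop: "zo * gop a b X = gop (Suc a) b X"
  by (simp add: gop_def mult.assoc)

lemma zb_gop: "zb * gop a b X = gop a (Suc b) X"
  using power_commute[OF zz_commute, of a] by (simp add: gop_def flip: mult.assoc)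

lemma lm_zpow: "Y \<in> cliff UNIV \<Longrightarrow> lm Y * (zo ^ a * zb ^ b) = zo ^ a * zb ^ b * lm Y"
  by (rule zpow_commuteI) (simp_all add: xo_lm)

lemma lm_gop: "X \<in> cliff UNIV \<Longrightarrow> Y \<in> cliff UNIV \<Longrightarrow> lm Y * gop a b X = gop a b (Y * X)"
  by (simp add: gop_def lm_mult mult_swap_assoc[OF lm_zpow] flip: mult.assoc) (simp add: mult.assoc mult_swap_assoc[OF lm_zpow, unfolded mult.assoc])

lemma gop_commuteI:
  assumes "A * xo 1 = xo 1 * A" "A * xo 2 = xo 2 * A" "A * lm X = lm Y * B"
  shows "A * gop a b X = gop a b Y * B"
  using zpow_commuteI[OF assms(1,2), of a b] assms(3) by (metis gop_def mult.assoc)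

lemma gop_add: "X \<in> cliff UNIV \<Longrightarrow> Y \<in> cliff UNIV \<Longrightarrow> gop a b (X + Y) = gop a b X + gop a b Y"
  by (simp add: gop_def lm_add distrib_left)

lemma gop_scal: "X \<in> cliff UNIV \<Longrightarrow> gop a b (scal c * X) = sc c * gop a b X"
  by (simp add: gop_def lm_mult lm_scal sc_commute2[of "zo ^ a * zb ^ b"] cliff.intros)

lemma power_eigen_commute:
  assumes "T * z = z * T + sc c * z"
  shows "T * z ^ n = z ^ n * T + sc (of_nat n * c) * z ^ n"
proof (induction n)
  case (Suc n)
  have "T * z ^ Suc n = (z * T + sc c * z) * z ^ n"
    using assms by (simp flip: mult.assoc)
  also have "\<dots> = z * (T * z ^ n) + sc c * z ^ Suc n"
    by (simp add: algebra_simps)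
  also have "\<dots> = z ^ Suc n * T + sc (of_nat n * c) * z ^ Suc n + sc c * z ^ Suc n"
    unfolding Suc by (simp add: distrib_left sc_commute2[of z] mult.assoc)
  finally show ?case by (simp add: sc_add distrib_right add.assoc algebra_simps)
qed simp

lemma zpow_eigen_commute:
  assumes "T * zo = zo * T + sc c * zo" "T * zb = zb * T + sc d * zb"
  shows "T * (zo ^ a * zb ^ b) = zo ^ a * zb ^ b * T + sc (of_nat a * c + of_nat b * d) * (zo ^ a * zb ^ b)"
proof -
  have "T * (zo ^ a * zb ^ b) = (zo ^ a * T + sc (of_nat a * c) * zo ^ a) * zb ^ b"
    by (simp add: power_eigen_commute[OF assms(1)] flip: mult.assoc)
  also have "\<dots> = zo ^ a * (T * zb ^ b) + sc (of_nat a * c) * (zo ^ a * zb ^ b)"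
    by (simp add: distrib_right mult.assoc)
  also have "\<dots> = zo ^ a * zb ^ b * T + sc (of_nat b * d) * (zo ^ a * zb ^ b) + sc (of_nat a * c) * (zo ^ a * zb ^ b)"
    by (simp add: power_eigen_commute[OF assms(2)] distrib_left sc_commute2[of "zo ^ a"] mult.assoc)
  finally show ?thesis by (simp add: sc_add distrib_right add.assoc add.commute)
qed

lemma cliff_commute:
  assumes "X \<in> cliff A" "\<And>a. a \<in> A \<Longrightarrow> T * lm (gen a) = lm (gen a) * T"
  shows "T * lm X = lm X * T"
  using assms(1)
proof (induction rule: cliff.induct)
  case (1 c)
  then show ?case by (simp add: lm_scal sc_commute)
next
  case (3 a b)
  then show ?case using cliff_UNIV by (simp add: lm_add distrib_left distrib_right)
next
  case (4 a b)
  then show ?case using cliff_UNIV by (simp add: lm_mult commute_mult)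
qed (use assms(2) in auto)

lemma c2_UNIV [simp]: "c2 p q r t \<in> cliff UNIV"
  by (rule cliff_UNIV[OF c2_in_cliff])

lemma lm_c2: "lm (c2 p q r t) = sc p + sc q * lm (gen 1) + sc r * lm (gen 2) + sc t * lm e12"
  unfolding c2_def by (simp add: lm_add lm_mult lm_scal cliff.intros e12_in_cliff)

fun kind_exps :: "kind \<Rightarrow> nat \<Rightarrow> nat \<Rightarrow> nat \<times> nat" where
  "kind_exps Ka s k = (k + s, s)"
| "kind_exps Kb s k = (s, k + s)"
| "kind_exps Kc s k = (k + s + 1, s)"
| "kind_exps Kd s k = (s, k + s + 1)"

lemma kind_monomial_exps: "kind_monomial \<tau> s k z = z ^ fst (kind_exps \<tau> s k) * cnj z ^ snd (kind_exps \<tau> s k)"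
  by (cases \<tau>) (simp_all add: mult.commute)

definition kop :: "kind \<Rightarrow> nat \<Rightarrow> nat \<Rightarrow> clifford \<Rightarrow> polyop" where
  "kop \<tau> s k X = gop (fst (kind_exps \<tau> s k)) (snd (kind_exps \<tau> s k)) X"

context split_dims
begin

lemma K_pd: "Q \<in> cpoly K \<Longrightarrow> ap (pd 1) Q = 0" "Q \<in> cpoly K \<Longrightarrow> ap (pd 2) Q = 0"
  using partial_deriv_outside[OF fin] K cpolysI[OF fin] by auto

lemma K_cpolys: "Q \<in> cpoly K \<Longrightarrow> Q \<in> cpolys" and J_cpolys: "P \<in> cpoly J \<Longrightarrow> P \<in> cpolys"
  using fin finite_J cpolysI by blast+

lemma K_J: "Q \<in> cpoly K \<Longrightarrow> Q \<in> cpoly J"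
  using cpoly_mono[OF finite_J KJ] by blast

lemma gop_in_cpoly:
  assumes "P \<in> cpoly J" "X \<in> cliff {1, 2}"
  shows "ap (gop a b X) P \<in> cpoly J"
proof -
  note s = cfun.subspace_add[OF subspace_cpoly] cfun.subspace_diff[OF subspace_cpoly] cfun.subspace_scale[OF subspace_cpoly]
  have x: "xmult j P \<in> cpoly J" if "j \<in> {1, 2}" "P \<in> cpoly J" for j P
    using that in_J finite_J by (auto intro: xmult_in_cpoly)
  have zo: "ap zo P \<in> cpoly J" and zb: "ap zb P \<in> cpoly J" if "P \<in> cpoly J" for P
    using that by (auto simp: zo_def zb_def J_cpolys xmult_in_cpolys intro!: s x)
  have "{1, 2} \<subseteq> J" using in_J by simp
  have "X \<in> cliff J"
    using assms(2)
  proof (induction rule: cliff.induct)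
    case (2 j)
    then show ?case using \<open>{1, 2} \<subseteq> J\<close> by (intro cliff.intros) blast
  qed (intro cliff.intros; assumption)+
  then have "lmult X P \<in> cpoly J" using assms(1) by (rule lmult_in_cpoly)
  then have "ap (zb ^ b) (lmult X P) \<in> cpoly J"
    by (induction b) (simp_all add: zb J_cpolys)
  then have "ap (zo ^ a) (ap (zb ^ b) (lmult X P)) \<in> cpoly J"
    by (induction a) (simp_all add: zo J_cpolys)
  then show ?thesis
    using assms cliff_UNIV by (simp add: gop_def J_cpolys lmult_in_cpolys)
qed

definition su :: polyop where "su = sc \<i> * mo"

text \<open>The orbital part of \<open>su\<close> has weight -1 on \<open>zo\<close> and 1 on
  \<open>zb\<close>, and it kills \<open>lmult X Q\<close> because \<open>Q\<close> does not involve
  the plane coordinates. The spin part contributes \<open>- e / 2\<close> through the eigenvalue of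
  \<open>e12\<close> on \<open>X\<close>.\<close>

lemma su_gop:
  assumes Q: "Q \<in> cpoly K" and X: "X \<in> cliff {1, 2}" "e12 * X = scal (- \<i> * of_int e) * X"
  shows "ap su (ap (gop a b X) Q) = cscale (of_nat b - of_nat a - of_int e / 2) (ap (gop a b X) Q)"
proof -
  let ?L = "sc \<i> * (xo 1 * pd 2 - xo 2 * pd 1)"
  have XU: "X \<in> cliff UNIV" using X cliff_UNIV by blast
  have QV: "Q \<in> cpolys" using Q K_cpolys by blast
  have p: "pd j * (xo k * A) = xo k * (pd j * A) + (if j = k then A else 0)" for j k A
    by (simp add: pd_xo distrib_right flip: mult.assoc)
  have "sc \<i> * sc \<i> = - 1"
    by (simp add: sc_uminus flip: sc_mult)
  then have ii: "sc \<i> * (sc \<i> * A) = - A" for A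
    by (simp flip: mult.assoc)
  have z: "?L * zo = zo * ?L + sc (- 1) * zo" "?L * zb = zb * ?L + sc 1 * zb"
    by (simp_all add: zo_def zb_def algebra_simps pd_xo p sc_pull xo_commute[of 2 1]
        mult_swap_assoc[OF xo_commute[of 2 1]] ii sc_uminus)
  have su: "su = ?L - sc (\<i> / 2) * lm e12"
  proof -
    have "sc \<i> * (sc (1/2) * lm e12) = sc (\<i> / 2) * lm e12"
      using sc_mult[of \<i> "1/2"] by (simp flip: mult.assoc)
    then show ?thesis by (simp add: su_def mo_def right_diff_distrib)
  qed
  have "ap ?L (lmult X Q) = 0"
  proof -
    have "ap (pd j) (lmult X Q) = 0" if "j \<in> {1, 2}" for j
      using that K_pd[OF Q] QV XU by (auto simp: partial_deriv_lmult lmult_in_cpolys)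
    then show ?thesis using QV XU by (simp add: lmult_in_cpolys del: ap_pd)
  qed
  then have "ap (?L * (zo ^ a * zb ^ b)) (lmult X Q) = cscale (of_nat b - of_nat a) (ap (zo ^ a * zb ^ b) (lmult X Q))"
    unfolding zpow_eigen_commute[OF z] using QV XU
    by (simp add: lmult_in_cpolys algebra_simps)
  then have 1: "ap ?L (ap (gop a b X) Q) = cscale (of_nat b - of_nat a) (ap (gop a b X) Q)"
    using QV XU by (simp add: gop_def lmult_in_cpolys)
  have "lm e12 * gop a b X = sc (- \<i> * of_int e) * gop a b X"
    using XU X(2) by (simp add: lm_gop e12_in_cliff gop_scal)
  then have "sc (\<i> / 2) * (lm e12 * gop a b X) = sc (of_int e / 2) * gop a b X"
    using sc_mult[of "\<i> / 2" "- \<i> * of_int e"] by (simp flip: mult.assoc)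
  then have 2: "ap (sc (\<i> / 2) * lm e12) (ap (gop a b X) Q) = cscale (of_int e / 2) (ap (gop a b X) Q)"
    using QV by (metis ap_in ap_ring(6) ap_sc mult.assoc)
  show ?thesis
    unfolding su using 1 2 by (simp only: ap_ring ap_in cfun.scale_left_diff_distrib)
qed

lemma scas_monogenic:
  assumes "finite A" "h \<in> monogenic_hom A n"
  shows "ap (scas A) h = cscale (- (2 * of_nat n + of_nat (card A) - 1)) h"
proof -
  have h: "h \<in> cpolys" "ap (dx A) h = 0" "ap (eu A) h = cscale (of_nat n) h"
    using assms cpolysI by (auto simp: monogenic_hom_eq monogenic_iff hom_poly_def)
  have "ap (dx A) (ap (vx A) h) = ap (- (vx A * dx A) - 2 * eu A - of_nat (card A)) h"
    using h(1) dx_vx[OF assms(1)] by (metis ap_ring(6))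
  also have "\<dots> = - (cscale (of_nat n) h + cscale (of_nat n) h) - cscale (of_nat (card A)) h"
    using h by (simp add: mult_2 ap_of_nat del: ap_dx ap_vx)
  finally have "ap (scas A) h = - (cscale (of_nat n) h + cscale (of_nat n) h) - cscale (of_nat (card A)) h + h"
    using h by (simp add: scas_def del: ap_dx ap_vx)
  also have "\<dots> = cscale (- (of_nat n + of_nat n) - of_nat (card A) + 1) h"
    by (simp only: cfun.scale_left_distrib cfun.scale_left_diff_distrib cfun.scale_minus_left cfun.scale_one)
  finally show ?thesis by (simp add: algebra_simps)
qed

text \<open>\<open>scas K\<close> commutes with everything built from the plane and so acts on
  \<open>Q\<close> alone, where it is a scalar; \<open>e12\<close> acts on \<open>X\<close>
  alone.\<close>

lemma sv_gop:
  assumes Q: "Q \<in> monogenic_hom K i" and X: "X \<in> cliff {1, 2}" "e12 * X = scal (- \<i> * of_int e) * X"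
  shows "ap (sv K) (ap (gop a b X) Q) = cscale (- of_int e * (of_nat i + (of_nat (card K) - 1) / 2)) (ap (gop a b X) Q)"
proof -
  have XU: "X \<in> cliff UNIV" using X cliff_UNIV by blast
  have QV: "Q \<in> cpolys" using Q K_cpolys by (auto simp: monogenic_hom_def monogenic_def)
  have "scas K * lm X = lm X * scas K"
    by (rule cliff_commute[OF X(1)]) (use K scas_outside(1) in auto)
  then have "scas K * gop a b X = gop a b X * scas K"
    by (rule gop_commuteI[OF scas_outside(2)[OF K(1)] scas_outside(2)[OF K(2)]])
  then have "sv K * gop a b X = sc (\<i> / 2) * (lm e12 * gop a b X) * scas K"
    by (simp add: sv_def mult.assoc)
  moreover have e: "lm e12 * gop a b X = sc (- \<i> * of_int e) * gop a b X"
    using XU X(2) by (simp add: lm_gop e12_in_cliff gop_scal)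
  moreover have "sc (\<i> / 2) * (lm e12 * gop a b X) * scas K = sc (of_int e / 2) * (gop a b X * scas K)"
    unfolding e using sc_mult[of "\<i> / 2" "- \<i> * of_int e"] by (simp flip: mult.assoc)
  ultimately have "ap (sv K) (ap (gop a b X) Q) = cscale (of_int e / 2) (ap (gop a b X) (ap (scas K) Q))"
    using QV by (metis ap_in ap_ring(6) ap_sc)
  then have "ap (sv K) (ap (gop a b X) Q) =
      cscale (of_int e / 2 * - (2 * of_nat i + of_nat (card K) - 1)) (ap (gop a b X) Q)"
    by (simp only: scas_monogenic[OF fin Q] ap_cscale[OF QV] cfun.scale_scale)
  moreover have "of_int e / 2 * - (2 * of_nat i + of_nat (card K) - 1) =
      (- of_int e * (of_nat i + (of_nat (card K) - 1) / 2) :: complex)"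
    by (simp add: field_simps)
  ultimately show ?thesis by (simp only:)
qed

lemma eu_gop:
  assumes Q: "Q \<in> hom_poly K i" and X: "X \<in> cliff {1, 2}"
  shows "ap (eu J) (ap (gop a b X) Q) = cscale (of_nat (a + b + i)) (ap (gop a b X) Q)"
proof -
  have XU: "X \<in> cliff UNIV" using X cliff_UNIV by blast
  have QK: "Q \<in> cpoly K" "Q \<in> cpolys" using Q K_cpolys by (auto simp: hom_poly_def)
  have "eu J * xo 1 = xo 1 * eu J + xo 1" "eu J * xo 2 = xo 2 * eu J + xo 2"
    using eu_xo[OF finite_J] in_J by auto
  then have z: "eu J * zo = zo * eu J + sc 1 * zo" "eu J * zb = zb * eu J + sc 1 * zb"
    by (simp_all add: zo_def zb_def algebra_simps sc_commute2[of "eu J"])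
  have "ap (eu J) (lmult X Q) = cscale (of_nat i) (lmult X Q)"
  proof -
    have "ap (eu J) Q = cscale (of_nat i) Q"
      using Q QK K_pd[OF QK(1)] by (simp add: eu_split hom_poly_def del: ap_pd)
    then have "ap (lm X) (ap (eu J) Q) = cscale (of_nat i) (lmult X Q)"
      using QK XU by (simp add: cpolys_cscale lmult_cscale)
    then show ?thesis using eu_lm[OF XU, of J] QK XU by (metis ap_lm ap_ring(6))
  qed
  then have "ap (eu J * (zo ^ a * zb ^ b)) (lmult X Q) = cscale (of_nat (a + b + i)) (ap (zo ^ a * zb ^ b) (lmult X Q))"
    unfolding zpow_eigen_commute[OF z] using QK XU
    by (simp add: lmult_in_cpolys ap_cscale algebra_simps cfun.scale_left_distrib)
  then show ?thesis using QK XU by (simp add: gop_def lmult_in_cpolys)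
qed

end

section \<open>The decomposition\<close>

text \<open>\<open>eig_u\<close>, \<open>eig_v\<close> and \<open>eig_x\<close> are twice the
  eigenvalues of S_u, S_v and \<open>S_x\<close>. Being integers, they reduce distinctness to linear
  integer arithmetic.\<close>

definition eig_u :: "kind \<Rightarrow> nat \<Rightarrow> int" where
  "eig_u \<tau> k = (case \<tau> of Ka \<Rightarrow> - (2 * int k + 1) | Kb \<Rightarrow> 2 * int k + 1
     | Kc \<Rightarrow> - (2 * int k + 1) | Kd \<Rightarrow> 2 * int k + 1)"

definition eig_v :: "nat \<Rightarrow> kind \<Rightarrow> nat \<Rightarrow> int" where
  "eig_v m \<tau> i = - kind_sign \<tau> * (2 * int i + int m - 3)"

definition eig_x :: "nat \<Rightarrow> kind \<Rightarrow> nat \<Rightarrow> nat \<Rightarrow> nat \<Rightarrow> int" where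
  "eig_x m \<tau> s k i = - (2 * (int k + int i + 2 * int s + (if \<tau> = Kc \<or> \<tau> = Kd then 1 else 0)) + int m - 1)"

text \<open>For \<open>m = 3\<close>, \<open>i = 0\<close> the second eigenvalue vanishes and does not separate (a) from (c) or
  (b) from (d); the parity of the degree does.\<close>

lemma eig_distinct:
  assumes "m \<ge> 3" "eig_u \<tau> k = eig_u \<tau>' k'" "eig_v m \<tau> i = eig_v m \<tau>' i'"
    "eig_x m \<tau> s k i = eig_x m \<tau>' s' k' i'"
  shows "(\<tau>, s, k, i) = (\<tau>', s', k', i')"
  using assms by (cases \<tau>; cases \<tau>'; simp add: eig_u_def eig_v_def eig_x_def; presburger)

section \<open>The projected generators in dimension m\<close>

locale spin_dims =
  fixes m :: nat
  assumes m: "m \<ge> 3"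
begin

abbreviation "K \<equiv> {3..m}"
abbreviation "J \<equiv> {1..m}"

sublocale split_dims K J
  using m by unfold_locales auto

lemma neK: "K \<noteq> {}" and neJ: "J \<noteq> {}"
  using m by auto

abbreviation "PM \<equiv> monogenic_proj J"

lemma card_J: "card J = m"
  by simp

text \<open>Different operators \<open>B\<close> and \<open>C\<close> on the other sides allow one
  rule for commuting \<open>su\<close>, anticommuting \<open>sv K\<close> and degree-shifting
  \<open>eu J\<close>.\<close>

lemma proj_commute_op:
  assumes "A * vx J = vx J * B" "dx J * A = C * dx J"
    and "\<And>P. P \<in> cpoly J \<Longrightarrow> ap A P \<in> cpoly J" "\<And>P. P \<in> cpoly J \<Longrightarrow> ap B P \<in> cpoly J"
    and "P \<in> cpoly J"
  shows "ap A (PM P) = PM (ap A P)"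
proof (rule monogenic_proj_commute[OF finite_J neJ _ _ _ assms(5)])
  show "ap A (P + Q) = ap A P + ap A Q" if "P \<in> cpoly J" "Q \<in> cpoly J" for P Q
    using that J_cpolys by (intro ap_add)
  show "ap A P \<in> monogenic J" if "P \<in> monogenic J" for P
  proof -
    have P: "P \<in> cpoly J" "ap (dx J) P = 0" "P \<in> cpolys"
      using that J_cpolys by (auto simp: monogenic_iff finite_J)
    have "ap (dx J) (ap A P) = ap C (ap (dx J) P)"
      using assms(2) P(3) by (metis ap_ring(6))
    then show ?thesis using P assms(3) by (simp add: monogenic_iff finite_J del: ap_dx)
  qed
  show "\<exists>R'\<in>cpoly J. ap A (ap (vx J) R) = ap (vx J) R'" if "R \<in> cpoly J" for R
    using that assms(1,4) J_cpolys by (intro bexI[of _ "ap B R"]) (metis ap_ring(6))+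
qed

lemma e12_in_cliff_J: "e12 \<in> cliff J"
  unfolding e12_def using in_J by (intro cliff.intros)

lemmas cpoly_closed = cfun.subspace_add[OF subspace_cpoly] cfun.subspace_diff[OF subspace_cpoly]
  cfun.subspace_scale[OF subspace_cpoly] cfun.subspace_neg[OF subspace_cpoly]

lemma sc_in_cpoly: "P \<in> cpoly J \<Longrightarrow> ap (sc c) P \<in> cpoly J"
  and lm_e12_in_cpoly: "P \<in> cpoly J \<Longrightarrow> ap (lm e12) P \<in> cpoly J"
  and xo_in_cpoly: "j \<in> J \<Longrightarrow> P \<in> cpoly J \<Longrightarrow> ap (xo j) P \<in> cpoly J"
  and pd_in_cpoly: "P \<in> cpoly J \<Longrightarrow> ap (pd j) P \<in> cpoly J"
  using J_cpolys[of P] finite_J e12_in_cliff e12_in_cliff_J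
  by (auto intro: cpoly_closed lmult_in_cpoly xmult_in_cpoly has_pd_partial_deriv(2))

lemma su_in_cpoly: "P \<in> cpoly J \<Longrightarrow> ap su P \<in> cpoly J"
  using J_cpolys[of P] in_J unfolding su_def mo_def
  by (simp only: ap_ring ap_in)
    (intro cpoly_closed sc_in_cpoly lm_e12_in_cpoly xo_in_cpoly pd_in_cpoly)

lemma sv_in_cpoly: "P \<in> cpoly J \<Longrightarrow> ap (sv K) P \<in> cpoly J"
  using J_cpolys[of P] unfolding sv_def scas_def
  by (simp only: ap_ring ap_in)
    (intro cpoly_closed sc_in_cpoly lm_e12_in_cpoly vx_in_cpoly dx_in_cpoly finite_J KJ)

lemma proj_su:
  assumes "P \<in> cpoly J"
  shows "ap su (PM P) = PM (ap su P)"
proof (rule proj_commute_op[OF _ _ su_in_cpoly su_in_cpoly assms])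
  show "su * vx J = vx J * su" "dx J * su = su * dx J"
    using mo_vx mo_dx by (simp_all add: su_def mult.assoc sc_commute2[of "vx J"] sc_commute2[of "dx J"])
qed

lemma proj_sv:
  assumes "P \<in> cpoly J"
  shows "ap (sv K) (PM P) = PM (ap (sv K) P)"
proof (rule proj_commute_op[OF _ _ sv_in_cpoly _ assms])
  show "sv K * vx J = vx J * (- sv K)" "dx J * sv K = (- sv K) * dx J"
    by (simp_all add: sv_vx sv_dx)
  show "ap (- sv K) P \<in> cpoly J" if "P \<in> cpoly J" for P
    using that sv_in_cpoly J_cpolys by (simp add: cpoly_closed)
qed

lemma proj_eu:
  assumes "P \<in> cpoly J"
  shows "ap (eu J) (PM P) = PM (ap (eu J) P)"
proof (rule proj_commute_op[OF _ _ _ _ assms])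
  show "eu J * vx J = vx J * (eu J + 1)" "dx J * eu J = (eu J + 1) * dx J"
    by (simp_all add: eu_vx eu_dx finite_J algebra_simps)
  show eu: "ap (eu J) P \<in> cpoly J" if "P \<in> cpoly J" for P
    using that finite_J by (intro eu_in_cpoly) auto
  show "ap (eu J + 1) P \<in> cpoly J" if "P \<in> cpoly J" for P
    using that eu J_cpolys by (simp add: cpoly_closed)
qed

lemma monogenic_hom_K:
  assumes "Q \<in> monogenic_hom K i"
  shows "Q \<in> cpoly K" "Q \<in> cpolys" "Q \<in> cpoly J" "Q \<in> hom_poly K i" "ap (dx K) Q = 0"
  using assms K_cpolys K_J by (auto simp: monogenic_hom_eq monogenic_iff fin)

lemma kind_factor_cliff: "X \<in> kind_factors \<tau> \<Longrightarrow> X \<in> cliff {1, 2}"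
  using kind_factor_c2 c2_in_cliff by metis

lemma kop_in_cpoly:
  assumes "X \<in> kind_factors \<tau>" "Q \<in> cpoly K"
  shows "ap (kop \<tau> s k X) Q \<in> cpoly J"
  unfolding kop_def using assms K_J kind_factor_cliff by (intro gop_in_cpoly) auto

lemma conj_cong_right: "(B \<Longrightarrow> A = A') \<Longrightarrow> (A \<and> B) = (A' \<and> B)"
  by blast

lemma summand_eq:
  "summand m \<tau> s k i = cfun.span {PM (ap (kop \<tau> s k X) Q) | X Q. X \<in> kind_factors \<tau> \<and> Q \<in> monogenic_hom K i}"
proof -
  have "ap (kop \<tau> s k X) Q = (\<lambda>y. scal (kind_monomial \<tau> s k (zc y)) * X * Q y)"
    if "X \<in> kind_factors \<tau>" "Q \<in> monogenic_hom K i" for X Q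
    using that monogenic_hom_K(2)[OF that(2)] cliff_UNIV[OF kind_factor_cliff[OF that(1)]]
    by (simp add: kop_def ap_gop kind_monomial_exps)
  then have "{monogenic_proj J (\<lambda>y. scal (kind_monomial \<tau> s k (zc y)) * X * Q y) | X Q.
        X \<in> kind_factors \<tau> \<and> Q \<in> monogenic_hom K i} =
      {PM (ap (kop \<tau> s k X) Q) | X Q. X \<in> kind_factors \<tau> \<and> Q \<in> monogenic_hom K i}"
    by (intro Collect_cong iff_exI) (rule conj_cong_right, simp)
  then show ?thesis by (simp only: summand_def)
qed

lemma summand_minimal:
  assumes "cfun.subspace W"
    and "\<And>X Q. X \<in> kind_factors \<tau> \<Longrightarrow> Q \<in> monogenic_hom K i \<Longrightarrow> PM (ap (kop \<tau> s k X) Q) \<in> W"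
  shows "summand m \<tau> s k i \<subseteq> W"
  unfolding summand_eq
proof (rule cfun.span_minimal)
  show "{PM (ap (kop \<tau> s k X) Q) | X Q. X \<in> kind_factors \<tau> \<and> Q \<in> monogenic_hom K i} \<subseteq> W"
    using assms(2) by blast
qed (rule assms(1))

lemma generator_in_summand:
  "X \<in> kind_factors \<tau> \<Longrightarrow> Q \<in> monogenic_hom K i \<Longrightarrow> PM (ap (kop \<tau> s k X) Q) \<in> summand m \<tau> s k i"
  unfolding summand_eq by (rule cfun.span_base) blast

lemma summand_monogenic: "summand m \<tau> s k i \<subseteq> monogenic J"
  using monogenic_hom_K(1)
  by (intro summand_minimal subspace_monogenic finite_J monogenic_proj_in[OF finite_J neJ] kop_in_cpoly)

lemma monogenic_J: "P \<in> monogenic J \<Longrightarrow> P \<in> cpoly J" "P \<in> monogenic J \<Longrightarrow> P \<in> cpolys"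
  using J_cpolys by (auto simp: monogenic_def)

lemma summand_eigen:
  assumes "P \<in> summand m \<tau> s k i"
  shows "ap su P = cscale (of_int (eig_u \<tau> k) / 2) P"
    and "ap (sv K) P = cscale (of_int (eig_v m \<tau> i) / 2) P"
    and "ap (scas J) P = cscale (of_int (eig_x m \<tau> s k i)) P"
proof -
  let ?E = "\<lambda>A c. {P \<in> cpolys. ap A P = cscale c P}"
  let ?W = "?E su (of_int (eig_u \<tau> k) / 2) \<inter> ?E (sv K) (of_int (eig_v m \<tau> i) / 2)
    \<inter> ?E (scas J) (of_int (eig_x m \<tau> s k i))"
  have "summand m \<tau> s k i \<subseteq> ?W"
  proof (rule summand_minimal)
    show "cfun.subspace ?W"
      by (intro cfun.subspace_inter subspace_eigen)
    fix X Q assume X: "X \<in> kind_factors \<tau>" and Q: "Q \<in> monogenic_hom K i"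
    let ?G = "ap (kop \<tau> s k X) Q"
    note Q' = monogenic_hom_K[OF Q] and X' = kind_factor_cliff[OF X] e12_kind_factor[OF X]
    have G: "?G \<in> cpoly J" using X Q' by (intro kop_in_cpoly)
    note cs = monogenic_proj_cscale[OF finite_J neJ G]
    have M: "PM ?G \<in> monogenic J" by (rule monogenic_proj_in[OF finite_J neJ G])
    have "ap su ?G = cscale (of_int (eig_u \<tau> k) / 2) ?G"
      unfolding kop_def su_gop[OF Q'(1) X']
      by (rule arg_cong2[where f = cscale, OF _ refl]) (cases \<tau>; simp add: eig_u_def field_simps)
    then have 1: "ap su (PM ?G) = cscale (of_int (eig_u \<tau> k) / 2) (PM ?G)"
      by (simp only: proj_su[OF G] cs)
    have cK: "of_nat (card K) - 1 = (of_nat m - 3 :: complex)"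
      using m by (simp add: of_nat_diff)
    have "ap (sv K) ?G = cscale (of_int (eig_v m \<tau> i) / 2) ?G"
      unfolding kop_def sv_gop[OF Q X'] cK
      by (rule arg_cong2[where f = cscale, OF _ refl]) (simp add: eig_v_def field_simps)
    then have 2: "ap (sv K) (PM ?G) = cscale (of_int (eig_v m \<tau> i) / 2) (PM ?G)"
      by (simp only: proj_sv[OF G] cs)
    \<comment> \<open>\<open>?G\<close> is in general no eigenvector of \<open>scas J\<close>. Its
      projection, however, is still homogeneous of degree \<open>n\<close>, and there
      \<open>scas J\<close> is the scalar of \<open>scas_monogenic\<close>.\<close>
    obtain n where n: "n = fst (kind_exps \<tau> s k) + snd (kind_exps \<tau> s k) + i" by blast
    have "ap (eu J) ?G = cscale (of_nat n) ?G"
      unfolding kop_def eu_gop[OF Q'(4) X'(1)] n ..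
    then have "ap (eu J) (PM ?G) = cscale (of_nat n) (PM ?G)"
      by (simp only: proj_eu[OF G] cs)
    then have "PM ?G \<in> monogenic_hom J n"
      using M monogenic_J(1)[OF M] hom_polyI_eu[OF finite_J] finite_J by (simp add: monogenic_hom_eq)
    then have 3: "ap (scas J) (PM ?G) = cscale (of_int (eig_x m \<tau> s k i)) (PM ?G)"
      unfolding scas_monogenic[OF finite_J \<open>PM ?G \<in> monogenic_hom J n\<close>] card_J
      by (intro arg_cong2[where f = cscale, OF _ refl]) (cases \<tau>; simp add: n eig_x_def algebra_simps)
    show "PM ?G \<in> ?W" using 1 2 3 monogenic_J(2)[OF M] by blast
  qed
  then show "ap su P = cscale (of_int (eig_u \<tau> k) / 2) P"
    "ap (sv K) P = cscale (of_int (eig_v m \<tau> i) / 2) P"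
    "ap (scas J) P = cscale (of_int (eig_x m \<tau> s k i)) P"
    using assms by blast+
qed

abbreviation "idx_summand \<equiv> \<lambda>(\<tau>, s, k, i). summand m \<tau> s k i"

lemma idx_summand_monogenic: "idx_summand \<iota> \<subseteq> monogenic J"
  using summand_monogenic by (cases \<iota>) auto

lemma summands_independent:
  assumes "finite I" "\<And>\<iota>. g \<iota> \<in> idx_summand \<iota>" "(\<Sum>\<iota>\<in>I. g \<iota>) = 0" "\<iota> \<in> I"
  shows "g \<iota> = 0"
proof -
  define T where "T \<kappa> = (if \<kappa> = 0 then su else if \<kappa> = 1 then sv K else scas J)" for \<kappa> :: nat
  define l :: "nat \<Rightarrow> kind \<times> nat \<times> nat \<times> nat \<Rightarrow> complex" where
    "l \<kappa> = (\<lambda>(\<tau>, s, k, i). if \<kappa> = 0 then of_int (eig_u \<tau> k) / 2 else if \<kappa> = 1 then of_int (eig_v m \<tau> i) / 2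
       else of_int (eig_x m \<tau> s k i))" for \<kappa>
  show ?thesis
  proof (rule joint_eigen_zero[where T = T and l = l, OF assms(1) _ _ _ assms(3,4)])
    show "g \<iota> \<in> cpolys" for \<iota>
      using assms(2)[of \<iota>] idx_summand_monogenic monogenic_J(2) by blast
    show "ap (T \<kappa>) (g \<iota>) = cscale (l \<kappa> \<iota>) (g \<iota>)" for \<kappa> \<iota>
      using assms(2)[of \<iota>] summand_eigen by (cases \<iota>) (auto simp: T_def l_def)
    show "\<exists>\<kappa>. l \<kappa> \<iota> \<noteq> l \<kappa> \<iota>'" if "\<iota> \<noteq> \<iota>'" for \<iota> \<iota>'
    proof (rule ccontr)
      assume "\<nexists>\<kappa>. l \<kappa> \<iota> \<noteq> l \<kappa> \<iota>'"
      then have eq: "l 0 \<iota> = l 0 \<iota>'" "l 1 \<iota> = l 1 \<iota>'" "l 2 \<iota> = l 2 \<iota>'" by blast+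
      obtain \<tau> s k i where \<iota>: "\<iota> = (\<tau>, s, k, i)" by (cases \<iota>)
      obtain \<tau>' s' k' i' where \<iota>': "\<iota>' = (\<tau>', s', k', i')" by (cases \<iota>')
      have "eig_u \<tau> k = eig_u \<tau>' k'" "eig_v m \<tau> i = eig_v m \<tau>' i'" "eig_x m \<tau> s k i = eig_x m \<tau>' s' k' i'"
        using eq by (simp_all add: l_def \<iota> \<iota>')
      then have "\<iota> = \<iota>'" unfolding \<iota> \<iota>' by (rule eig_distinct[OF m])
      with that show False by contradiction
    qed
  qed
qed

text \<open>The polynomials whose monogenic part is already known to lie in the sum of the summands.
  They contain \<open>x P\<close> for every \<open>P\<close>; modulo these, \<open>v = x - u\<close> acts as
  \<open>- u = - (z T\<^sub>- + z\<^sup>* T\<^sub>+)\<close>, with \<open>z\<^sup>*\<close> the conjugate of \<open>z\<close>, which removes the powers of \<open>v\<close>.\<close>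

definition covered :: "cfun set" where
  "covered = {P \<in> cpoly J. PM P \<in> cfun.span (\<Union>\<iota>. idx_summand \<iota>)}"

lemma subspace_covered: "cfun.subspace covered"
proof (rule cfun.subspaceI)
  have "PM 0 = 0"
    using monogenic_proj_monogenic[OF finite_J neJ, of 0] cfun.subspace_0[OF subspace_monogenic[OF finite_J]] by simp
  then show "0 \<in> covered"
    using cfun.span_zero cfun.subspace_0[OF subspace_cpoly] by (simp add: covered_def)
qed (auto simp: covered_def cpoly_closed monogenic_proj_add[OF finite_J neJ]
    monogenic_proj_cscale[OF finite_J neJ] intro: cfun.span_add cfun.span_scale cpolys_add)

lemma vx_covered: "P \<in> cpoly J \<Longrightarrow> ap (vx J) P \<in> covered"
  using monogenic_proj_vx[OF finite_J neJ] vx_in_cpoly[OF finite_J order.refl] cfun.span_zero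
  by (simp add: covered_def del: ap_vx)

lemma gop_factor_covered:
  assumes Q: "Q \<in> monogenic_hom K i" and X: "X \<in> {Iplus, Iminus, Tplus, Tminus}"
  shows "ap (gop a b X) Q \<in> covered"
proof -
  have "\<exists>\<tau> s k. X \<in> kind_factors \<tau> \<and> kind_exps \<tau> s k = (a, b)"
  proof (cases "X \<in> {Iplus, Tplus}")
    case True
    show ?thesis
    proof (cases "a \<ge> b")
      case True
      then show ?thesis using \<open>X \<in> {Iplus, Tplus}\<close>
        by (intro exI[of _ Ka] exI[of _ b] exI[of _ "a - b"]) auto
    next
      case False
      then show ?thesis using \<open>X \<in> {Iplus, Tplus}\<close>
        \<comment> \<open>Kind (d) starts at exponent difference 1, which matches
          \<open>b > a\<close>; the balanced products \<open>a = b\<close> belong to (a).\<close>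
        by (intro exI[of _ Kd] exI[of _ a] exI[of _ "b - a - 1"]) auto
    qed
  next
    case False
    then have X': "X \<in> {Iminus, Tminus}" using X by auto
    show ?thesis
    proof (cases "b \<ge> a")
      case True
      then show ?thesis using X'
        by (intro exI[of _ Kb] exI[of _ a] exI[of _ "b - a"]) auto
    next
      case False
      then show ?thesis using X'
        by (intro exI[of _ Kc] exI[of _ b] exI[of _ "a - b - 1"]) auto
    qed
  qed
  then obtain \<tau> s k where X: "X \<in> kind_factors \<tau>" and e: "kind_exps \<tau> s k = (a, b)" by blast
  have "PM (ap (kop \<tau> s k X) Q) \<in> idx_summand (\<tau>, s, k, i)"
    using generator_in_summand[OF X Q] by simp
  then have "PM (ap (kop \<tau> s k X) Q) \<in> cfun.span (\<Union>\<iota>. idx_summand \<iota>)"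
    by (intro cfun.span_base) blast
  then show ?thesis
    using kop_in_cpoly[OF X monogenic_hom_K(1)[OF Q], of s k] by (simp add: covered_def kop_def e)
qed

lemma gop_c2_covered:
  assumes Q: "Q \<in> monogenic_hom K i"
  shows "ap (gop a b (c2 p q r t)) Q \<in> covered"
proof -
  \<comment> \<open>The coefficients come from \<open>1 = Iplus + Iminus\<close>,
    \<open>gen 1 = Tplus + Tminus\<close>, and the fact that \<open>Iplus - Iminus\<close> and
    \<open>Tplus - Tminus\<close> are \<open>\<i>\<close> times \<open>e12\<close> and
    \<open>gen 2\<close>.\<close>
  have e: "c2 p q r t = scal (p - \<i> * t) * Iplus + scal (p + \<i> * t) * Iminus
      + scal (q - \<i> * r) * Tplus + scal (q + \<i> * r) * Tminus"
    by (simp add: c2_units' c2_scal c2_add algebra_simps) (simp add: field_simps)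
  have F: "X \<in> cliff UNIV" if "X \<in> {Iplus, Iminus, Tplus, Tminus}" for X
    using that by (auto simp: c2_units')
  have "ap (gop a b (c2 p q r t)) Q = cscale (p - \<i> * t) (ap (gop a b Iplus) Q)
      + cscale (p + \<i> * t) (ap (gop a b Iminus) Q) + cscale (q - \<i> * r) (ap (gop a b Tplus) Q)
      + cscale (q + \<i> * r) (ap (gop a b Tminus) Q)"
    using monogenic_hom_K(2)[OF Q] F unfolding e by (simp add: gop_add gop_scal cliff.intros)
  also have "\<dots> \<in> covered"
    by (intro cfun.subspace_add[OF subspace_covered] cfun.subspace_scale[OF subspace_covered]
        gop_factor_covered[OF Q]) auto
  finally show ?thesis .
qed

text \<open>Vectors of R^K commute with even and anticommute with odd elements of the plane algebra;
  the sign changes are its main involution.\<close>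

lemma vx_K_gop: "vx K * gop a b (c2 p q r t) = gop a b (c2 p (- q) (- r) t) * vx K"
proof (rule gop_commuteI)
  note o1 = vx_dx_outside[OF K(1)] and o2 = vx_dx_outside[OF K(2)]
  show "vx K * xo 1 = xo 1 * vx K" "vx K * xo 2 = xo 2 * vx K"
    using o1 o2 by simp_all
  show "vx K * lm (c2 p q r t) = lm (c2 p (- q) (- r) t) * vx K"
    unfolding lm_c2
    by (simp add: distrib_left distrib_right left_diff_distrib right_diff_distrib sc_commute2[of "vx K"] sc_commute[symmetric, of "vx K"]
        o1(1) o2(1) e12_commute(1) mult.assoc sc_uminus)
qed

lemma u_gop:
  "(lm (gen 1) * xo 1 + lm (gen 2) * xo 2) * gop a b X =
     gop (Suc a) b (Tminus * X) + gop a (Suc b) (Tplus * X)" if "X \<in> cliff UNIV"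
proof -
  have U: "Tminus \<in> cliff UNIV" "Tplus \<in> cliff UNIV" by (simp_all add: c2_units')
  have T: "lm Tminus = sc (1/2) * (lm (gen 1) - sc \<i> * lm (gen 2))"
    "lm Tplus = sc (1/2) * (lm (gen 1) + sc \<i> * lm (gen 2))"
    by (simp_all add: c2_units' lm_c2 distrib_left right_diff_distrib sc_uminus flip: mult.assoc sc_mult)
  have h: "sc (1/2) * (A + A) = A" for A
    by (simp add: distrib_left flip: distrib_right sc_add)
  have ii: "sc \<i> * (sc \<i> * A) = - A" for A
  proof -
    have "sc \<i> * sc \<i> = - 1" by (simp add: sc_uminus flip: sc_mult)
    then show ?thesis by (simp flip: mult.assoc)
  qed
  have "(lm (gen 1) - sc \<i> * lm (gen 2)) * zo + (lm (gen 1) + sc \<i> * lm (gen 2)) * zb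
      = (lm (gen 1) * xo 1 + lm (gen 2) * xo 2) + (lm (gen 1) * xo 1 + lm (gen 2) * xo 2)"
    by (simp add: zo_def zb_def algebra_simps sc_commute2[of "lm (gen 1)"] sc_commute2[of "lm (gen 2)"] ii)
  then have "lm Tminus * zo + lm Tplus * zb = lm (gen 1) * xo 1 + lm (gen 2) * xo 2"
    unfolding T mult.assoc[of "sc (1/2)"] by (simp only: h flip: distrib_left)
  then have "(lm (gen 1) * xo 1 + lm (gen 2) * xo 2) * gop a b X =
      lm Tminus * (zo * gop a b X) + lm Tplus * (zb * gop a b X)"
    by (metis distrib_right mult.assoc)
  then show ?thesis using that U by (simp add: zo_gop zb_gop lm_gop)
qed

text \<open>Trading one factor v for -u raises an exponent of the plane and multiplies X by T_- or
  T_+. Therefore the exponents and the coefficients of X are all arbitrary in the induction on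
  \<open>j\<close>.\<close>

lemma gop_vx_power_covered:
  assumes Q: "Q \<in> monogenic_hom K i"
  shows "ap (gop a b (c2 p q r t)) (ap (vx K ^ j) Q) \<in> covered"
proof (induction j arbitrary: a b p q r t)
  case 0
  then show ?case using gop_c2_covered[OF Q] monogenic_hom_K(2)[OF Q] by simp
next
  case (Suc j)
  let ?R = "ap (vx K ^ j) Q" and ?X = "c2 p (- q) (- r) t"
  have R: "?R \<in> cpoly K" "?R \<in> cpolys"
    using monogenic_hom_K(1)[OF Q] vx_power_in_cpoly[OF fin neK] by auto
  have "gop a b (c2 p q r t) * vx K = vx K * gop a b ?X"
    by (simp add: vx_K_gop)
  also have "\<dots> = vx J * gop a b ?X - (lm (gen 1) * xo 1 + lm (gen 2) * xo 2) * gop a b ?X"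
    by (simp add: vx_split distrib_right)
  also have "(lm (gen 1) * xo 1 + lm (gen 2) * xo 2) * gop a b ?X =
      gop (Suc a) b (Tminus * ?X) + gop a (Suc b) (Tplus * ?X)"
    by (rule u_gop) simp
  finally have e: "ap (gop a b (c2 p q r t) * vx K) ?R = ap (vx J * gop a b ?X -
      (gop (Suc a) b (Tminus * ?X) + gop a (Suc b) (Tplus * ?X))) ?R"
    by simp
  have "ap (gop a b (c2 p q r t)) (ap (vx K ^ Suc j) Q) = ap (gop a b (c2 p q r t) * vx K) ?R"
    using monogenic_hom_K(2)[OF Q] by simp
  also have "\<dots> = ap (vx J) (ap (gop a b ?X) ?R)
      - (ap (gop (Suc a) b (Tminus * ?X)) ?R + ap (gop a (Suc b) (Tplus * ?X)) ?R)"
    unfolding e using R(2) by (simp del: ap_vx)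
  also have "\<dots> \<in> covered"
  proof (intro cfun.subspace_diff[OF subspace_covered] cfun.subspace_add[OF subspace_covered])
    show "ap (vx J) (ap (gop a b ?X) ?R) \<in> covered"
      using R K_J c2_in_cliff by (intro vx_covered gop_in_cpoly) auto
  qed (simp_all only: c2_units' c2_mult Suc.IH)
  finally show ?case .
qed

lemma gop_covered:
  assumes "R \<in> cpoly K"
  shows "ap (gop a b (c2 p q r t)) R \<in> covered"
proof (rule ap_span[OF subspace_covered _ _ cpoly_fischer_hom[OF fin neK assms]])
  show "(\<Union>s n. ap (vx K ^ s) ` monogenic_hom K n) \<subseteq> cpolys" by auto
qed (auto intro: gop_vx_power_covered)

text \<open>The products of z-powers, plane elements and polynomials over \<open>K\<close> contain
  \<open>1\<close>, and their span is closed under coordinates and generators; by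
  \<open>cpoly_induct\<close> it contains all polynomials over \<open>J\<close>.\<close>

lemma cpoly_covered:
  assumes "P \<in> cpoly J"
  shows "P \<in> covered"
proof -
  let ?B = "{ap (gop a b (c2 p q r t)) R | a b p q r t R. R \<in> cpoly K}"
  have BV: "?B \<subseteq> cpolys" by auto
  have step: "ap A P \<in> cfun.span ?B"
    if "P \<in> cfun.span ?B" "\<And>a b p q r t R. R \<in> cpoly K \<Longrightarrow> ap A (ap (gop a b (c2 p q r t)) R) \<in> cfun.span ?B" for A P
    by (rule ap_span[OF cfun.subspace_span BV _ that(1)]) (use that(2) in auto)
  have base: "ap (gop a b (c2 p q r t)) R \<in> cfun.span ?B" if "R \<in> cpoly K" for a b p q r t R
    using that by (intro cfun.span_base) blast
  have spV: "P \<in> cpolys" if "P \<in> cfun.span ?B" for P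
    using that cfun.span_minimal[OF BV subspace_cpolys] by blast
  have "P \<in> cfun.span ?B"
    using finite_J assms
  proof (induction rule: cpoly_induct)
    case subspace
    show ?case by simp
  next
    case one
    have "gop 0 0 (c2 1 0 0 0) = 1" by (simp add: gop_def lm_c2)
    moreover have c: "(\<lambda>_. 1) \<in> cpoly K" by (simp add: const_in_cpoly one_in_cliff)
    ultimately have "ap (gop 0 0 (c2 1 0 0 0)) (\<lambda>_. 1) = (\<lambda>_. 1)" using K_cpolys[OF c] by simp
    then show ?case using base[OF c, of 0 0 1 0 0 0] by (simp only:)
  next
    case (xmult j P)
    have "ap (xo j) P \<in> cfun.span ?B"
    proof (rule step[OF xmult(2)])
      fix a b p q r t R assume R: "R \<in> cpoly K"
      let ?G = "gop a b (c2 p q r t)"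
      have z: "ap (zo * ?G) R \<in> cfun.span ?B" "ap (zb * ?G) R \<in> cfun.span ?B"
        unfolding zo_gop zb_gop by (rule base[OF R])+
      consider "j = 1" | "j = 2" | "j \<in> K" using xmult(1) J by blast
      then have "ap (xo j * ?G) R \<in> cfun.span ?B"
      proof cases
        case 1
        have "xo 1 = sc (1/2) * (zo + zb)"
          by (simp add: zo_def zb_def distrib_left flip: distrib_right sc_add)
        then have "xo j * ?G = sc (1/2) * (zo * ?G + zb * ?G)"
          by (simp add: 1 distrib_right mult.assoc)
        then show ?thesis using z K_cpolys[OF R] by (simp del: ap_ring(6) add: ap_ring(6)[of _ "sc c" for c] cfun.span_add cfun.span_scale cpolys_add)
      next
        case 2
        have "sc (- \<i> / 2) * (sc (2 * \<i>) * xo 2) = xo 2"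
          by (simp flip: mult.assoc sc_mult)
        moreover have "zo - zb = sc (2 * \<i>) * xo 2"
          by (simp add: zo_def zb_def flip: distrib_right sc_add)
        ultimately have "xo 2 = sc (- \<i> / 2) * (zo - zb)" by simp
        then have "xo j * ?G = sc (- \<i> / 2) * (zo * ?G - zb * ?G)"
          by (simp add: 2 left_diff_distrib mult.assoc)
        then show ?thesis using z K_cpolys[OF R] by (simp del: ap_ring(6) add: ap_ring(6)[of _ "sc c" for c] cfun.span_neg cfun.span_diff cfun.span_scale cpolys_diff)
      next
        case 3
        have "xo j * ?G = ?G * xo j"
          by (rule gop_commuteI[OF xo_commute xo_commute]) (simp add: xo_lm)
        then show ?thesis using base[OF xmult_in_cpoly[OF fin 3 R]] K_cpolys[OF R] by simp
      qed
      then show "ap (xo j) (ap ?G R) \<in> cfun.span ?B" using K_cpolys[OF R] by (simp del: ap_xo)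
    qed
    then show ?case using spV[OF xmult(2)] by simp
  next
    case (gen j P)
    have "ap (lm (gen j)) P \<in> cfun.span ?B"
    proof (rule step[OF gen(2)])
      fix a b p q r t R assume R: "R \<in> cpoly K"
      let ?G = "gop a b (c2 p q r t)"
      consider "j = 1" | "j = 2" | "j \<in> K" using gen(1) J by blast
      then have "ap (lm (gen j) * ?G) R \<in> cfun.span ?B"
      proof cases
        case 1
        then show ?thesis using base[OF R] by (simp only: lm_gop gen_in_cliff c2_UNIV) (simp only: c2_units c2_mult)
      next
        case 2
        then show ?thesis using base[OF R] by (simp only: lm_gop gen_in_cliff c2_UNIV) (simp only: c2_units c2_mult)
      next
        case 3
        \<comment> \<open>The generator passes the plane element at the cost of the main involution
          and is then absorbed into \<open>R\<close>.\<close>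
        then have j: "j \<noteq> 1" "j \<noteq> 2" using K by auto
        note s = lm_gen_swap[OF j(1)] lm_gen_swap[OF j(2)]
        have "lm (gen j) * lm e12 = lm e12 * lm (gen j)"
          unfolding lm_e12 by (simp add: s mult_swap_neg_assoc[OF s(1)] mult.assoc)
        then have "lm (gen j) * lm (c2 p q r t) = lm (c2 p (- q) (- r) t) * lm (gen j)"
          unfolding lm_c2
          by (simp add: distrib_left distrib_right left_diff_distrib right_diff_distrib sc_commute2[of "lm (gen j)"]
              sc_commute[symmetric, of "lm (gen j)"] s mult.assoc sc_uminus)
        then have "lm (gen j) * ?G = gop a b (c2 p (- q) (- r) t) * lm (gen j)"
          by (intro gop_commuteI) (simp_all add: xo_lm gen_in_cliff)
        then show ?thesis
          using base[OF lmult_in_cpoly[OF cliff.intros(2)[OF 3] R]] K_cpolys[OF R] by (simp add: gen_in_cliff)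
      qed
      then show "ap (lm (gen j)) (ap ?G R) \<in> cfun.span ?B" using K_cpolys[OF R] by simp
    qed
    then show ?case using spV[OF gen(2)] by (simp add: gen_in_cliff)
  qed
  moreover have "cfun.span ?B \<subseteq> covered"
    by (rule cfun.span_minimal[OF _ subspace_covered]) (use gop_covered in auto)
  ultimately show ?thesis by blast
qed

lemma subspace_summand: "cfun.subspace (idx_summand \<iota>)"
  by (cases \<iota>) (simp add: summand_def)

lemma direct_sum: "direct_sum_of (monogenic J) idx_summand"
  unfolding direct_sum_of_def
proof (intro conjI allI ballI)
  fix P assume P: "P \<in> monogenic J"
  then have "P \<in> covered" by (intro cpoly_covered monogenic_J)
  then have "P \<in> cfun.span (\<Union>\<iota>. idx_summand \<iota>)"
    using monogenic_proj_monogenic[OF finite_J neJ P] by (simp add: covered_def)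
  from span_UN_decomp[OF subspace_summand this]
  obtain h where h: "\<And>\<iota>. h \<iota> \<in> idx_summand \<iota>" "finite {\<iota>. h \<iota> \<noteq> 0}" "P = (\<Sum>\<iota> | h \<iota> \<noteq> 0. h \<iota>)"
    by blast
  show "\<exists>!h. (\<forall>\<iota>. h \<iota> \<in> idx_summand \<iota>) \<and> finite {\<iota>. h \<iota> \<noteq> 0} \<and> P = (\<Sum>\<iota> | h \<iota> \<noteq> 0. h \<iota>)"
  proof (rule ex1I[of _ h])
    fix g assume g: "(\<forall>\<iota>. g \<iota> \<in> idx_summand \<iota>) \<and> finite {\<iota>. g \<iota> \<noteq> 0} \<and> P = (\<Sum>\<iota> | g \<iota> \<noteq> 0. g \<iota>)"
    let ?S = "{\<iota>. h \<iota> \<noteq> 0} \<union> {\<iota>. g \<iota> \<noteq> 0}"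
    have S: "finite ?S" using h(2) g by simp
    have "sum h ?S = P" "sum g ?S = P"
      using sum_nonzero_eq[OF S, of h] sum_nonzero_eq[OF S, of g] h(3) g by auto
    then have 0: "(\<Sum>\<iota>\<in>?S. g \<iota> - h \<iota>) = 0" by (simp add: sum_subtractf)
    have gh: "g \<iota> - h \<iota> \<in> idx_summand \<iota>" for \<iota>
      by (rule cfun.subspace_diff[OF subspace_summand]) (use g h(1) in blast)+
    have "g \<iota> - h \<iota> = 0" if "\<iota> \<in> ?S" for \<iota>
      by (rule summands_independent[OF S gh 0 that])
    then have "g \<iota> = h \<iota>" for \<iota> by (cases "\<iota> \<in> ?S") auto
    then show "g = h" by blast
  qed (use h in blast)
qed (use subspace_monogenic[OF finite_J] subspace_summand idx_summand_monogenic in blast)+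

text \<open>A nonzero \<open>P\<close> common to two summands of different index gives the relation
  \<open>P + (- P) = 0\<close>, against independence. Zero summands do occur and would coincide: for
  \<open>m = 3\<close> the monogenics in one variable are constants, so there is nothing for
  \<open>i > 0\<close>.\<close>

lemma summand_inj:
  assumes "summand m \<tau> s k i \<noteq> {0}" "summand m \<tau> s k i = summand m \<tau>' s' k' i'"
  shows "(\<tau>, s, k, i) = (\<tau>', s', k', i')"
proof (rule ccontr)
  let ?\<alpha> = "(\<tau>, s, k, i)" and ?\<beta> = "(\<tau>', s', k', i')"
  assume ne: "?\<alpha> \<noteq> ?\<beta>"
  have "0 \<in> summand m \<tau> s k i" using cfun.subspace_0[OF subspace_summand, of ?\<alpha>] by simp
  then obtain P where P: "P \<in> summand m \<tau> s k i" "P \<noteq> 0" using assms(1) by blast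
  define g where "g \<iota> = (if \<iota> = ?\<alpha> then P else if \<iota> = ?\<beta> then - P else 0)" for \<iota>
  have "P \<in> idx_summand ?\<alpha>" "- P \<in> idx_summand ?\<beta>"
    using P(1) assms(2) cfun.subspace_neg[OF subspace_summand, of P ?\<beta>] by simp_all
  then have gI: "g \<iota> \<in> idx_summand \<iota>" for \<iota>
    unfolding g_def using cfun.subspace_0[OF subspace_summand] by presburger
  have sum: "(\<Sum>\<iota>\<in>{?\<alpha>, ?\<beta>}. g \<iota>) = 0"
  proof -
    have "g ?\<alpha> = P" "g ?\<beta> = - P" using ne by (simp_all add: g_def del: prod.inject)
    then show ?thesis using ne by (simp del: prod.inject)
  qed
  have "g ?\<alpha> = 0"
    by (rule summands_independent[OF _ gI sum insertI1]) (intro finite.intros)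
  then show False using P(2) by (simp add: g_def)
qed

end

section \<open>The spin action\<close>

lemma cvec_anticommute:
  assumes "finite A"
  shows "cvec A y * cvec A w + cvec A w * cvec A y = scal (of_real (- 2 * (\<Sum>j\<in>A. y j * w j)))"
proof -
  have t: "scal x * gen j * (scal x' * gen k) = scal (x * x') * (gen j * gen k)" for x x' j k
    by (metis mult.assoc scal_central scal_mult)
  have "cvec A y * cvec A w + cvec A w * cvec A y =
      (\<Sum>j\<in>A. \<Sum>k\<in>A. scal (of_real (y j * w k)) * (gen j * gen k + gen k * gen j))"
  proof -
    have "cvec A w * cvec A y = (\<Sum>j\<in>A. \<Sum>k\<in>A. scal (of_real (y j * w k)) * (gen k * gen j))"
      unfolding cvec_def sum_product t by (subst sum.swap) (simp add: mult.commute)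
    then show ?thesis
      unfolding cvec_def sum_product t by (simp add: distrib_left sum.distrib)
  qed
  also have "\<dots> = (\<Sum>j\<in>A. scal (of_real (y j * w j)) * (- 2))"
    using assms by (intro sum.cong refl) (simp add: gen_anticommute if_distrib cong: if_cong)
  also have "\<dots> = (\<Sum>j\<in>A. scal (of_real (- 2 * (y j * w j))))"
  proof -
    have "scal (of_real c) * - 2 = scal (of_real (- 2 * c))" for c
      using scal_central[of "of_real c" "- 2"] by (simp add: scal_uminus scal_mult scal_numeral)
    then show ?thesis by (simp only:)
  qed
  also have "\<dots> = scal (of_real (- 2 * (\<Sum>j\<in>A. y j * w j)))"
    by (simp only: sum_distrib_left of_real_sum scal_sum)
  finally show ?thesis .
qed

lemma gen_cvec_outside: "a \<notin> A \<Longrightarrow> cvec A w * gen a = - (gen a * cvec A w)"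
proof -
  assume a: "a \<notin> A"
  have "scal x * gen k * gen a = - (gen a * (scal x * gen k))" if "k \<in> A" for x k
  proof -
    have "gen k * gen a = - (gen a * gen k)" using a that by (intro gen_swap) auto
    then show ?thesis by (simp add: mult.assoc scal_left_commute[of "gen a"])
  qed
  then show ?thesis by (simp add: cvec_def sum_distrib_left sum_distrib_right sum_negf)
qed

lemma coef_cvec: "finite A \<Longrightarrow> coef (cvec A y) {j} = (if j \<in> A then of_real (y j) else 0)"
  by (simp add: cvec_def coef_sum coef_gen if_distrib cong: if_cong)

lemma coords_cvec: "finite A \<Longrightarrow> coords (cvec A y) = (\<lambda>j. if j \<in> A then y j else 0)"
  by (auto simp: coords_def coef_cvec)

lemma cvec_add: "cvec A (\<lambda>j. y j + w j) = cvec A y + cvec A w"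
  by (simp add: cvec_def scal_add distrib_right sum.distrib)

lemma cvec_scale: "cvec A (\<lambda>j. c * y j) = scal (of_real c) * cvec A y"
  by (simp add: cvec_def scal_mult sum_distrib_left mult.assoc)

lemma cvec_cong: "(\<And>j. j \<in> A \<Longrightarrow> y j = w j) \<Longrightarrow> cvec A y = cvec A w"
  by (simp add: cvec_def)

section \<open>The action of a single unit vector\<close>

locale unit_vector =
  fixes A :: "nat set" and w :: "nat \<Rightarrow> real"
  assumes finA: "finite A" and neA: "A \<noteq> {}" and norm1: "(\<Sum>j\<in>A. (w j)\<^sup>2) = 1"
begin

text \<open>In coordinates over \<open>A\<close>, the conjugation of the vector y to
  \<open>w^(-1) y w\<close>, where \<open>w^(-1) = - w\<close>. It fixes w and negates the
  orthogonal complement.\<close>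

definition rho :: "(nat \<Rightarrow> real) \<Rightarrow> nat \<Rightarrow> real" where
  "rho y j = (if j \<in> A then 2 * (\<Sum>k\<in>A. y k * w k) * w j - y j else 0)"

text \<open>The formula for \<open>L\<close> at one unit vector, an odd element outside the spin
  group. By \<open>Lact_mult\<close>, the action of a product of vectors is a composition of such
  maps.\<close>

definition refl :: "cfun \<Rightarrow> cfun" where
  "refl P = (\<lambda>y. cvec A w * P (rho y))"

lemma cw_square: "cvec A w * cvec A w = - 1"
proof -
  have n: "(\<Sum>j\<in>A. w j * w j) = 1"
    using norm1 by (simp add: power2_eq_square)
  have "cvec A w * cvec A w + cvec A w * cvec A w = scal (- 2)"
    using cvec_anticommute[OF finA, of w w] unfolding n by simp
  then have "coef (cvec A w * cvec A w + cvec A w * cvec A w) C = coef (scal (- 2)) C" for C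
    by simp
  then have "coef (cvec A w * cvec A w) C = coef (- 1) C" for C
    by (auto simp: coef_scal coef_one split: if_splits dest!: meta_spec[of _ C])
  then show ?thesis by (rule clifford_eqI)
qed

lemma cvec_rho: "cvec A (rho y) = scal (of_real (2 * (\<Sum>k\<in>A. y k * w k))) * cvec A w - cvec A y"
proof -
  have "cvec A (rho y) = cvec A (\<lambda>j. 2 * (\<Sum>k\<in>A. y k * w k) * w j + (- 1) * y j)"
    by (rule cvec_cong) (simp add: rho_def)
  also have "\<dots> = scal (of_real (2 * (\<Sum>k\<in>A. y k * w k))) * cvec A w + scal (of_real (- 1)) * cvec A y"
    by (rule trans[OF cvec_add arg_cong2[where f = plus, OF cvec_scale cvec_scale]])
  finally show ?thesis by (simp add: scal_uminus scal_one)
qed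

lemma cvec_swap: "cvec A y * cvec A w = scal (of_real (- 2 * (\<Sum>k\<in>A. y k * w k))) - cvec A w * cvec A y"
  using cvec_anticommute[OF finA, of y w] by (simp add: algebra_simps)

lemma cvec_conj: "- cvec A w * cvec A y * cvec A w = cvec A (rho y)"
proof -
  have "- cvec A w * cvec A y * cvec A w = - (cvec A w * (cvec A y * cvec A w))"
    by (simp add: mult.assoc)
  also have "\<dots> = scal (of_real (2 * (\<Sum>k\<in>A. y k * w k))) * cvec A w + cvec A w * cvec A w * cvec A y"
    by (subst cvec_swap[of y]) (simp add: right_diff_distrib scal_uminus mult.assoc scal_central)
  finally show ?thesis by (simp add: cw_square cvec_rho)
qed

text \<open>This is \<open>w (w^(-1) y w) = y w\<close>, the reason why \<open>refl\<close> commutes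
  with multiplication by the vector variable.\<close>

lemma cvec_rho_left: "cvec A w * cvec A (rho y) = cvec A y * cvec A w"
proof -
  have "cvec A w * cvec A (rho y) = - (cvec A w * cvec A w) * (cvec A y * cvec A w)"
    by (simp add: mult.assoc flip: cvec_conj)
  then show ?thesis by (simp add: cw_square)
qed

lemma cw_cliff: "cvec A w \<in> cliff A"
  unfolding cvec_def using finA
proof -
  have "(\<Sum>j\<in>B. scal (of_real (w j)) * gen j) \<in> cliff A" if "B \<subseteq> A" for B
    using finite_subset[OF that finA] that
  proof (induction rule: finite_induct)
    case empty
    then show ?case using cliff.intros(1)[of 0 A] by simp
  next
    case (insert j B)
    then show ?case by (simp add: cliff.intros)
  qed
  then show "(\<Sum>j\<in>A. scal (of_real (w j)) * gen j) \<in> cliff A" by blast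
qed

text \<open>The chain rule for the composition of \<open>P\<close> with \<open>rho\<close>, whose
  Jacobian has the entries \<open>2 * w j * w k\<close> minus those of the identity.\<close>

definition chain :: "nat \<Rightarrow> cfun \<Rightarrow> cfun" where
  "chain j P = (\<lambda>y. scal (of_real (2 * w j)) * (\<Sum>k\<in>A. scal (of_real (w k)) * partial_deriv k P (rho y))
     - partial_deriv j P (rho y))"

lemma rho_deriv:
  assumes "j \<in> A" "l \<in> A"
  shows "((\<lambda>t. rho (y(j := t)) l) has_real_derivative (2 * w j * w l - (if j = l then 1 else 0))) (at (y j))"
proof -
  have "(\<Sum>k\<in>A. (y(j := t)) k * w k) = t * w j + (\<Sum>k\<in>A - {j}. y k * w k)" for t
    using assms finA by (simp add: sum.remove[of A j])
  then have "rho (y(j := t)) l = 2 * (t * w j + (\<Sum>k\<in>A - {j}. y k * w k)) * w l - (if j = l then t else y l)" for t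
    using assms by (simp add: rho_def)
  then show ?thesis by (auto intro!: derivative_eq_intros)
qed

text \<open>The chain rule is obtained by induction over the polynomial, each coordinate
  contributing by the product rule and \<open>rho_deriv\<close>. Membership in
  \<open>cpoly A\<close> is carried along because the derivatives of \<open>P\<close> must
  exist.\<close>

lemma rho_cpoly:
  assumes "P \<in> cpoly A"
  shows "(\<lambda>y. P (rho y)) \<in> cpoly A" "j \<in> A \<Longrightarrow> has_pd j (\<lambda>y. P (rho y)) (chain j P)"
proof -
  let ?S = "{P \<in> cpoly A. (\<lambda>y. P (rho y)) \<in> cpoly A \<and> (\<forall>j\<in>A. has_pd j (\<lambda>y. P (rho y)) (chain j P))}"
  have V: "P \<in> cpolys" if "P \<in> cpoly A" for P using that finA cpolysI by blast
  note s = cfun.subspace_0[OF subspace_cpoly] cfun.subspace_add[OF subspace_cpoly]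
    cfun.subspace_diff[OF subspace_cpoly] cfun.subspace_scale[OF subspace_cpoly] cfun.subspace_sum[OF subspace_cpoly]
  have "P \<in> ?S"
    using finA assms
  proof (induction rule: cpoly_induct)
    case subspace
    show ?case
    proof (rule cfun.subspaceI)
      have "(\<lambda>y. (0::cfun) (rho y)) = 0" "chain j 0 = 0" for j
        by (auto simp: chain_def partial_deriv_zero pointwise)
      moreover have "has_pd j 0 0" for j using has_pd_const[of j 0] by (simp add: zero_fun_def)
      ultimately show "0 \<in> ?S" by (simp add: s)
    next
      fix P Q assume P: "P \<in> ?S" and Q: "Q \<in> ?S"
      have "(\<lambda>y. (P + Q) (rho y)) = (\<lambda>y. P (rho y)) + (\<lambda>y. Q (rho y))"
        by (auto simp: pointwise)
      moreover have "chain j (P + Q) = chain j P + chain j Q" for j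
        using P Q V by (auto simp: chain_def partial_deriv_add pointwise distrib_left sum.distrib algebra_simps)
      ultimately show "P + Q \<in> ?S" using P Q by (auto simp: s intro: has_pd_add)
    next
      fix c P assume P: "P \<in> ?S"
      have "(\<lambda>y. cscale c P (rho y)) = cscale c (\<lambda>y. P (rho y))"
        by (auto simp: cscale_def)
      moreover have "chain j (cscale c P) = cscale c (chain j P)" for j
      proof
        fix y
        have e: "scal x * (\<Sum>k\<in>A. scal (f k) * (scal c * g k)) = scal c * (scal x * (\<Sum>k\<in>A. scal (f k) * g k))" for x f g
          by (simp add: sum_distrib_left scal_scal_commute[of _ c])
        show "chain j (cscale c P) y = cscale c (chain j P) y"
          using P V by (simp add: chain_def partial_deriv_cscale) (simp add: cscale_def right_diff_distrib e)
      qed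
      ultimately show "cscale c P \<in> ?S" using P by (auto simp: s intro: has_pd_cscale)
    qed
  next
    case one
    have "chain j (\<lambda>_. 1) = 0" for j by (auto simp: chain_def partial_deriv_const pointwise)
    then show ?case by (simp add: has_pd_const const_in_cpoly one_in_cliff)
  next
    case (xmult l P)
    then have P: "P \<in> cpoly A" "P \<in> cpolys" "(\<lambda>y. P (rho y)) \<in> cpoly A" using V by auto
    let ?F = "\<lambda>y. P (rho y)"
    have e: "(\<lambda>y. xmult l P (rho y)) = (\<lambda>y. scal (of_real (rho y l)) * P (rho y))"
      by (simp add: xmult_def)
    have "(\<lambda>y. xmult l P (rho y)) = cscale (of_real (2 * w l)) (\<Sum>k\<in>A. cscale (of_real (w k)) (xmult k ?F)) - xmult l ?F"
    proof
      fix y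
      have "scal (of_real (rho y l)) = scal (of_real (2 * w l)) * (\<Sum>k\<in>A. scal (of_real (w k)) * scal (of_real (y k)))
          - scal (of_real (y l))"
        using xmult(1) unfolding rho_def
        by (simp add: mult.commute flip: scal_mult scal_sum scal_diff) (simp add: mult.assoc mult.left_commute)
      then show "xmult l P (rho y) = (cscale (of_real (2 * w l)) (\<Sum>k\<in>A. cscale (of_real (w k)) (xmult k ?F)) - xmult l ?F) y"
        by (simp add: xmult_def cscale_def sum_cfun_apply pointwise left_diff_distrib sum_distrib_right mult.assoc)
    qed
    then have m: "(\<lambda>y. xmult l P (rho y)) \<in> cpoly A"
      using P finA xmult(1) by (auto intro!: s xmult_in_cpoly)
    have "has_pd j (\<lambda>y. xmult l P (rho y)) (chain j (xmult l P))" if j: "j \<in> A" for j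
    proof -
      have "has_pd j (\<lambda>y. scal (of_real (rho y l)) * P (rho y))
          (\<lambda>y. scal (of_real (2 * w j * w l - (if j = l then 1 else 0))) * P (rho y) + scal (of_real (rho y l)) * chain j P y)"
        by (rule has_pd_real_mult) (use xmult j rho_deriv in auto)
      moreover have "scal (of_real (2 * w j * w l - (if j = l then 1 else 0))) * P (rho y) + scal (of_real (rho y l)) * chain j P y
          = chain j (xmult l P) y" for y
      proof -
        let ?r = "scal (of_real (rho y l))" and ?p = "P (rho y)" and ?d = "\<lambda>k. partial_deriv k P (rho y)"
        have "partial_deriv k (xmult l P) (rho y) = (if k = l then ?p else 0) + ?r * ?d k" for k
          using P(2) by (simp add: partial_deriv_xmult) (simp add: pointwise xmult_def)
        then have "(\<Sum>k\<in>A. scal (of_real (w k)) * partial_deriv k (xmult l P) (rho y)) =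
            (\<Sum>k\<in>A. (if k = l then scal (of_real (w k)) * ?p else 0) + ?r * (scal (of_real (w k)) * ?d k))"
          by (intro sum.cong refl) (auto simp: distrib_left scal_scal_commute[of "of_real (rho y l)"])
        then have "(\<Sum>k\<in>A. scal (of_real (w k)) * partial_deriv k (xmult l P) (rho y)) =
            scal (of_real (w l)) * ?p + ?r * (\<Sum>k\<in>A. scal (of_real (w k)) * ?d k)"
          using finA xmult(1)
          by (simp add: sum.distrib sum_distrib_left)
        then have "chain j (xmult l P) y = scal (of_real (2 * w j)) * (scal (of_real (w l)) * ?p)
            + ?r * (scal (of_real (2 * w j)) * (\<Sum>k\<in>A. scal (of_real (w k)) * ?d k)) - (if j = l then ?p else 0) - ?r * ?d j"
          using \<open>\<And>k. partial_deriv k (xmult l P) (rho y) = (if k = l then ?p else 0) + ?r * ?d k\<close>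
          by (simp add: chain_def distrib_left scal_scal_commute[of "of_real (rho y l)"])
        moreover have "scal (of_real (2 * w j)) * (scal (of_real (w l)) * ?p) - (if j = l then ?p else 0) =
            scal (of_real (2 * w j * w l - (if j = l then 1 else 0))) * ?p"
          by (simp add: scal_diff left_diff_distrib scal_mult scal_one mult.assoc)
        ultimately show ?thesis by (simp add: chain_def right_diff_distrib algebra_simps)
      qed
      ultimately show ?thesis by (simp add: e)
    qed
    then show ?case using m xmult finA by (auto intro: xmult_in_cpoly)
  next
    case (gen l P)
    have e: "(\<lambda>y. lmult (gen l) P (rho y)) = lmult (gen l) (\<lambda>y. P (rho y))" by (auto simp: lmult_def)
    have "chain j (lmult (gen l) P) = lmult (gen l) (chain j P)" for j
      using gen V by (simp add: chain_def partial_deriv_lmult)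
        (simp add: lmult_def right_diff_distrib sum_distrib_left scal_left_commute[of "gen l"])
    then show ?case using gen by (auto simp: e lmult_in_cpoly cliff.intros intro: has_pd_lmult)
  qed
  then show "(\<lambda>y. P (rho y)) \<in> cpoly A" "j \<in> A \<Longrightarrow> has_pd j (\<lambda>y. P (rho y)) (chain j P)" by auto
qed

lemma refl_lmult: "refl P = lmult (cvec A w) (\<lambda>y. P (rho y))"
  by (simp add: refl_def lmult_def)

lemma refl_cpoly: "P \<in> cpoly A \<Longrightarrow> refl P \<in> cpoly A"
  unfolding refl_lmult by (intro lmult_in_cpoly cw_cliff rho_cpoly)

lemma refl_add: "refl (P + Q) = refl P + refl Q"
  by (auto simp: refl_def pointwise distrib_left)

lemma refl_cscale: "refl (cscale c P) = cscale c (refl P)"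
  by (auto simp: refl_def cscale_def scal_left_commute)

lemma refl_zero: "refl 0 = 0"
  by (auto simp: refl_def pointwise)

lemma refl_vmult: "refl (vmult A P) = vmult A (refl P)"
  by (auto simp: refl_def vmult_def cvec_rho_left simp flip: mult.assoc)

text \<open>Moving each generator past w leaves the wanted sum and two multiples of the derivative
  of \<open>P\<close> in direction w. These cancel because the square of w is -1.\<close>

lemma refl_dirac:
  assumes "P \<in> cpoly A"
  shows "dirac A (refl P) = refl (dirac A P)"
proof
  fix y
  let ?c = "cvec A w" and ?d = "\<lambda>k. partial_deriv k P (rho y)"
  let ?S = "\<Sum>k\<in>A. scal (of_real (w k)) * ?d k"
  have sw: "gen j * ?c = - (?c * gen j) - scal (of_real (2 * w j))" if "j \<in> A" for j
  proof -
    have "cvec A (\<lambda>k. if k = j then 1 else 0) = gen j"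
    proof -
      have "cvec A (\<lambda>k. if k = j then 1 else 0) = (\<Sum>k\<in>A. if k = j then gen k else 0)"
        unfolding cvec_def by (intro sum.cong refl) (simp add: scal_one)
      then show ?thesis using that finA by simp
    qed
    moreover have "(\<Sum>k\<in>A. (if k = j then 1 else 0) * w k) = w j"
      using that finA by (simp add: if_distrib[of "\<lambda>x. x * _"] cong: if_cong)
    ultimately have "gen j * ?c + ?c * gen j = - scal (of_real (2 * w j))"
      using cvec_anticommute[OF finA, of "\<lambda>k. if k = j then 1 else 0" w] by (simp add: scal_uminus)
    then have "gen j * ?c + ?c * gen j - ?c * gen j = - scal (of_real (2 * w j)) - ?c * gen j" by (simp only:)
    then show ?thesis by simp
  qed
  have pd: "partial_deriv j (refl P) = lmult ?c (chain j P)" if "j \<in> A" for j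
    unfolding refl_lmult by (intro partial_deriv_eqI has_pd_lmult rho_cpoly assms that)
  have "dirac A (refl P) y = (\<Sum>j\<in>A. gen j * (?c * chain j P y))"
    by (simp add: dirac_def sum_cfun_apply lmult_def pd)
  also have "\<dots> = (\<Sum>j\<in>A. scal (of_real (w j)) * gen j * (?c * (scal 2 * ?S)) + ?c * (gen j * ?d j) + scal 2 * (scal (of_real (w j)) * ?d j))"
  proof (intro sum.cong refl)
    fix j assume j: "j \<in> A"
    have "gen j * (?c * (scal (of_real (2 * w j)) * ?S)) = scal (of_real (w j)) * gen j * (?c * (scal 2 * ?S))"
      by (simp add: scal_mult mult.assoc scal_left_commute[of "gen j"] scal_left_commute[of ?c] scal_scal_commute[of 2])
    moreover have "gen j * (?c * ?d j) = - (?c * (gen j * ?d j)) - scal 2 * (scal (of_real (w j)) * ?d j)"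
    proof -
      have "gen j * (?c * ?d j) = gen j * ?c * ?d j" by (simp add: mult.assoc)
      then show ?thesis by (simp add: sw[OF j] left_diff_distrib mult.assoc scal_mult)
    qed
    ultimately show "gen j * (?c * chain j P y) = scal (of_real (w j)) * gen j * (?c * (scal 2 * ?S)) + ?c * (gen j * ?d j) + scal 2 * (scal (of_real (w j)) * ?d j)"
      by (simp add: chain_def right_diff_distrib)
  qed
  also have "\<dots> = ?c * (?c * (scal 2 * ?S)) + ?c * (\<Sum>j\<in>A. gen j * ?d j) + scal 2 * ?S"
  proof -
    have "(\<Sum>j\<in>A. scal (of_real (w j)) * gen j * Z) = ?c * Z" for Z
      by (simp only: cvec_def sum_distrib_right)
    then show ?thesis by (simp only: sum.distrib flip: sum_distrib_left)
  qed
  also have "?c * (?c * (scal 2 * ?S)) = - (scal 2 * ?S)"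
    by (simp add: cw_square flip: mult.assoc)
  finally show "dirac A (refl P) y = refl (dirac A P) y"
    by (simp add: refl_def dirac_def sum_cfun_apply lmult_def)
qed

lemma refl_monogenic: "P \<in> monogenic A \<Longrightarrow> refl P \<in> monogenic A"
  by (auto simp: monogenic_def refl_cpoly refl_dirac refl_zero)

lemma refl_monogenic_hom:
  assumes "P \<in> monogenic_hom A i"
  shows "refl P \<in> monogenic_hom A i"
proof -
  have "rho (\<lambda>j. t * y j) = (\<lambda>j. t * rho y j)" for t y
    by (auto simp: rho_def sum_distrib_left mult.assoc algebra_simps)
  then show ?thesis
    using assms refl_monogenic by (auto simp: monogenic_hom_def refl_def scal_left_commute[of "cvec A w"] simp del: of_real_power)
qed

lemma refl_proj:
  assumes "P \<in> cpoly A"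
  shows "refl (monogenic_proj A P) = monogenic_proj A (refl P)"
proof (rule monogenic_proj_commute[OF finA neA refl_add refl_monogenic _ assms])
  show "\<exists>R'\<in>cpoly A. refl (ap (vx A) R) = ap (vx A) R'" if "R \<in> cpoly A" for R
    using that cpolysI[OF finA] refl_cpoly by (intro bexI[of _ "refl R"]) (auto simp: refl_vmult)
qed

text \<open>\<open>cinv\<close> is a definite description, so the inverse \<open>t\<close> of
  \<open>s\<close> is supplied explicitly; the inverse of \<open>w s\<close> is then
  \<open>t * - w\<close>, and the inner conjugation by w becomes \<open>rho\<close>.\<close>

lemma Lact_mult:
  assumes "s * t = 1" "t * s = 1"
  shows "Lact A (cvec A w * s) P = refl (Lact A s P)"
proof -
  have inv: "cinv a = b" if "a * b = 1" "b * a = 1" for a b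
    unfolding cinv_def
  proof (rule the_equality)
    fix c assume "a * c = 1 \<and> c * a = 1"
    then show "c = b" using that by (metis mult.assoc mult_1_left mult_1_right)
  qed (use that in auto)
  have "cvec A w * s * (t * - cvec A w) = 1"
  proof -
    have "cvec A w * s * (t * - cvec A w) = - (cvec A w * (s * t) * cvec A w)" by (simp only: mult.assoc mult_minus_right)
    then show ?thesis by (simp add: assms cw_square)
  qed
  moreover have "t * - cvec A w * (cvec A w * s) = 1"
  proof -
    have "t * - cvec A w * (cvec A w * s) = - (t * (cvec A w * cvec A w) * s)" by (simp only: mult.assoc mult_minus_right mult_minus_left)
    then show ?thesis by (simp add: assms cw_square)
  qed
  ultimately have "cinv (cvec A w * s) = t * - cvec A w" by (rule inv)
  then have "cinv (cvec A w * s) * cvec A y * (cvec A w * s) = cinv s * cvec A (rho y) * s" for y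
    by (simp add: inv[OF assms] mult.assoc flip: cvec_conj)
  then show ?thesis by (simp add: Lact_def refl_def mult.assoc)
qed

end

lemma Lact_one:
  assumes "finite A" "P \<in> cpoly A"
  shows "Lact A 1 P = P"
proof -
  have "cinv 1 = 1" by (auto simp: cinv_def)
  moreover have "P (coords (cvec A y)) = P y" for y
    by (rule cpoly_local[OF assms]) (simp add: coords_cvec[OF assms(1)])
  ultimately show ?thesis by (simp add: Lact_def)
qed

section \<open>Products of unit vectors acting on the summands\<close>

fun flip_kind :: "kind \<Rightarrow> kind" where
  "flip_kind Ka = Kb" | "flip_kind Kb = Ka" | "flip_kind Kc = Kd" | "flip_kind Kd = Kc"

lemma flip_kind_even: "even n \<Longrightarrow> (flip_kind ^^ n) \<tau> = \<tau>"
proof (induction n rule: induct_nat_012)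
  case (ge2 n)
  moreover have "flip_kind (flip_kind \<tau>) = \<tau>" for \<tau> by (cases \<tau>) auto
  ultimately show ?case by simp
qed auto

lemma cvec_inverse:
  assumes "finite A" "c \<in> unit_vecs A"
  shows "c * - c = 1" "- c * c = 1"
proof -
  obtain y where y: "c = cvec A y" "(\<Sum>j\<in>A. (y j)\<^sup>2) = 1"
    using assms(2) by (auto simp: unit_vecs_def)
  then have "A \<noteq> {}" by auto
  then interpret unit_vector A y using assms(1) y by unfold_locales
  show "c * - c = 1" "- c * c = 1" using cw_square by (simp_all add: y)
qed

lemma unit_vecs_prod_inverse:
  assumes "finite A" "set ws \<subseteq> unit_vecs A"
  shows "\<exists>t. prod_list ws * t = 1 \<and> t * prod_list ws = 1"
  using assms(2)
proof (induction ws)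
  case (Cons c ws)
  then obtain t where t: "prod_list ws * t = 1" "t * prod_list ws = 1" by auto
  have c: "c * - c = 1" "- c * c = 1" using cvec_inverse[OF assms(1)] Cons by auto
  have "c * prod_list ws * (t * - c) = c * (prod_list ws * t) * - c"
    "t * - c * (c * prod_list ws) = t * (- c * c) * prod_list ws"
    by (simp_all only: mult.assoc)
  then have "c * prod_list ws * (t * - c) = 1 \<and> t * - c * (c * prod_list ws) = 1"
    by (simp only: t c mult_1_right)
  then show ?case unfolding prod_list.Cons by blast
qed (auto intro: exI[of _ 1])

lemma c2_cong: "p = p' \<Longrightarrow> q = q' \<Longrightarrow> r = r' \<Longrightarrow> t = t' \<Longrightarrow> c2 p q r t = c2 p' q' r' t'"
  by simp

context spin_dims
begin

text \<open>Extending the coordinates by zero makes a unit vector of the plane or of R^K one of R^J,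
  so that \<open>refl\<close> acts on polynomials over \<open>J\<close>.\<close>

lemma unit_vecs_restrict:
  assumes "B \<subseteq> J" "c \<in> unit_vecs B"
  obtains w where "unit_vector J w" "\<And>j. j \<notin> B \<Longrightarrow> w j = 0" "c = cvec J w"
    "cvec J w = cvec B w" "(\<Sum>j\<in>B. (w j)\<^sup>2) = 1"
proof -
  obtain y where y: "c = cvec B y" "(\<Sum>j\<in>B. (y j)\<^sup>2) = 1"
    using assms(2) by (auto simp: unit_vecs_def)
  let ?w = "\<lambda>j. if j \<in> B then y j else 0"
  have 1: "(\<Sum>j\<in>J. (?w j)\<^sup>2) = (\<Sum>j\<in>B. (y j)\<^sup>2)"
    using assms(1) finite_J by (intro sum.mono_neutral_cong_right) auto
  have 2: "cvec J ?w = cvec B y"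
    unfolding cvec_def using assms(1) finite_J by (intro sum.mono_neutral_cong_right) auto
  show ?thesis
  proof (rule that[of ?w])
    show "unit_vector J ?w" using 1 y finite_J neJ by unfold_locales auto
    show "cvec J ?w = cvec B ?w" unfolding 2 by (rule cvec_cong) simp
  qed (use 1 2 y in auto)
qed

text \<open>Since \<open>refl\<close> commutes with the projection, it suffices to follow the
  generators before projection.\<close>

lemma refl_summand:
  assumes "unit_vector J w"
    and "\<And>X Q. X \<in> kind_factors \<tau> \<Longrightarrow> Q \<in> monogenic_hom K i \<Longrightarrow>
      \<exists>c X' Q'. X' \<in> kind_factors \<tau>' \<and> Q' \<in> monogenic_hom K i \<and>
        unit_vector.refl J w (ap (kop \<tau> s k X) Q) = cscale c (ap (kop \<tau>' s k X') Q')"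
    and "P \<in> summand m \<tau> s k i"
  shows "unit_vector.refl J w P \<in> summand m \<tau>' s k i"
proof -
  interpret unit_vector J w by (rule assms(1))
  have sub: "cfun.subspace (summand m \<tau>' s k i)"
    using subspace_summand[of "(\<tau>', s, k, i)"] by simp
  have "summand m \<tau> s k i \<subseteq> {P. refl P \<in> summand m \<tau>' s k i}"
  proof (rule summand_minimal)
    show "cfun.subspace {P. refl P \<in> summand m \<tau>' s k i}"
      using sub by (auto simp: cfun.subspace_def refl_add refl_cscale refl_zero)
    fix X Q assume X: "X \<in> kind_factors \<tau>" and Q: "Q \<in> monogenic_hom K i"
    obtain c X' Q' where c: "X' \<in> kind_factors \<tau>'" "Q' \<in> monogenic_hom K i"
      "refl (ap (kop \<tau> s k X) Q) = cscale c (ap (kop \<tau>' s k X') Q')"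
      using assms(2)[OF X Q] by blast
    have "refl (PM (ap (kop \<tau> s k X) Q)) = cscale c (PM (ap (kop \<tau>' s k X') Q'))"
      using X Q c monogenic_hom_K(1)
      by (simp add: refl_proj kop_in_cpoly monogenic_proj_cscale[OF finite_J neJ])
    then show "PM (ap (kop \<tau> s k X) Q) \<in> {P. refl P \<in> summand m \<tau>' s k i}"
      using generator_in_summand[OF c(1,2)] sub by (simp add: cfun.subspace_scale)
  qed
  then show ?thesis using assms(3) by blast
qed

lemma ap_kop:
  assumes "X \<in> kind_factors \<tau>" "Q \<in> monogenic_hom K i"
  shows "ap (kop \<tau> s k X) Q = (\<lambda>y. scal (kind_monomial \<tau> s k (zc y)) * X * Q y)"
  using monogenic_hom_K(2)[OF assms(2)] cliff_UNIV[OF kind_factor_cliff[OF assms(1)]]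
  by (simp add: kop_def ap_gop kind_monomial_exps)

text \<open>A reflection in \<open>\<real>\<^bsup>m - 2\<^esup>\<close> sends \<open>z\<close> to \<open>- z\<close> and commutes or anticommutes with \<open>X\<close>.\<close>

lemma refl_summand_K:
  assumes w: "unit_vector J w" "\<And>j. j \<notin> K \<Longrightarrow> w j = 0" "cvec J w = cvec K w" "(\<Sum>j\<in>K. (w j)\<^sup>2) = 1"
    and P: "P \<in> summand m \<tau> s k i"
  shows "unit_vector.refl J w P \<in> summand m \<tau> s k i"
proof (rule refl_summand[OF w(1) _ P])
  interpret unit_vector J w by (rule w(1))
  interpret wK: unit_vector K w using w(4) fin neK by unfold_locales
  fix X Q assume X: "X \<in> kind_factors \<tau>" and Q: "Q \<in> monogenic_hom K i"
  have "(\<Sum>k\<in>J. y k * w k) = (\<Sum>k\<in>K. y k * w k)" for y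
    using finite_J KJ w(2) by (intro sum.mono_neutral_right) auto
  \<comment> \<open>As \<open>w\<close> vanishes on the plane, the map is -1 there, while on R^K it
    is the corresponding map of that space. So \<open>Q\<close> is replaced by
    \<open>wK.refl Q\<close>, again monogenic of degree \<open>i\<close>.\<close>
  then have rho: "rho y j = (if j \<in> K then wK.rho y j else if j \<in> J then - y j else 0)" for y j
    using KJ w(2)[of j] by (auto simp: rho_def wK.rho_def)
  have Qrho: "Q (rho y) = Q (wK.rho y)" for y
    by (rule cpoly_local[OF fin monogenic_hom_K(1)[OF Q]]) (simp add: rho)
  have z: "zc (rho y) = - zc y" for y
    using K in_J by (simp add: zc_def rho complex_eq_iff)
  have mon: "kind_monomial \<tau> s k (- z) = (- 1) ^ (fst (kind_exps \<tau> s k) + snd (kind_exps \<tau> s k)) * kind_monomial \<tau> s k z" for z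
    unfolding kind_monomial_exps by (simp add: power_minus[of z] power_minus[of "cnj z"] power_add)
  obtain e :: complex where e: "cvec K w * X = scal e * X * cvec K w"
  proof -
    note sw = gen_cvec_outside[OF K(1), of w] gen_cvec_outside[OF K(2), of w]
    have s: "cvec K w * c2 p q r t = c2 p (- q) (- r) t * cvec K w" for p q r t
    proof -
      have "cvec K w * (gen 1 * gen 2) = gen 1 * gen 2 * cvec K w"
        by (simp add: mult_swap_neg_assoc[OF sw(1)] sw(2) mult.assoc)
      then show ?thesis
        by (simp add: c2_def e12_def distrib_left distrib_right left_diff_distrib right_diff_distrib scal_left_commute[of "cvec K w"] sw
            mult.assoc scal_uminus scal_central[symmetric])
    qed
    have "X \<in> {Iplus, Iminus} \<or> X \<in> {Tplus, Tminus}" using X by (cases \<tau>) auto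
    then show ?thesis
    proof
      assume "X \<in> {Iplus, Iminus}"
      then have "cvec K w * X = scal 1 * X * cvec K w"
        by (auto simp: c2_units' s scal_one)
      then show ?thesis by (rule that)
    next
      assume "X \<in> {Tplus, Tminus}"
      then have "cvec K w * X = scal (- 1) * X * cvec K w"
        by (auto simp: c2_units' s c2_scal)
      then show ?thesis by (rule that)
    qed
  qed
  define c where "c = (- 1) ^ (fst (kind_exps \<tau> s k) + snd (kind_exps \<tau> s k)) * e"
  have Q': "wK.refl Q \<in> monogenic_hom K i" by (rule wK.refl_monogenic_hom[OF Q])
  have "refl (ap (kop \<tau> s k X) Q) = cscale c (ap (kop \<tau> s k X) (wK.refl Q))"
  proof
    fix y
    have "refl (ap (kop \<tau> s k X) Q) y = scal (kind_monomial \<tau> s k (- zc y)) * (cvec K w * X) * Q (wK.rho y)"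
      unfolding ap_kop[OF X Q] refl_def by (simp add: w(3) z Qrho mult.assoc scal_left_commute[of "cvec K w"])
    also have "\<dots> = scal c * (scal (kind_monomial \<tau> s k (zc y)) * X * (cvec K w * Q (wK.rho y)))"
      unfolding e mon c_def by (simp add: scal_mult mult.assoc scal_scal_commute[of e])
    finally show "refl (ap (kop \<tau> s k X) Q) y = cscale c (ap (kop \<tau> s k X) (wK.refl Q)) y"
      unfolding ap_kop[OF X Q'] by (simp add: cscale_def wK.refl_def)
  qed
  then show "\<exists>c X' Q'. X' \<in> kind_factors \<tau> \<and> Q' \<in> monogenic_hom K i \<and>
      refl (ap (kop \<tau> s k X) Q) = cscale c (ap (kop \<tau> s k X') Q')"
    using X Q' by blast
qed

text \<open>A reflection in the plane sends \<open>z\<close> to a multiple of its conjugate and exchanges \<open>I\<^sub>\<plusminus>\<close> with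
  \<open>T\<^sub>\<mp>\<close>, so it exchanges the types (a), (b) and the types (c), (d).\<close>

lemma refl_summand_plane:
  assumes w: "unit_vector J w" "\<And>j. j \<notin> {1, 2} \<Longrightarrow> w j = 0" "cvec J w = cvec {1, 2} w"
      "(\<Sum>j\<in>{1, 2}. (w j)\<^sup>2) = 1"
    and P: "P \<in> summand m \<tau> s k i"
  shows "unit_vector.refl J w P \<in> summand m (flip_kind \<tau>) s k i"
proof (rule refl_summand[OF w(1) _ P])
  interpret unit_vector J w by (rule w(1))
  fix X Q assume X: "X \<in> kind_factors \<tau>" and Q: "Q \<in> monogenic_hom K i"
  have n: "(w 1)\<^sup>2 + (w 2)\<^sup>2 = 1" using w(4) by simp
  define \<omega> where "\<omega> = Complex (w 1) (w 2)"
  have s: "(\<Sum>k\<in>J. y k * w k) = y 1 * w 1 + y 2 * w 2" for y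
  proof -
    have "(\<Sum>k\<in>J. y k * w k) = (\<Sum>k\<in>{1, 2}. y k * w k)"
      using finite_J in_J w(2) by (intro sum.mono_neutral_right) auto
    then show ?thesis by simp
  qed
  \<comment> \<open>The reflection of the plane in the line through the unit complex number
    \<open>\<omega>\<close>.\<close>
  have z: "zc (rho y) = cnj (zc y) * \<omega>\<^sup>2" for y
  proof -
    have w2: "(w 2)\<^sup>2 = 1 - (w 1)\<^sup>2" using n by simp
    have "rho y 1 = 2 * (y 1 * w 1 + y 2 * w 2) * w 1 - y 1" "rho y 2 = 2 * (y 1 * w 1 + y 2 * w 2) * w 2 - y 2"
      using in_J by (simp_all add: rho_def s)
    moreover have "2 * (y 1 * w 1 + y 2 * w 2) * w 1 - y 1 = y 1 * ((w 1)\<^sup>2 - (w 2)\<^sup>2) + y 2 * (2 * w 1 * w 2)"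
      unfolding w2 by (simp add: algebra_simps power2_eq_square)
    moreover have "2 * (y 1 * w 1 + y 2 * w 2) * w 2 - y 2 = y 1 * (2 * w 1 * w 2) - y 2 * ((w 1)\<^sup>2 - (w 2)\<^sup>2)"
    proof -
      have "y 2 * ((w 1)\<^sup>2 + (w 2)\<^sup>2) = y 2" by (simp add: n)
      then show ?thesis by (simp add: algebra_simps power2_eq_square)
    qed
    ultimately show ?thesis
      by (simp add: zc_def \<omega>_def complex_eq_iff power2_eq_square algebra_simps)
  qed
  \<comment> \<open>Outside the plane \<open>rho\<close> is -1, so homogeneity of \<open>Q\<close>
    gives the sign.\<close>
  have Qrho: "Q (rho y) = scal ((- 1) ^ i) * Q y" for y
  proof -
    have "Q (rho y) = Q (\<lambda>j. - 1 * y j)"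
      by (rule cpoly_local[OF fin monogenic_hom_K(1)[OF Q]]) (use w(2) K KJ in \<open>force simp: rho_def\<close>)
    also have "\<dots> = scal (of_real ((- 1) ^ i)) * Q y"
      using Q unfolding monogenic_hom_def by blast
    finally show ?thesis by simp
  qed
  obtain \<alpha> X' where X': "X' \<in> kind_factors (flip_kind \<tau>)" "cvec J w * X = scal \<alpha> * X'"
  proof -
    have c: "cvec J w = c2 0 (of_real (w 1)) (of_real (w 2)) 0"
      by (simp add: w(3)) (simp add: cvec_def c2_def)
    note d = c c2_mult c2_scal c2_units'
    have "cvec J w * Iplus = scal (of_real (w 1) + \<i> * of_real (w 2)) * Tminus"
      "cvec J w * Tplus = scal (- (of_real (w 1) + \<i> * of_real (w 2))) * Iminus"
      "cvec J w * Iminus = scal (of_real (w 1) - \<i> * of_real (w 2)) * Tplus"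
      "cvec J w * Tminus = scal (- (of_real (w 1) - \<i> * of_real (w 2))) * Iplus"
      by (simp_all only: d) (rule c2_cong; simp add: field_simps)+
    then show ?thesis using X that by (cases \<tau>) auto
  qed
  \<comment> \<open>Each monomial is multiplicative in its argument, and conjugating the argument
    exchanges the kinds as \<open>flip_kind\<close> does.\<close>
  obtain \<beta> where \<beta>: "\<And>z. kind_monomial \<tau> s k (cnj z * \<omega>\<^sup>2) = \<beta> * kind_monomial (flip_kind \<tau>) s k z"
  proof (rule that[of "kind_monomial \<tau> s k (\<omega>\<^sup>2)"])
    show "kind_monomial \<tau> s k (cnj z * \<omega>\<^sup>2) = kind_monomial \<tau> s k (\<omega>\<^sup>2) * kind_monomial (flip_kind \<tau>) s k z" for z
      by (cases \<tau>) (simp_all add: power_mult_distrib)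
  qed
  have "refl (ap (kop \<tau> s k X) Q) = cscale (\<beta> * \<alpha> * (- 1) ^ i) (ap (kop (flip_kind \<tau>) s k X') Q)"
  proof
    fix y
    have "refl (ap (kop \<tau> s k X) Q) y =
        scal (kind_monomial \<tau> s k (cnj (zc y) * \<omega>\<^sup>2)) * (cvec J w * X) * (scal ((- 1) ^ i) * Q y)"
      unfolding ap_kop[OF X Q] refl_def z Qrho by (simp add: mult.assoc scal_left_commute[of "cvec J w"])
    also have "\<dots> = scal (\<beta> * \<alpha> * (- 1) ^ i) * (scal (kind_monomial (flip_kind \<tau>) s k (zc y)) * X' * Q y)"
      unfolding X'(2) \<beta>
      by (simp add: scal_mult mult.assoc scal_left_commute[of X'] scal_scal_commute)
    finally show "refl (ap (kop \<tau> s k X) Q) y = cscale (\<beta> * \<alpha> * (- 1) ^ i) (ap (kop (flip_kind \<tau>) s k X') Q) y"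
      unfolding ap_kop[OF X'(1) Q] by (simp add: cscale_def)
  qed
  then show "\<exists>c X' Q'. X' \<in> kind_factors (flip_kind \<tau>) \<and> Q' \<in> monogenic_hom K i \<and>
      refl (ap (kop \<tau> s k X) Q) = cscale c (ap (kop (flip_kind \<tau>) s k X') Q')"
    using X' Q by blast
qed

lemma Lact_prod_K:
  assumes "set ws \<subseteq> unit_vecs K" "P \<in> summand m \<tau> s k i"
  shows "Lact J (prod_list ws) P \<in> summand m \<tau> s k i"
  using assms(1)
proof (induction ws)
  case Nil
  have "P \<in> cpoly J" using assms(2) summand_monogenic monogenic_J(1) by blast
  then show ?case using assms(2) Lact_one[OF finite_J] by simp
next
  case (Cons c ws)
  then have c: "c \<in> unit_vecs K" and ws: "set ws \<subseteq> unit_vecs K" by auto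
  obtain w where w: "unit_vector J w" "\<And>j. j \<notin> K \<Longrightarrow> w j = 0" "c = cvec J w"
    "cvec J w = cvec K w" "(\<Sum>j\<in>K. (w j)\<^sup>2) = 1"
    using unit_vecs_restrict[OF KJ c] by blast
  obtain t where t: "prod_list ws * t = 1" "t * prod_list ws = 1"
    using unit_vecs_prod_inverse[OF fin ws] by blast
  show ?case
    using refl_summand_K[OF w(1,2,4,5) Cons.IH[OF ws]] unit_vector.Lact_mult[OF w(1) t]
    by (simp add: w(3))
qed

text \<open>The plane vectors are peeled off from the left, with the factor \<open>h\<close> from
  R^K already dealt with. Every one of them flips the kind, and for spin elements the number of
  flips is even.\<close>

lemma Lact_prod_plane:
  assumes "set ws \<subseteq> unit_vecs {1, 2}" "h * t = 1" "t * h = 1" "Lact J h P \<in> summand m \<tau> s k i"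
  shows "Lact J (prod_list ws * h) P \<in> summand m ((flip_kind ^^ length ws) \<tau>) s k i"
  using assms(1)
proof (induction ws)
  case (Cons c ws)
  then have c: "c \<in> unit_vecs {1, 2}" and ws: "set ws \<subseteq> unit_vecs {1, 2}" by auto
  have sub: "{1, 2} \<subseteq> J" using in_J by simp
  obtain w where w: "unit_vector J w" "\<And>j. j \<notin> {1, 2} \<Longrightarrow> w j = 0" "c = cvec J w"
    "cvec J w = cvec {1, 2} w" "(\<Sum>j\<in>{1, 2}. (w j)\<^sup>2) = 1"
    using unit_vecs_restrict[OF sub c] by blast
  obtain r where r: "prod_list ws * r = 1" "r * prod_list ws = 1"
    using unit_vecs_prod_inverse[OF _ ws] by blast
  have "prod_list ws * h * (t * r) = prod_list ws * (h * t) * r"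
    "t * r * (prod_list ws * h) = t * (r * prod_list ws) * h"
    by (simp_all only: mult.assoc)
  then have "prod_list ws * h * (t * r) = 1" "t * r * (prod_list ws * h) = 1"
    by (simp_all only: assms r mult_1_right)
  from unit_vector.Lact_mult[OF w(1) this] refl_summand_plane[OF w(1,2,4,5) Cons.IH[OF ws]]
  show ?case by (simp add: w(3) mult.assoc)
qed (use assms in simp)

lemma spin_invariant:
  assumes "g \<in> Spin {1, 2}" "h \<in> Spin K" "P \<in> summand m \<tau> s k i"
  shows "Lact J (g * h) P \<in> summand m \<tau> s k i"
proof -
  obtain ws where ws: "g = prod_list ws" "even (length ws)" "set ws \<subseteq> unit_vecs {1, 2}"
    using assms(1) by (auto simp: Spin_def)
  obtain vs where vs: "h = prod_list vs" "set vs \<subseteq> unit_vecs K"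
    using assms(2) by (auto simp: Spin_def)
  obtain t where t: "h * t = 1" "t * h = 1"
    using unit_vecs_prod_inverse[OF fin vs(2)] vs(1) by blast
  have "Lact J h P \<in> summand m \<tau> s k i"
    unfolding vs(1) by (rule Lact_prod_K[OF vs(2) assms(3)])
  from Lact_prod_plane[OF ws(3) t this] show ?thesis
    by (simp add: flip_kind_even[OF ws(2)] ws(1))
qed

section \<open>Commutation of the three operators and the final eigenvalues\<close>

lemma commute_ops:
  "commute_on (cpoly J) S_u (S_v m)" "commute_on (cpoly J) S_u (S_x m)" "commute_on (cpoly J) (S_v m) (S_x m)"
proof -
  let ?u = "su" and ?v = "sv K" and ?x = "sc (1/2) * scas J"
  have eq: "S_u P = ap ?u P" "S_v m P = ap ?v P" "S_x m P = ap ?x P" if "P \<in> cpolys" for P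
    using that m by (simp_all only: S_u_eq S_v_eq S_x_eq su_def)
  have "?u * ?v = ?v * ?u"
    unfolding su_def using mo_sv by (metis mult.assoc sc_commute)
  moreover have "?u * ?x = ?x * ?u"
  proof -
    have "su * scas J = scas J * su" unfolding su_def using mo_scas_J by (metis mult.assoc sc_commute)
    then show ?thesis by (intro commute_mult sc_commute[symmetric])
  qed
  moreover have "?v * ?x = ?x * ?v"
    by (intro commute_mult sc_commute[symmetric] sv_scas_J)
  moreover have "commute_on (cpoly J) S T"
    if "A * B = B * A" "\<And>P. P \<in> cpolys \<Longrightarrow> S P = ap A P" "\<And>P. P \<in> cpolys \<Longrightarrow> T P = ap B P" for A B S T
    unfolding commute_on_def
  proof
    fix P assume "P \<in> cpoly J"
    then have P: "P \<in> cpolys" by (rule J_cpolys)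
    have "S (T P) = ap (A * B) P" "T (S P) = ap (B * A) P"
      by (simp_all only: that(2,3) P ap_in ap_ring(6))
    then show "S (T P) = T (S P)" by (simp only: that(1))
  qed
  ultimately show "commute_on (cpoly J) S_u (S_v m)" "commute_on (cpoly J) S_u (S_x m)"
    "commute_on (cpoly J) (S_v m) (S_x m)"
    using eq by blast+
qed

lemma summand_joint_eigenvectors:
  assumes "a = of_int (eig_u \<tau> k) / 2" "b = of_int (eig_v m \<tau> i) / 2" "c = of_int (eig_x m \<tau> s k i) / 2"
  shows "joint_eigenvectors m (summand m \<tau> s k i) a b c"
  unfolding joint_eigenvectors_def
proof
  fix P assume P: "P \<in> summand m \<tau> s k i"
  then have V: "P \<in> cpolys" using summand_monogenic monogenic_J(2) by blast
  note e = summand_eigen[OF P]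
  have "S_u P = ap su P" "S_v m P = ap (sv K) P" "S_x m P = cscale (1/2) (ap (scas J) P)"
    using V m by (simp_all add: S_u_eq S_v_eq S_x_eq su_def)
  then show "S_u P = cscale a P \<and> S_v m P = cscale b P \<and> S_x m P = cscale c P"
    unfolding e assms by simp
qed

end

theorem theorem14:
  fixes m :: nat
  assumes "m \<ge> 3"
  shows
    "direct_sum_of (monogenic {1..m}) (\<lambda>(\<tau>, s, k, i). summand m \<tau> s k i) \<and>
     (\<forall>\<tau> s k i \<tau>' s' k' i'. summand m \<tau> s k i \<noteq> {0} \<and>
        summand m \<tau> s k i = summand m \<tau>' s' k' i' \<longrightarrow> (\<tau>, s, k, i) = (\<tau>', s', k', i')) \<and>
     (\<forall>\<tau> s k i. \<forall>g\<in>Spin {1, 2}. \<forall>h\<in>Spin {3..m}.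
        Lact {1..m} (g * h) ` summand m \<tau> s k i \<subseteq> summand m \<tau> s k i) \<and>
     commute_on (cpoly {1..m}) S_u (S_v m) \<and>
     commute_on (cpoly {1..m}) S_u (S_x m) \<and>
     commute_on (cpoly {1..m}) (S_v m) (S_x m) \<and>
     (\<forall>s k i.
        joint_eigenvectors m (summand m Ka s k i)
          (- (of_nat k + 1 / 2)) (- (of_nat i + (of_nat m - 3) / 2))
          (- (of_nat k + of_nat i + 2 * of_nat s + (of_nat m - 1) / 2)) \<and>
        joint_eigenvectors m (summand m Kb s k i)
          (of_nat k + 1 / 2) (of_nat i + (of_nat m - 3) / 2)
          (- (of_nat k + of_nat i + 2 * of_nat s + (of_nat m - 1) / 2)) \<and>
        joint_eigenvectors m (summand m Kc s k i)
          (- (of_nat k + 1 / 2)) (of_nat i + (of_nat m - 3) / 2)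
          (- (of_nat k + of_nat i + 2 * of_nat s + 1 + (of_nat m - 1) / 2)) \<and>
        joint_eigenvectors m (summand m Kd s k i)
          (of_nat k + 1 / 2) (- (of_nat i + (of_nat m - 3) / 2))
          (- (of_nat k + of_nat i + 2 * of_nat s + 1 + (of_nat m - 1) / 2)))"
proof -
  interpret spin_dims m by unfold_locales (rule assms)
  show ?thesis
  proof (intro conjI allI impI ballI)
    show "direct_sum_of (monogenic J) idx_summand" by (rule direct_sum)
    show "(\<tau>, s, k, i) = (\<tau>', s', k', i')"
      if "summand m \<tau> s k i \<noteq> {0} \<and> summand m \<tau> s k i = summand m \<tau>' s' k' i'" for \<tau> s k i \<tau>' s' k' i'
      using that summand_inj by blast
    show "Lact J (g * h) ` summand m \<tau> s k i \<subseteq> summand m \<tau> s k i"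
      if "g \<in> Spin {1, 2}" "h \<in> Spin K" for \<tau> s k i g h
      using spin_invariant[OF that] by blast
  qed (intro commute_ops summand_joint_eigenvectors;
      simp add: eig_u_def eig_v_def eig_x_def field_simps)+
qed

end
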